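(* Let $w\in\mathfrak S_n$ be a $321$-avoiding permutation. The following statements are equivalent: (1) The Temperley-Lieb immanant $\operatorname{Imm}_w$ is a ($\mathbb C$-)linear combination of \%-immanants (of degree $n$). (2) The signed Temperley-Lieb immanant $\operatorname{sgn}(w)\operatorname{Imm}_w$ is a sum of at most two \%-immanants (of degree $n$). (3) The permutation $w$ avoids the patterns $1324$, $24153$, $31524$, $231564$ and $312645$, in addition to avoiding $321$.
   Context: Notation. $[n]=\{1,\dots,n\}$; $\mathfrak S_n$ is the symmetric group on $[n]$ with product $(v\cdot w)(i)=v(w(i))$; $s_i=(i,i+1)$ for $1\le i\le n-1$. Permutations and patterns are written in one-line notation. $x_{i,j}$ ($1\le i,j\le n$) are $n^2$ commuting variables, and for $u\in\mathfrak S_n$ put $x_u=\prod_{i=1}^n x_{i,u(i)}$. Pattern avoidance. For $w\in\mathfrak S_n$ and $I\subset[n]$, $w|_I\in\mathfrak S_{|I|}$ is the permutation such that $w$ maps the $i$-th smallest element of $I$ to the $w|_I(i)$-th smallest element of $w(I)$. $w$ avoids $v\in\mathfrak S_m$ if there is no $I\subset[n]$ with $|I|=m$ and $w|_I=v$ (in particular if $m>n$); otherwise $w$ contains $v$. Temperley-Lieb immanants. $TL_n(2)$ is the unital associative $\mathbb C$-algebra generated by $t_1,\dots,t_{n-1}$ with relations $t_i^2=2t_i$, $t_it_j=t_jt_i$ if $|i-j|\ge2$, and $t_it_jt_i=t_i$ if $|i-j|=1$. Let $\theta:\mathbb C[\mathfrak S_n]\to TL_n(2)$ be the $\mathbb C$-algebra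 homomorphism with $\theta(s_i)=t_i-1$. For a $321$-avoiding $w\in\mathfrak S_n$ with reduced word $s_{i_1}\cdots s_{i_k}$, put $\beta(w)=t_{i_1}\cdots t_{i_k}$; this does not depend on the reduced word, and the $\beta(w)$, over $321$-avoiding $w\in\mathfrak S_n$, form a basis of $TL_n(2)$. For $u\in\mathfrak S_n$ let $f_w(u)$ be the coefficient of $\beta(w)$ in the expansion of $\theta(u)$ in this basis. The Temperley-Lieb immanant of a $321$-avoiding $w$ is $\operatorname{Imm}_w=\sum_{u\in\mathfrak S_n}f_w(u)x_u$. \%-immanants. A skew shape $\lambda/\mu$ (in the $n\times n$ square) is given by non-increasing sequences of non-negative integers $\lambda=(\lambda_1,\dots,\lambda_n)$, $\mu=(\mu_1,\dots,\mu_n)$ with $\mu_i\le\lambda_i\le n$; it is identified with the set of cells $(i,j)$ with $\mu_i<j\le\lambda_i$. A permutation $\sigma\in\mathfrak S_n$ lies in $\lambda/\mu$ if $\mu_i<\sigma(i)\le\lambda_i$ for all $1\le i\le n$. The \%-immanant (of degree $n$) of $\lambda/\mu$ is $\operatorname{Imm}^{\%}_{\lambda/\mu}=\sum_{\sigma}\operatorname{sgn}(\sigma)x_\sigma$, summed over all $\sigma\in\mathfrak S_n$ lying in $\lambda/\mu$. *)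

theory Defs
  imports Complex_Main "HOL-Library.Poly_Mapping" "HOL-Algebra.Sym_Groups" "HOL-Algebra.QuotRing"
    "HOL-Algebra.Module"
begin

section \<open>Permutations and pattern avoidance\<close>

text \<open>
  The symmetric group on $[n]$ is \<^const>\<open>sym_group\<close>: its elements are the functions
  on \<^typ>\<open>nat\<close> that permute \<open>{1..n}\<close> (and fix every other number), its product is \<open>(\<circ>)\<close>.
\<close>

abbreviation simple_transposition :: "nat \<Rightarrow> nat \<Rightarrow> nat"
  where "simple_transposition i \<equiv> Transposition.transpose i (Suc i)"

definition nth_smallest :: "nat set \<Rightarrow> nat \<Rightarrow> nat"
  where "nth_smallest A i = sorted_list_of_set A ! (i - 1)"

text \<open>
  A pattern is given in one-line notation, as the list \<open>v\<close> of its values. For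
  \<open>card I = length v\<close>, the inner condition of the following definition says $w|_I = v$.
\<close>

definition contains_pattern :: "nat \<Rightarrow> (nat \<Rightarrow> nat) \<Rightarrow> nat list \<Rightarrow> bool"
  where "contains_pattern n w v \<longleftrightarrow>
    (\<exists>I \<subseteq> {1..n}. card I = length v \<and>
      (\<forall>i \<in> {1..length v}. w (nth_smallest I i) = nth_smallest (w ` I) (v ! (i - 1))))"

abbreviation avoids_pattern :: "nat \<Rightarrow> (nat \<Rightarrow> nat) \<Rightarrow> nat list \<Rightarrow> bool"
  where "avoids_pattern n w v \<equiv> \<not> contains_pattern n w v"

definition avoiders_321 :: "nat \<Rightarrow> (nat \<Rightarrow> nat) set"
  where "avoiders_321 n = {w. w permutes {1..n} \<and> avoids_pattern n w [3, 2, 1]}"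

text \<open>The word $s_{i_1} \cdots s_{i_k}$ is represented by the list of its indices.\<close>

definition word_perm :: "nat list \<Rightarrow> nat \<Rightarrow> nat"
  where "word_perm is = foldr (\<lambda>i p. simple_transposition i \<circ> p) is id"

definition reduced_word :: "nat \<Rightarrow> (nat \<Rightarrow> nat) \<Rightarrow> nat list \<Rightarrow> bool"
  where "reduced_word n w is \<longleftrightarrow>
    is \<in> lists {1..<n} \<and> word_perm is = w \<and>
    (\<forall>js \<in> lists {1..<n}. word_perm js = w \<longrightarrow> length is \<le> length js)"


section \<open>Associative algebras over the complex numbers\<close>

text \<open>
  A \<open>\<complex>\<close>-algebra is represented by a record of type \<^type>\<open>module\<close>, which extends
  the ring operations by a scalar multiplication.
\<close>

definition algebra_hom ::
    "(complex, 'a, 'm) module_scheme \<Rightarrow> (complex, 'b, 'k) module_scheme \<Rightarrow> ('a \<Rightarrow> 'b) set"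
  where "algebra_hom A B =
    {h \<in> ring_hom A B. \<forall>c. \<forall>a \<in> carrier A. h (c \<odot>\<^bsub>A\<^esub> a) = c \<odot>\<^bsub>B\<^esub> h a}"

definition monoid_algebra ::
    "('g, 'm) monoid_scheme \<Rightarrow> (complex, 'g \<Rightarrow>\<^sub>0 complex) module"
  where "monoid_algebra G =
    \<lparr>carrier = {p. Poly_Mapping.keys p \<subseteq> carrier G},
     mult = (\<lambda>p q. \<Sum>v \<in> Poly_Mapping.keys p. \<Sum>w \<in> Poly_Mapping.keys q.
       Poly_Mapping.single (v \<otimes>\<^bsub>G\<^esub> w) (Poly_Mapping.lookup p v * Poly_Mapping.lookup q w)),
     one = Poly_Mapping.single \<one>\<^bsub>G\<^esub> 1,
     zero = 0,
     add = (+),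
     smult = (\<lambda>c p. Poly_Mapping.map ((*) c) p)\<rparr>"

abbreviation group_algebra :: "nat \<Rightarrow> (complex, (nat \<Rightarrow> nat) \<Rightarrow>\<^sub>0 complex) module"
  where "group_algebra n \<equiv> monoid_algebra (sym_group n)"

definition free_monoid :: "'a set \<Rightarrow> 'a list monoid"
  where "free_monoid A = \<lparr>carrier = lists A, mult = (@), one = []\<rparr>"

text \<open>The free unital associative \<open>\<complex>\<close>-algebra on the generators $t_1, \dots, t_{n-1}$.\<close>

abbreviation free_algebra :: "nat \<Rightarrow> (complex, nat list \<Rightarrow>\<^sub>0 complex) module"
  where "free_algebra n \<equiv> monoid_algebra (free_monoid {1..<n})"

definition quotient_algebra ::
    "(complex, 'a, 'm) module_scheme \<Rightarrow> 'a set \<Rightarrow> (complex, 'a set) module"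
  where "quotient_algebra A J =
    ring.extend (A Quot J) \<lparr>smult = (\<lambda>c X. \<Union>x \<in> X. J +>\<^bsub>A\<^esub> (c \<odot>\<^bsub>A\<^esub> x))\<rparr>"


section \<open>The Temperley-Lieb algebra\<close>

definition tl_relators :: "nat \<Rightarrow> (nat list \<Rightarrow>\<^sub>0 complex) set"
  where "tl_relators n =
    {Poly_Mapping.single [i, i] 1 - Poly_Mapping.single [i] 2 | i. i \<in> {1..<n}} \<union>
    {Poly_Mapping.single [i, j] 1 - Poly_Mapping.single [j, i] 1 | i j.
      i \<in> {1..<n} \<and> j \<in> {1..<n} \<and> \<bar>int i - int j\<bar> \<ge> 2} \<union>
    {Poly_Mapping.single [i, j, i] 1 - Poly_Mapping.single [i] 1 | i j.
      i \<in> {1..<n} \<and> j \<in> {1..<n} \<and> \<bar>int i - int j\<bar> = 1}"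

definition tl_ideal :: "nat \<Rightarrow> (nat list \<Rightarrow>\<^sub>0 complex) set"
  where "tl_ideal n = Idl\<^bsub>free_algebra n\<^esub> (tl_relators n)"

definition TL :: "nat \<Rightarrow> (complex, (nat list \<Rightarrow>\<^sub>0 complex) set) module"
  where "TL n = quotient_algebra (free_algebra n) (tl_ideal n)"

definition tl_gen :: "nat \<Rightarrow> nat \<Rightarrow> (nat list \<Rightarrow>\<^sub>0 complex) set"
  where "tl_gen n i = tl_ideal n +>\<^bsub>free_algebra n\<^esub> Poly_Mapping.single [i] 1"

text \<open>
  The algebra homomorphism \<open>\<theta>\<close> is determined by its values on the generators; only
  its restriction to the carrier of the group algebra is meaningful.
\<close>

definition tl_theta ::
    "nat \<Rightarrow> ((nat \<Rightarrow> nat) \<Rightarrow>\<^sub>0 complex) \<Rightarrow> (nat list \<Rightarrow>\<^sub>0 complex) set"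
  where "tl_theta n = (SOME h. h \<in> algebra_hom (group_algebra n) (TL n) \<and>
    (\<forall>i \<in> {1..<n}. h (Poly_Mapping.single (simple_transposition i) 1) =
      tl_gen n i \<ominus>\<^bsub>TL n\<^esub> \<one>\<^bsub>TL n\<^esub>))"

definition tl_basis :: "nat \<Rightarrow> (nat \<Rightarrow> nat) \<Rightarrow> (nat list \<Rightarrow>\<^sub>0 complex) set"
  where "tl_basis n w =
    foldr (\<lambda>i x. tl_gen n i \<otimes>\<^bsub>TL n\<^esub> x) (SOME is. reduced_word n w is) \<one>\<^bsub>TL n\<^esub>"

text \<open>Coordinates with respect to the basis; only their values on \<^const>\<open>avoiders_321\<close> matter.\<close>

definition tl_coordinates ::
    "nat \<Rightarrow> (nat list \<Rightarrow>\<^sub>0 complex) set \<Rightarrow> (nat \<Rightarrow> nat) \<Rightarrow> complex"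
  where "tl_coordinates n a =
    (SOME c. a = (\<Oplus>\<^bsub>TL n\<^esub> w \<in> avoiders_321 n. c w \<odot>\<^bsub>TL n\<^esub> tl_basis n w))"

definition tl_coefficient :: "nat \<Rightarrow> (nat \<Rightarrow> nat) \<Rightarrow> (nat \<Rightarrow> nat) \<Rightarrow> complex"
  where "tl_coefficient n w u =
    tl_coordinates n (tl_theta n (Poly_Mapping.single u 1)) w"


section \<open>Immanants\<close>

text \<open>
  Polynomials in the variables $x_{i,j}$ are finitely supported functions from monomials to
  coefficients, and monomials are finitely supported functions from index pairs to exponents.
\<close>

type_synonym matrix_poly = "((nat \<times> nat) \<Rightarrow>\<^sub>0 nat) \<Rightarrow>\<^sub>0 complex"

definition const_poly :: "complex \<Rightarrow> matrix_poly"
  where "const_poly c = Poly_Mapping.single 0 c"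

definition var_poly :: "nat \<Rightarrow> nat \<Rightarrow> matrix_poly"
  where "var_poly i j = Poly_Mapping.single (Poly_Mapping.single (i, j) 1) 1"

definition perm_monomial :: "nat \<Rightarrow> (nat \<Rightarrow> nat) \<Rightarrow> matrix_poly"
  where "perm_monomial n u = (\<Prod>i \<in> {1..n}. var_poly i (u i))"

definition tl_immanant :: "nat \<Rightarrow> (nat \<Rightarrow> nat) \<Rightarrow> matrix_poly"
  where "tl_immanant n w =
    (\<Sum>u | u permutes {1..n}. const_poly (tl_coefficient n w u) * perm_monomial n u)"

text \<open>
  A skew shape is given by two functions of which only the values on \<open>{1..n}\<close> are used.
\<close>

definition skew_shape :: "nat \<Rightarrow> (nat \<Rightarrow> nat) \<Rightarrow> (nat \<Rightarrow> nat) \<Rightarrow> bool"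
  where "skew_shape n l m \<longleftrightarrow>
    antimono_on {1..n} l \<and> antimono_on {1..n} m \<and>
    (\<forall>i \<in> {1..n}. m i \<le> l i \<and> l i \<le> n)"

definition lies_in :: "nat \<Rightarrow> (nat \<Rightarrow> nat) \<Rightarrow> (nat \<Rightarrow> nat) \<Rightarrow> (nat \<Rightarrow> nat) \<Rightarrow> bool"
  where "lies_in n l m s \<longleftrightarrow> (\<forall>i \<in> {1..n}. m i < s i \<and> s i \<le> l i)"

definition percent_immanant :: "nat \<Rightarrow> (nat \<Rightarrow> nat) \<Rightarrow> (nat \<Rightarrow> nat) \<Rightarrow> matrix_poly"
  where "percent_immanant n l m =
    (\<Sum>s | s permutes {1..n} \<and> lies_in n l m s. of_int (sign s) * perm_monomial n s)"

definition percent_immanants :: "nat \<Rightarrow> matrix_poly set"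
  where "percent_immanants n = {percent_immanant n l m | l m. skew_shape n l m}"

definition is_linear_combination :: "matrix_poly \<Rightarrow> matrix_poly set \<Rightarrow> bool"
  where "is_linear_combination f S \<longleftrightarrow>
    (\<exists>T c. finite T \<and> T \<subseteq> S \<and> f = (\<Sum>p \<in> T. const_poly (c p) * p))"

text \<open>The sum is over a list, so that a summand may be repeated; the empty sum is allowed.\<close>

definition is_sum_of_at_most :: "nat \<Rightarrow> matrix_poly \<Rightarrow> matrix_poly set \<Rightarrow> bool"
  where "is_sum_of_at_most k f S \<longleftrightarrow>
    (\<exists>ps. length ps \<le> k \<and> set ps \<subseteq> S \<and> f = sum_list ps)"

end

theory Submission
  imports Defs
begin

text \<open>
  Twisting \<open>\<theta>\<close> by the sign gives the homomorphism with $s_i \mapsto 1 - t_i$, whose kernel is generated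
  by the alternating sums of the permutations of three positions. Hence the functions
  $u \mapsto \mathrm{sgn}(u) f_w(u)$ form a basis of the space of all functions on the symmetric group
  that are annihilated by these alternating sums, and it is dual to the products of factors
  $1 - s_i$ along reduced words of 321-avoiding permutations. Moreover, $f_w(u) = 0$ unless $w \le u$ in
  the Bruhat order.

  If $\mathrm{Imm}_w$ is a linear combination of percent immanants, then $\mathrm{sgn}(u) f_w(u)$ depends
  only on the set of skew shapes in which \<open>u\<close> lies. If \<open>w\<close> contained one of the patterns, then the
  relations at triples of positions of the pattern would force $f_w(w) = 0$.

  Conversely, if \<open>w\<close> avoids the patterns, then it is increasing on each of three blocks of rows and,
  likewise, of columns, and it lies in the square without a rectangle in the upper left and one in the
  lower right corner. The indicator function of this skew shape, possibly increased by that of a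
  narrower shape, satisfies all the relations, takes the value 1 at \<open>w\<close>, and is annihilated by the
  products that belong to the other basis elements; so it is $\mathrm{sgn}(w)\,\mathrm{sgn}(u) f_w(u)$.
\<close>

text \<open>The obstacle is that \<open>TL n\<close> is a bare quotient of a free algebra: neither
  the independence of the basis nor the existence of theta can be read off. Both are settled by
  letting the letter i act on functions on the symmetric group through right multiplication by 1 -
  s_i. The relation ideal turns out to consist of everything that kills the functions obeying the
  alternating-sum relations, so equality in the quotient becomes equality of actions, while the
  group algebra acts by sign-twisted translations.

  The block sizes come from the rows of the values 1 and n and from w(1) and w(n). Avoiding 321 and
  1324 yields the monotone blocks and the two empty corners; 24153 and 31524 clear the two opposite
  corner blocks; 231564 and 312645 make some block sizes equal to 1. One shape suffices if rows or
  columns occupy only two classes. Otherwise three distinct classes can meet, the corner shape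
  leaves the alternating sum 1 + 1 - 1, and the second shape supplies the missing -1.\<close>

declare One_nat_def [simp del]

section \<open>Rank functions and the Bruhat order\<close>

text \<open>Position 0 is counted too. Permutations of \<open>{1..n}\<close> fix 0, so all their
  ranks are shifted by the same 1 and comparisons are unaffected, while the recursion over rows can
  start at 0.\<close>

definition rank_count :: "(nat \<Rightarrow> nat) \<Rightarrow> nat \<Rightarrow> nat \<Rightarrow> nat"
  where "rank_count u a b = card {k. k \<le> a \<and> u k \<le> b}"

text \<open>The rank-matrix criterion, taken as the definition of Bruhat order: going up in the
  order makes ranks smaller.\<close>

definition bruhat_le :: "(nat \<Rightarrow> nat) \<Rightarrow> (nat \<Rightarrow> nat) \<Rightarrow> bool"
  where "bruhat_le u v \<longleftrightarrow> (\<forall>a b. rank_count v a b \<le> rank_count u a b)"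

lemma bruhat_le_refl [simp]: "bruhat_le u u"
  by (simp add: bruhat_le_def)

lemma bruhat_le_trans: "bruhat_le u v \<Longrightarrow> bruhat_le v w \<Longrightarrow> bruhat_le u w"
  unfolding bruhat_le_def using le_trans by blast

lemma rank_count_0: "rank_count u 0 b = (if u 0 \<le> b then 1 else 0)"
proof -
  have "{k. k \<le> 0 \<and> u k \<le> b} = (if u 0 \<le> b then {0} else {})" by auto
  then show ?thesis by (simp add: rank_count_def)
qed

lemma rank_count_Suc:
  "rank_count u (Suc a) b = rank_count u a b + (if u (Suc a) \<le> b then 1 else 0)"
proof -
  have "{k. k \<le> Suc a \<and> u k \<le> b} =
      (if u (Suc a) \<le> b then insert (Suc a) {k. k \<le> a \<and> u k \<le> b} else {k. k \<le> a \<and> u k \<le> b})"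
    by (auto simp: le_Suc_eq)
  then show ?thesis by (simp add: rank_count_def)
qed

lemma rank_count_transpose_outside:
  assumes "a < i \<and> a < j \<or> i \<le> a \<and> j \<le> a"
  shows "rank_count (u \<circ> Transposition.transpose i j) a b = rank_count u a b"
proof -
  let ?t = "Transposition.transpose i j"
  have *: "?t k \<le> a \<longleftrightarrow> k \<le> a" for k
    using assms by (auto simp: Transposition.transpose_def)
  have "{k. k \<le> a \<and> (u \<circ> ?t) k \<le> b} = ?t ` {k. k \<le> a \<and> u k \<le> b}" (is "?A = ?t ` ?B")
  proof (rule Set.set_eqI)
    fix k
    show "k \<in> ?A \<longleftrightarrow> k \<in> ?t ` ?B"
      using * by (auto simp: image_iff intro!: exI[of _ "?t k"])
  qed
  then show ?thesis
    unfolding rank_count_def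
    by (metis (no_types, lifting) bij_is_inj bij_transpose card_image inj_on_subset subset_UNIV)
qed

text \<open>Only the rows i, ..., j - 1 of the rank matrix change, and bringing the smaller value
  forward can only raise the counts there.\<close>

lemma bruhat_le_transpose:
  assumes "i < j" "u j < u i"
  shows "bruhat_le (u \<circ> Transposition.transpose i j) u"
  unfolding bruhat_le_def
proof (intro allI)
  fix a b
  let ?u = "u \<circ> Transposition.transpose i j"
  show "rank_count u a b \<le> rank_count ?u a b"
  proof (cases "a < i \<or> j \<le> a")
    case True
    then have "a < i \<and> a < j \<or> i \<le> a \<and> j \<le> a" using assms(1) by linarith
    then show ?thesis by (simp add: rank_count_transpose_outside)
  next
    case False
    then have "{k. k \<le> a \<and> u k \<le> b} \<subseteq> {k. k \<le> a \<and> ?u k \<le> b}"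
      using assms by (auto simp: Transposition.transpose_def)
    then show ?thesis
      unfolding rank_count_def by (intro card_mono) auto
  qed
qed

lemma bruhat_le_ascent:
  assumes "v i < v (Suc i)"
  shows "bruhat_le v (v \<circ> simple_transposition i)"
proof -
  have "bruhat_le ((v \<circ> simple_transposition i) \<circ> simple_transposition i) (v \<circ> simple_transposition i)"
    by (rule bruhat_le_transpose) (use assms in auto)
  then show ?thesis by (simp add: o_assoc [symmetric])
qed

text \<open>The lifting property. Only row i changes. If \<open>v (Suc i) \<le> b\<close>, then the
  ascent gives \<open>v i \<le> b\<close> as well and the comparison in row i + 1 suffices;
  otherwise the one in row i - 1 does.\<close>

lemma bruhat_le_lift:
  assumes "bruhat_le u v" "v i < v (Suc i)" "0 < i"
  shows "bruhat_le (u \<circ> simple_transposition i) (v \<circ> simple_transposition i)"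
  unfolding bruhat_le_def
proof (intro allI)
  fix a b
  let ?u = "u \<circ> simple_transposition i" and ?v = "v \<circ> simple_transposition i"
  have le: "rank_count v a b \<le> rank_count u a b" for a
    using assms(1) by (simp add: bruhat_le_def)
  show "rank_count ?v a b \<le> rank_count ?u a b"
  proof (cases "a = i")
    case False
    then show ?thesis using le by (subst (1 2) rank_count_transpose_outside) auto
  next
    case True
    obtain m where m: "i = Suc m" using assms(3) by (cases i) auto
    have step: "rank_count (w \<circ> simple_transposition i) i b + (if w i \<le> b then 1 else 0) =
        rank_count w m b + (if w i \<le> b then 1 else 0) + (if w (Suc i) \<le> b then 1 else 0)" for w
    proof -
      have "rank_count (w \<circ> simple_transposition i) (Suc i) b = rank_count w (Suc i) b"
        by (rule rank_count_transpose_outside) auto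
      then show ?thesis by (simp add: rank_count_Suc m)
    qed
    have "rank_count v (Suc i) b \<le> rank_count u (Suc i) b" by (rule le)
    then have *: "rank_count v m b + (if v i \<le> b then 1 else 0) + (if v (Suc i) \<le> b then 1 else 0)
        \<le> rank_count u m b + (if u i \<le> b then 1 else 0) + (if u (Suc i) \<le> b then 1 else 0)"
      by (simp add: rank_count_Suc m)
    have "rank_count v m b \<le> rank_count u m b" by (rule le)
    then show ?thesis using * step[of u] step[of v] assms(2) True
      by (auto split: if_splits)
  qed
qed

lemma bruhat_le_antisym:
  assumes "bruhat_le u v" "bruhat_le v u"
  shows "u = v"
proof
  fix a
  have eq: "rank_count u a b = rank_count v a b" for a b
    using assms by (auto simp: bruhat_le_def intro: le_antisym)
  have "u a \<le> b \<longleftrightarrow> v a \<le> b" for b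
  proof (cases a)
    case 0
    then show ?thesis using eq[of 0 b] by (simp add: rank_count_0 split: if_splits)
  next
    case (Suc m)
    then show ?thesis using eq[of m b] eq[of a b] by (simp add: rank_count_Suc split: if_splits)
  qed
  then show "u a = v a" by (meson le_antisym order_refl)
qed

text \<open>Strictly decreasing along Bruhat order, so that a minimiser of this number in a set of
  permutations is Bruhat-maximal in the set.\<close>

definition rank_sum :: "nat \<Rightarrow> (nat \<Rightarrow> nat) \<Rightarrow> nat"
  where "rank_sum n u = (\<Sum>a\<le>n. \<Sum>b\<le>n. rank_count u a b)"

lemma rank_sum_less:
  assumes "u permutes {1..n}" "v permutes {1..n}" "bruhat_le u v" "u \<noteq> v"
  shows "rank_sum n v < rank_sum n u"
proof -
  have le: "rank_count v a b \<le> rank_count u a b" for a b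
    using assms(3) by (simp add: bruhat_le_def)
  have "rank_sum n v \<le> rank_sum n u"
    unfolding rank_sum_def by (intro sum_mono le)
  moreover have "rank_sum n v \<noteq> rank_sum n u"
  proof
    assume "rank_sum n v = rank_sum n u"
    then have rows: "(\<Sum>b\<le>n. rank_count v a b) = (\<Sum>b\<le>n. rank_count u a b)" if "a \<le> n" for a
      unfolding rank_sum_def by (rule sum_mono_inv) (use that in \<open>auto intro: sum_mono le\<close>)
    have eq: "rank_count v a b = rank_count u a b" if "a \<le> n" "b \<le> n" for a b
      by (rule sum_mono_inv[OF rows]) (use that in \<open>auto intro: le\<close>)
    have "u a = v a" for a
    proof (cases "a \<in> {1..n}")
      case False
      then show ?thesis using assms by (metis permutes_not_in)
    next
      case True
      then obtain m where m: "a = Suc m" by (cases a) auto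
      have "u a \<le> b \<longleftrightarrow> v a \<le> b" if "b \<le> n" for b
        using eq[of m b] eq[of a b] that True m by (simp add: rank_count_Suc split: if_splits)
      moreover have "u a \<le> n" "v a \<le> n"
        using True assms permutes_in_image by fastforce+
      ultimately show ?thesis by (meson le_antisym order_refl)
    qed
    then show False using assms(4) by auto
  qed
  ultimately show ?thesis by simp
qed

section \<open>Inversions and reduced words\<close>

definition inversions :: "(nat \<Rightarrow> nat) \<Rightarrow> (nat \<times> nat) set"
  where "inversions w = {(i, j). i < j \<and> w j < w i}"

lemma simple_transposition_permutes:
  "i \<in> {1..<n} \<Longrightarrow> simple_transposition i permutes {1..n}"
  by (intro permutes_swap_id) auto

lemma inversions_subset:
  assumes "w permutes {1..n}"
  shows "inversions w \<subseteq> {1..n} \<times> {1..n}"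
proof
  fix x assume "x \<in> inversions w"
  then obtain i j where x: "x = (i, j)" "i < j" "w j < w i" by (auto simp: inversions_def)
  have "w 0 = 0" using assms by (auto intro: permutes_not_in)
  moreover have "w k \<le> n" if "k \<le> n" for k
    using that assms by (cases "k \<in> {1..n}") (metis atLeastAtMost_iff permutes_in_image, metis permutes_not_in)
  moreover have "w k = k" if "k > n" for k using that assms by (auto intro: permutes_not_in)
  ultimately have "0 < i" "j \<le> n"
    using x by (metis gr0I not_less0, metis le_less_trans less_asym not_le nat_less_le)
  then show "x \<in> {1..n} \<times> {1..n}" using x by auto
qed

lemma finite_inversions: "w permutes {1..n} \<Longrightarrow> finite (inversions w)"
  by (rule finite_subset[OF inversions_subset]) auto

text \<open>The transposition preserves the order of every pair of positions except i and i + 1, so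
  it carries the old inversions to new ones and adds just the pair (i, i + 1).\<close>

lemma card_inversions_ascent:
  assumes "w permutes {1..n}" "w i < w (Suc i)"
  shows "card (inversions (w \<circ> simple_transposition i)) = Suc (card (inversions w))"
proof -
  let ?s = "simple_transposition i"
  have "inversions (w \<circ> ?s) = insert (i, Suc i) (map_prod ?s ?s ` inversions w)" (is "?A = insert _ (?f ` ?B)")
  proof (rule Set.set_eqI)
    fix x :: "nat \<times> nat"
    obtain a b where x: "x = (a, b)" by (cases x)
    have 1: "x \<in> ?f ` ?B \<longleftrightarrow> ?s a < ?s b \<and> w (?s b) < w (?s a)"
    proof
      assume "x \<in> ?f ` ?B" then show "?s a < ?s b \<and> w (?s b) < w (?s a)"
        by (auto simp: x inversions_def)
    next
      assume "?s a < ?s b \<and> w (?s b) < w (?s a)"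
      then have "(?s a, ?s b) \<in> ?B" by (simp add: inversions_def)
      then have "?f (?s a, ?s b) \<in> ?f ` ?B" by (rule imageI)
      then show "x \<in> ?f ` ?B" by (simp add: x)
    qed
    have 2: "x \<in> ?A \<longleftrightarrow> a < b \<and> w (?s b) < w (?s a)" by (simp add: x inversions_def)
    have 3: "a = i \<and> b = Suc i \<or> a = Suc i \<and> b = i \<or> (a < b \<longleftrightarrow> ?s a < ?s b)"
      by (auto simp: Transposition.transpose_def)
    from 3 show "x \<in> ?A \<longleftrightarrow> x \<in> insert (i, Suc i) (?f ` ?B)"
    proof (elim disjE)
      assume "a = i \<and> b = Suc i" then show ?thesis using assms(2) unfolding insert_iff 1 2 by (auto simp add: x)
    next
      assume "a = Suc i \<and> b = i" then show ?thesis using assms(2) unfolding insert_iff 1 2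
        by (auto simp add: x)
    next
      assume "a < b \<longleftrightarrow> ?s a < ?s b"
      then show ?thesis unfolding insert_iff 1 2 using assms(2) by (auto simp: x)
    qed
  qed
  moreover have "(i, Suc i) \<notin> ?f ` ?B"
    by (auto simp: inversions_def Transposition.transpose_def split: if_splits)
  moreover have "inj_on ?f ?B"
    by (intro inj_on_subset[OF prod.inj_map] bij_is_inj bij_transpose) auto
  ultimately show ?thesis using finite_inversions[OF assms(1)] by (simp add: card_image)
qed

lemma card_inversions_descent:
  assumes "w permutes {1..n}" "w (Suc i) < w i" "i \<in> {1..<n}"
  shows "card (inversions w) = Suc (card (inversions (w \<circ> simple_transposition i)))"
proof -
  have "card (inversions ((w \<circ> simple_transposition i) \<circ> simple_transposition i)) =
      Suc (card (inversions (w \<circ> simple_transposition i)))"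
    by (rule card_inversions_ascent[of _ n])
      (use assms in \<open>auto simp del: One_nat_def intro!: permutes_compose simple_transposition_permutes\<close>)
  then show ?thesis by (simp add: o_assoc [symmetric])
qed

lemma ascent_or_descent:
  assumes "w permutes A"
  shows "w i < w (Suc i) \<or> w (Suc i) < w i"
  using permutes_inj[OF assms] by (metis inj_eq n_not_Suc_n nat_neq_iff)

lemma word_perm_Nil [simp]: "word_perm [] = id"
  by (simp add: word_perm_def)

lemma word_perm_Cons [simp]: "word_perm (i # x) = simple_transposition i \<circ> word_perm x"
  by (simp add: word_perm_def)

lemma word_perm_append: "word_perm (x @ y) = word_perm x \<circ> word_perm y"
  by (induction x) (auto simp: o_assoc)

lemma word_perm_permutes: "x \<in> lists {1..<n} \<Longrightarrow> word_perm x permutes {1..n}"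
proof (induction x)
  case (Cons i x)
  then show ?case unfolding word_perm_Cons by (intro permutes_compose simple_transposition_permutes) auto
qed (simp add: permutes_id)

lemma card_inversions_word_le:
  "x \<in> lists {1..<n} \<Longrightarrow> card (inversions (word_perm x)) \<le> length x"
proof (induction x rule: rev_induct)
  case Nil
  have "inversions id = {}" by (auto simp: inversions_def)
  then show ?case by (simp del: id_apply)
next
  case (snoc i x)
  let ?w = "word_perm x"
  have x: "x \<in> lists {1..<n}" "i \<in> {1..<n}" using snoc.prems by auto
  have w: "?w permutes {1..n}" by (rule word_perm_permutes[OF x(1)])
  have "card (inversions (?w \<circ> simple_transposition i)) \<le> Suc (card (inversions ?w))"
    using ascent_or_descent[OF w, of i] card_inversions_ascent[OF w, of i] card_inversions_descent[OF w _ x(2)]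
    by auto
  then show ?case using snoc.IH[OF x(1)]
    unfolding word_perm_append word_perm_Cons word_perm_Nil comp_id length_append_singleton by linarith
qed

text \<open>Bubble sort on the positions a, ..., b, that is, the parabolic decomposition with
  additive lengths. The full interval yields reduced words; initial and final intervals yield the
  factorisation in \<open>exists_split_word\<close>.\<close>

lemma sort_interval:
  assumes "w permutes {1..n}" "1 \<le> a" "b \<le> n"
  shows "\<exists>v x. v permutes {1..n} \<and> x \<in> lists {a..<b} \<and> w = v \<circ> word_perm x \<and>
    card (inversions w) = card (inversions v) + length x \<and> (\<forall>i\<in>{a..<b}. v i < v (Suc i))"
  using assms(1)
proof (induction "card (inversions w)" arbitrary: w rule: less_induct)
  case less
  show ?case
  proof (cases "\<forall>i\<in>{a..<b}. w i < w (Suc i)")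
    case True
    then show ?thesis using less.prems by (intro exI[of _ w] exI[of _ "[]"]) auto
  next
    case False
    then obtain i where i: "i \<in> {a..<b}" "w (Suc i) < w i"
      using ascent_or_descent[OF less.prems] by blast
    let ?s = "simple_transposition i"
    have i': "i \<in> {1..<n}" using i assms by auto
    have p: "w \<circ> ?s permutes {1..n}"
      using less.prems i' by (intro permutes_compose simple_transposition_permutes)
    have inv: "card (inversions w) = Suc (card (inversions (w \<circ> ?s)))"
      by (rule card_inversions_descent[OF less.prems i(2) i'])
    obtain v x where vx: "v permutes {1..n}" "x \<in> lists {a..<b}" "w \<circ> ?s = v \<circ> word_perm x"
        "card (inversions (w \<circ> ?s)) = card (inversions v) + length x" "\<forall>i\<in>{a..<b}. v i < v (Suc i)"
      using less.hyps[of "w \<circ> ?s"] inv p lessI by metis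
    have "w = (w \<circ> ?s) \<circ> ?s" by (simp add: o_assoc [symmetric])
    then have "w = v \<circ> word_perm (x @ [i])" by (simp add: vx(3) word_perm_append o_assoc)
    then show ?thesis using vx i inv by (intro exI[of _ v] exI[of _ "x @ [i]"]) auto
  qed
qed

lemma ascents_imp_less:
  fixes v :: "nat \<Rightarrow> nat"
  assumes "\<forall>i\<in>{a..<b}. v i < v (Suc i)" "a \<le> i" "i < j" "j \<le> b"
  shows "v i < v j"
  using assms(3,4)
proof (induction j)
  case (Suc j)
  show ?case
  proof (cases "i = j")
    case True
    then show ?thesis using assms Suc by auto
  next
    case False
    then have "v i < v j" using Suc by auto
    also have "v j < v (Suc j)" using assms Suc by auto
    finally show ?thesis .
  qed
qed simp

text \<open>At the least moved point k one has v k > k, while the value k is taken at a later point,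
  against monotonicity.\<close>

lemma permutes_increasing_id:
  fixes v :: "nat \<Rightarrow> nat"
  assumes "v permutes S" "\<And>i j. i \<in> S \<Longrightarrow> j \<in> S \<Longrightarrow> i < j \<Longrightarrow> v i < v j"
  shows "v = id"
proof (rule ccontr)
  assume "v \<noteq> id"
  then have ex: "\<exists>k. v k \<noteq> k" by auto
  define k where "k = (LEAST k. v k \<noteq> k)"
  have k: "v k \<noteq> k" unfolding k_def using ex by (rule LeastI_ex)
  have below: "v j = j" if "j < k" for j using that not_less_Least unfolding k_def by blast
  have "k \<in> S" using k permutes_not_in[OF assms(1)] by blast
  obtain j where j: "v j = k" using permutes_surj[OF assms(1)] by (metis surjD)
  have "j \<in> S" using j \<open>k \<in> S\<close> permutes_in_image[OF assms(1)] by metis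
  have inj: "inj v" by (rule permutes_inj[OF assms(1)])
  have "k < v k"
  proof (rule ccontr)
    assume "\<not> k < v k"
    then have "v k < k" using k by simp
    then have "v (v k) = v k" by (rule below)
    then show False using inj k by (auto dest: injD)
  qed
  moreover have "k < j"
    using j k below by (metis linorder_neqE_nat nat_less_le)
  ultimately show False using assms(2)[OF \<open>k \<in> S\<close> \<open>j \<in> S\<close>] j by simp
qed

lemma exists_word:
  assumes "w permutes {1..n}"
  shows "\<exists>x\<in>lists {1..<n}. word_perm x = w \<and> length x = card (inversions w)"
proof -
  obtain v x where vx: "v permutes {1..n}" "x \<in> lists {1..<n}" "w = v \<circ> word_perm x"
      "card (inversions w) = card (inversions v) + length x" "\<forall>i\<in>{1..<n}. v i < v (Suc i)"
    using sort_interval[OF assms, of 1 n] by auto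
  have "v = id"
    using vx(1) ascents_imp_less[OF vx(5)] by (intro permutes_increasing_id[OF vx(1)]) auto
  moreover have "inversions id = {}" by (auto simp: inversions_def)
  ultimately show ?thesis using vx by auto
qed

text \<open>Trades minimality over all words for a number, which inductions on the last letter can
  follow.\<close>

lemma reduced_word_iff:
  "reduced_word n w x \<longleftrightarrow> x \<in> lists {1..<n} \<and> word_perm x = w \<and> length x = card (inversions w)"
proof
  assume r: "reduced_word n w x"
  then have x: "x \<in> lists {1..<n}" "word_perm x = w" by (auto simp: reduced_word_def)
  have "length x \<le> card (inversions w)"
    using r exists_word[OF word_perm_permutes[OF x(1)]] x(2) by (auto simp: reduced_word_def)
  then show "x \<in> lists {1..<n} \<and> word_perm x = w \<and> length x = card (inversions w)"
    using x card_inversions_word_le[OF x(1)] by auto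
next
  assume "x \<in> lists {1..<n} \<and> word_perm x = w \<and> length x = card (inversions w)"
  then show "reduced_word n w x"
    unfolding reduced_word_def using card_inversions_word_le[of _ n] by metis
qed

lemma reduced_word_snocD:
  assumes "reduced_word n w (x @ [i])"
  shows "reduced_word n (w \<circ> simple_transposition i) x" "w (Suc i) < w i" "i \<in> {1..<n}"
    "w permutes {1..n}"
proof -
  have x: "x \<in> lists {1..<n}" "i \<in> {1..<n}" "w = word_perm x \<circ> simple_transposition i"
      "Suc (length x) = card (inversions w)"
    using assms by (auto simp: reduced_word_iff word_perm_append)
  show "i \<in> {1..<n}" by fact
  have eq: "w \<circ> simple_transposition i = word_perm x" by (simp add: x(3) o_assoc [symmetric])
  have p: "word_perm x permutes {1..n}" by (rule word_perm_permutes[OF x(1)])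
  show w: "w permutes {1..n}"
    unfolding x(3) using p x(2) by (intro permutes_compose simple_transposition_permutes)
  have "card (inversions (word_perm x)) \<le> length x" by (rule card_inversions_word_le[OF x(1)])
  then show desc: "w (Suc i) < w i"
    using card_inversions_ascent[OF w, of i] ascent_or_descent[OF w, of i] x(4) by (auto simp: eq)
  show "reduced_word n (w \<circ> simple_transposition i) x"
    using card_inversions_descent[OF w desc x(2)] x(1,4) unfolding reduced_word_iff eq by auto
qed

lemma reduced_word_snocI:
  assumes "w permutes {1..n}" "w (Suc i) < w i" "i \<in> {1..<n}"
    "reduced_word n (w \<circ> simple_transposition i) x"
  shows "reduced_word n w (x @ [i])"
proof -
  have "word_perm x = w \<circ> simple_transposition i" using assms(4) by (simp add: reduced_word_iff)
  then have "word_perm (x @ [i]) = w" by (simp add: word_perm_append o_assoc [symmetric])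
  then show ?thesis
    using card_inversions_descent[OF assms(1-3)] assms(3,4) by (simp add: reduced_word_iff)
qed

lemma exists_reduced_word: "w permutes {1..n} \<Longrightarrow> \<exists>x. reduced_word n w x"
  using exists_word unfolding reduced_word_iff by blast

lemma sign_word_perm:
  "x \<in> lists {1..<n} \<Longrightarrow> sign (word_perm x) = (-1) ^ length x"
proof (induction x)
  case (Cons i x)
  then have "word_perm x permutes {1..n}" by (intro word_perm_permutes) auto
  then have "permutation (word_perm x)" by (auto simp: permutation_permutes)
  then show ?case using Cons unfolding word_perm_Cons
    by (subst sign_compose) (auto simp: permutation_swap_id sign_swap_id)
qed (simp add: sign_id)

lemma word_perm_rev: "word_perm (rev x) \<circ> word_perm x = id"
proof (induction x)
  case (Cons i x)
  have "word_perm (rev (i # x)) \<circ> word_perm (i # x) =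
      word_perm (rev x) \<circ> ((simple_transposition i \<circ> simple_transposition i) \<circ> word_perm x)"
    unfolding rev.simps word_perm_append word_perm_Cons word_perm_Nil o_assoc comp_id ..
  then show ?case unfolding transpose_comp_involutory id_comp using Cons by metis
qed simp

lemma word_perm_rev_inv: "word_perm (rev x) = Hilbert_Choice.inv (word_perm x)"
proof -
  have "word_perm x \<circ> word_perm (rev x) = id" using word_perm_rev[of "rev x"] by simp
  then show ?thesis using word_perm_rev by (intro inv_unique_comp[symmetric])
qed

lemma card_inversions_inv:
  assumes "w permutes {1..n}"
  shows "card (inversions (Hilbert_Choice.inv w)) = card (inversions w)"
proof -
  have "inversions (Hilbert_Choice.inv w) = (\<lambda>(i, j). (w j, w i)) ` inversions w"
  proof (rule Set.set_eqI)
    fix x :: "nat \<times> nat"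
    obtain a b where x: "x = (a, b)" by (cases x)
    have "x \<in> inversions (Hilbert_Choice.inv w) \<longleftrightarrow> (Hilbert_Choice.inv w b, Hilbert_Choice.inv w a) \<in> inversions w"
      using assms by (auto simp add: x inversions_def permutes_inverses)
    also have "\<dots> \<longleftrightarrow> x \<in> (\<lambda>(i, j). (w j, w i)) ` inversions w"
      using assms by (force simp: x permutes_inverses)
    finally show "x \<in> inversions (Hilbert_Choice.inv w) \<longleftrightarrow> x \<in> (\<lambda>(i, j). (w j, w i)) ` inversions w" .
  qed
  moreover have "inj_on (\<lambda>(i, j). (w j, w i)) (inversions w)"
    using permutes_inj[OF assms] by (auto simp: inj_on_def dest: injD)
  ultimately show ?thesis by (simp add: card_image)
qed

lemma reduced_word_rev:
  assumes "reduced_word n w x"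
  shows "reduced_word n (Hilbert_Choice.inv w) (rev x)"
proof -
  have "word_perm x permutes {1..n}" "word_perm (rev x) = Hilbert_Choice.inv (word_perm x)" "word_perm x = w"
      "length x = card (inversions w)" "x \<in> lists {1..<n}"
    using assms word_perm_permutes[of x n] word_perm_rev_inv[of x] by (auto simp: reduced_word_iff)
  then show ?thesis by (auto simp: reduced_word_iff card_inversions_inv)
qed

section \<open>Pattern containment in terms of positions\<close>

lemma sorted_list_of_set_eq:
  fixes xs :: "nat list"
  assumes "sorted_wrt (<) xs" "set xs = A"
  shows "sorted_list_of_set A = xs"
  using assms by (metis strict_sorted_equal strict_sorted_list_of_set set_sorted_list_of_set List.finite_set)

text \<open>The set I is traded for its increasing enumeration p, and only the relative order of the
  values is kept. That order already determines the sorted list of values: its entry at t is the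
  value at the place where the pattern has the entry t + 1.\<close>

lemma contains_pattern_iff:
  assumes w: "w permutes {1..n}" and v: "distinct v" "set v = {1..length v}"
  shows "contains_pattern n w v \<longleftrightarrow>
    (\<exists>p. length p = length v \<and> sorted_wrt (<) p \<and> set p \<subseteq> {1..n} \<and>
      (\<forall>j<length v. \<forall>k<length v. v ! j < v ! k \<longrightarrow> w (p ! j) < w (p ! k)))"
    (is "_ \<longleftrightarrow> (\<exists>p. ?P p)")
proof
  assume "contains_pattern n w v"
  then obtain I where I: "I \<subseteq> {1..n}" "card I = length v"
    "\<And>i. i \<in> {1..length v} \<Longrightarrow> w (nth_smallest I i) = nth_smallest (w ` I) (v ! (i - 1))"
    unfolding contains_pattern_def by blast
  have fin: "finite I" using I(1) finite_subset by blast
  have card: "card (w ` I) = length v"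
    using I(2) permutes_inj_on[OF w] by (simp add: card_image)
  let ?p = "sorted_list_of_set I" and ?q = "sorted_list_of_set (w ` I)"
  have val: "w (?p ! j) = ?q ! (v ! j - 1)" if "j < length v" for j
    using I(3)[of "Suc j"] that by (simp add: nth_smallest_def)
  have "w (?p ! j) < w (?p ! k)" if "j < length v" "k < length v" "v ! j < v ! k" for j k
  proof -
    have "v ! j \<in> {1..length v}" "v ! k \<in> {1..length v}"
      using that(1,2) v(2) nth_mem by blast+
    then have "v ! j - 1 < v ! k - 1" "v ! k - 1 < length ?q"
      using that(3) card by auto
    moreover have "sorted_wrt (<) ?q" by simp
    ultimately show ?thesis using that val by (simp add: sorted_wrt_nth_less)
  qed
  then have "?P ?p" using I(1,2) fin by auto
  then show "\<exists>p. ?P p" by blast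
next
  assume "\<exists>p. ?P p"
  then obtain p where p: "length p = length v" "sorted_wrt (<) p" "set p \<subseteq> {1..n}"
    "\<And>j k. j < length v \<Longrightarrow> k < length v \<Longrightarrow> v ! j < v ! k \<Longrightarrow> w (p ! j) < w (p ! k)"
    by blast
  let ?m = "length v"
  have ex: "\<exists>j<?m. v ! j = Suc t" if "t < ?m" for t
  proof -
    have "Suc t \<in> set v" using that v(2) by auto
    then show ?thesis by (simp add: in_set_conv_nth)
  qed
  then obtain pos where pos: "\<And>t. t < ?m \<Longrightarrow> pos t < ?m \<and> v ! pos t = Suc t" by metis
  have pos_v: "pos (v ! j - 1) = j" "v ! j - 1 < ?m" if "j < ?m" for j
  proof -
    have "v ! j \<in> {1..?m}" using that v(2) nth_mem by blast
    then show lt: "v ! j - 1 < ?m" by auto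
    have "v ! pos (v ! j - 1) = v ! j" using pos[OF lt] \<open>v ! j \<in> {1..?m}\<close> by auto
    then show "pos (v ! j - 1) = j" using v(1) pos[OF lt] that by (meson nth_eq_iff_index_eq)
  qed
  have P: "sorted_list_of_set (set p) = p" by (rule sorted_list_of_set_eq) (use p in auto)
  let ?q = "map (\<lambda>t. w (p ! pos t)) [0..<?m]"
  have "sorted_wrt (<) ?q"
    unfolding sorted_wrt_iff_nth_less using pos p(4) by auto
  moreover have "set ?q = w ` set p"
  proof
    show "set ?q \<subseteq> w ` set p" using pos p(1) by auto
    show "w ` set p \<subseteq> set ?q"
    proof
      fix y assume "y \<in> w ` set p"
      then obtain j where "j < ?m" "y = w (p ! j)" using p(1) by (auto simp: in_set_conv_nth)
      then show "y \<in> set ?q" using pos_v[of j] by (auto intro!: image_eqI[of _ _ "v ! j - 1"])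
    qed
  qed
  ultimately have Q: "sorted_list_of_set (w ` set p) = ?q" by (rule sorted_list_of_set_eq)
  have "card (set p) = ?m" using p(1,2) by (metis distinct_card strict_sorted_iff)
  moreover have "w (nth_smallest (set p) i) = nth_smallest (w ` set p) (v ! (i - 1))"
    if "i \<in> {1..?m}" for i
  proof -
    have "i - 1 < ?m" using that by auto
    then show ?thesis unfolding nth_smallest_def P Q using pos_v[of "i - 1"] by simp
  qed
  ultimately show "contains_pattern n w v" unfolding contains_pattern_def using p(3) by blast
qed

lemma contains_321_iff:
  assumes "w permutes {1..n}"
  shows "contains_pattern n w [3,2,1] \<longleftrightarrow>
    (\<exists>a b c. 1 \<le> a \<and> a < b \<and> b < c \<and> c \<le> n \<and>
      w c < w b \<and> w b < w a)" (is "_ \<longleftrightarrow> ?R")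
proof
  assume "contains_pattern n w [3,2,1]"
  then obtain p where p: "length p = 3" "sorted_wrt (<) p" "set p \<subseteq> {1..n}"
      "\<forall>j<3. \<forall>k<3. [3,2,1] ! j < ([3,2,1] ! k :: nat) \<longrightarrow> w (p ! j) < w (p ! k)"
    by (subst (asm) contains_pattern_iff[OF assms]) (auto simp: numeral_eq_Suc)
  obtain a b c where "p = [a, b, c]"
    using p(1) by (auto simp: numeral_eq_Suc length_Suc_conv)
  then show ?R using p(2-4) by (simp add: numeral_eq_Suc All_less_Suc) blast
next
  assume ?R
  then obtain a b c where "1 \<le> a" "a < b" "b < c" "c \<le> n"
      "w c < w b" "w b < w a"
    by blast
  then show "contains_pattern n w [3,2,1]"
    by (subst contains_pattern_iff[OF assms], force, force, intro exI[of _ "[a, b, c]"])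
      (simp add: numeral_eq_Suc All_less_Suc)
qed

lemma contains_1324_iff:
  assumes "w permutes {1..n}"
  shows "contains_pattern n w [1,3,2,4] \<longleftrightarrow>
    (\<exists>a b c d. 1 \<le> a \<and> a < b \<and> b < c \<and> c < d \<and> d \<le> n \<and>
      w a < w c \<and> w c < w b \<and> w b < w d)" (is "_ \<longleftrightarrow> ?R")
proof
  assume "contains_pattern n w [1,3,2,4]"
  then obtain p where p: "length p = 4" "sorted_wrt (<) p" "set p \<subseteq> {1..n}"
      "\<forall>j<4. \<forall>k<4. [1,3,2,4] ! j < ([1,3,2,4] ! k :: nat) \<longrightarrow> w (p ! j) < w (p ! k)"
    by (subst (asm) contains_pattern_iff[OF assms]) (auto simp: numeral_eq_Suc)
  obtain a b c d where "p = [a, b, c, d]"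
    using p(1) by (auto simp: numeral_eq_Suc length_Suc_conv)
  then show ?R using p(2-4) by (simp add: numeral_eq_Suc All_less_Suc) blast
next
  assume ?R
  then obtain a b c d where "1 \<le> a" "a < b" "b < c" "c < d" "d \<le> n"
      "w a < w c" "w c < w b" "w b < w d"
    by blast
  then show "contains_pattern n w [1,3,2,4]"
    by (subst contains_pattern_iff[OF assms], force, force, intro exI[of _ "[a, b, c, d]"])
      (simp add: numeral_eq_Suc All_less_Suc)
qed

lemma contains_24153_iff:
  assumes "w permutes {1..n}"
  shows "contains_pattern n w [2,4,1,5,3] \<longleftrightarrow>
    (\<exists>a b c d e. 1 \<le> a \<and> a < b \<and> b < c \<and> c < d \<and> d < e \<and> e \<le> n \<and>
      w c < w a \<and> w a < w e \<and> w e < w b \<and> w b < w d)" (is "_ \<longleftrightarrow> ?R")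
proof
  assume "contains_pattern n w [2,4,1,5,3]"
  then obtain p where p: "length p = 5" "sorted_wrt (<) p" "set p \<subseteq> {1..n}"
      "\<forall>j<5. \<forall>k<5. [2,4,1,5,3] ! j < ([2,4,1,5,3] ! k :: nat) \<longrightarrow> w (p ! j) < w (p ! k)"
    by (subst (asm) contains_pattern_iff[OF assms]) (auto simp: numeral_eq_Suc)
  obtain a b c d e where "p = [a, b, c, d, e]"
    using p(1) by (auto simp: numeral_eq_Suc length_Suc_conv)
  then show ?R using p(2-4) by (simp add: numeral_eq_Suc All_less_Suc) blast
next
  assume ?R
  then obtain a b c d e where "1 \<le> a" "a < b" "b < c" "c < d" "d < e" "e \<le> n"
      "w c < w a" "w a < w e" "w e < w b" "w b < w d"
    by blast
  then show "contains_pattern n w [2,4,1,5,3]"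
    by (subst contains_pattern_iff[OF assms], force, force, intro exI[of _ "[a, b, c, d, e]"])
      (simp add: numeral_eq_Suc All_less_Suc)
qed

lemma contains_31524_iff:
  assumes "w permutes {1..n}"
  shows "contains_pattern n w [3,1,5,2,4] \<longleftrightarrow>
    (\<exists>a b c d e. 1 \<le> a \<and> a < b \<and> b < c \<and> c < d \<and> d < e \<and> e \<le> n \<and>
      w b < w d \<and> w d < w a \<and> w a < w e \<and> w e < w c)" (is "_ \<longleftrightarrow> ?R")
proof
  assume "contains_pattern n w [3,1,5,2,4]"
  then obtain p where p: "length p = 5" "sorted_wrt (<) p" "set p \<subseteq> {1..n}"
      "\<forall>j<5. \<forall>k<5. [3,1,5,2,4] ! j < ([3,1,5,2,4] ! k :: nat) \<longrightarrow> w (p ! j) < w (p ! k)"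
    by (subst (asm) contains_pattern_iff[OF assms]) (auto simp: numeral_eq_Suc)
  obtain a b c d e where "p = [a, b, c, d, e]"
    using p(1) by (auto simp: numeral_eq_Suc length_Suc_conv)
  then show ?R using p(2-4) by (simp add: numeral_eq_Suc All_less_Suc) blast
next
  assume ?R
  then obtain a b c d e where "1 \<le> a" "a < b" "b < c" "c < d" "d < e" "e \<le> n"
      "w b < w d" "w d < w a" "w a < w e" "w e < w c"
    by blast
  then show "contains_pattern n w [3,1,5,2,4]"
    by (subst contains_pattern_iff[OF assms], force, force, intro exI[of _ "[a, b, c, d, e]"])
      (simp add: numeral_eq_Suc All_less_Suc)
qed

lemma contains_231564_iff:
  assumes "w permutes {1..n}"
  shows "contains_pattern n w [2,3,1,5,6,4] \<longleftrightarrow>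
    (\<exists>a b c d e f. 1 \<le> a \<and> a < b \<and> b < c \<and> c < d \<and> d < e \<and> e < f \<and> f \<le> n \<and>
      w c < w a \<and> w a < w b \<and> w b < w f \<and> w f < w d \<and> w d < w e)" (is "_ \<longleftrightarrow> ?R")
proof
  assume "contains_pattern n w [2,3,1,5,6,4]"
  then obtain p where p: "length p = 6" "sorted_wrt (<) p" "set p \<subseteq> {1..n}"
      "\<forall>j<6. \<forall>k<6. [2,3,1,5,6,4] ! j < ([2,3,1,5,6,4] ! k :: nat) \<longrightarrow> w (p ! j) < w (p ! k)"
    by (subst (asm) contains_pattern_iff[OF assms]) (auto simp: numeral_eq_Suc)
  obtain a b c d e f where "p = [a, b, c, d, e, f]"
    using p(1) by (auto simp: numeral_eq_Suc length_Suc_conv)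
  then show ?R using p(2-4) by (simp add: numeral_eq_Suc All_less_Suc) blast
next
  assume ?R
  then obtain a b c d e f where "1 \<le> a" "a < b" "b < c" "c < d" "d < e" "e < f" "f \<le> n"
      "w c < w a" "w a < w b" "w b < w f" "w f < w d" "w d < w e"
    by blast
  then show "contains_pattern n w [2,3,1,5,6,4]"
    by (subst contains_pattern_iff[OF assms], force, force, intro exI[of _ "[a, b, c, d, e, f]"])
      (simp add: numeral_eq_Suc All_less_Suc)
qed

lemma contains_312645_iff:
  assumes "w permutes {1..n}"
  shows "contains_pattern n w [3,1,2,6,4,5] \<longleftrightarrow>
    (\<exists>a b c d e f. 1 \<le> a \<and> a < b \<and> b < c \<and> c < d \<and> d < e \<and> e < f \<and> f \<le> n \<and>
      w b < w c \<and> w c < w a \<and> w a < w e \<and> w e < w f \<and> w f < w d)" (is "_ \<longleftrightarrow> ?R")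
proof
  assume "contains_pattern n w [3,1,2,6,4,5]"
  then obtain p where p: "length p = 6" "sorted_wrt (<) p" "set p \<subseteq> {1..n}"
      "\<forall>j<6. \<forall>k<6. [3,1,2,6,4,5] ! j < ([3,1,2,6,4,5] ! k :: nat) \<longrightarrow> w (p ! j) < w (p ! k)"
    by (subst (asm) contains_pattern_iff[OF assms]) (auto simp: numeral_eq_Suc)
  obtain a b c d e f where "p = [a, b, c, d, e, f]"
    using p(1) by (auto simp: numeral_eq_Suc length_Suc_conv)
  then show ?R using p(2-4) by (simp add: numeral_eq_Suc All_less_Suc) blast
next
  assume ?R
  then obtain a b c d e f where "1 \<le> a" "a < b" "b < c" "c < d" "d < e" "e < f" "f \<le> n"
      "w b < w c" "w c < w a" "w a < w e" "w e < w f" "w f < w d"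
    by blast
  then show "contains_pattern n w [3,1,2,6,4,5]"
    by (subst contains_pattern_iff[OF assms], force, force, intro exI[of _ "[a, b, c, d, e, f]"])
      (simp add: numeral_eq_Suc All_less_Suc)
qed

section \<open>Functionals on the Temperley-Lieb algebra\<close>

text \<open>When $t_i$ is replaced by $1 - s_i$, the relation $t_i t_j t_i = t_i$ says that the alternating
  sum of the permutations of three positions is zero.\<close>

definition tl_relation :: "((nat \<Rightarrow> nat) \<Rightarrow> complex) \<Rightarrow> (nat \<Rightarrow> nat) \<Rightarrow> nat \<Rightarrow> nat \<Rightarrow> nat \<Rightarrow> bool"
  where "tl_relation h u i j k \<longleftrightarrow>
    h u + h (u \<circ> Transposition.transpose i j \<circ> Transposition.transpose j k)
        + h (u \<circ> Transposition.transpose j k \<circ> Transposition.transpose i j) =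
    h (u \<circ> Transposition.transpose i j) + h (u \<circ> Transposition.transpose j k)
      + h (u \<circ> Transposition.transpose i k)"

definition tl_functional :: "nat \<Rightarrow> ((nat \<Rightarrow> nat) \<Rightarrow> complex) \<Rightarrow> bool"
  where "tl_functional n h \<longleftrightarrow> (\<forall>u i j k. u permutes {1..n} \<longrightarrow> {i, j, k} \<subseteq> {1..n} \<longrightarrow>
    i \<noteq> j \<longrightarrow> j \<noteq> k \<longrightarrow> i \<noteq> k \<longrightarrow> tl_relation h u i j k)"

lemma tl_functionalD:
  assumes "tl_functional n h" "u permutes {1..n}" "i \<in> {1..n}" "j \<in> {1..n}" "k \<in> {1..n}"
    "i \<noteq> j" "j \<noteq> k" "i \<noteq> k"
  shows "h u + h (u \<circ> Transposition.transpose i j \<circ> Transposition.transpose j k)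
        + h (u \<circ> Transposition.transpose j k \<circ> Transposition.transpose i j) =
    h (u \<circ> Transposition.transpose i j) + h (u \<circ> Transposition.transpose j k)
      + h (u \<circ> Transposition.transpose i k)"
  using assms unfolding tl_functional_def tl_relation_def by simp

lemma transpose_comp_perm:
  assumes "inj s"
  shows "Transposition.transpose (s a) (s b) \<circ> s = s \<circ> Transposition.transpose a b"
  using assms by (auto simp: fun_eq_iff Transposition.transpose_def inj_eq)

lemma transpose_three_cycle:
  assumes "i \<noteq> j" "j \<noteq> k" "i \<noteq> k"
  shows "Transposition.transpose i j \<circ> Transposition.transpose j k =
      Transposition.transpose i k \<circ> Transposition.transpose i j"
    "Transposition.transpose i j \<circ> Transposition.transpose j k =
      Transposition.transpose j k \<circ> Transposition.transpose i k"
  using assms by (auto simp: fun_eq_iff Transposition.transpose_def)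

lemma permutes_mem: "u permutes S \<Longrightarrow> i \<in> S \<Longrightarrow> u i \<in> S"
  by (simp add: permutes_in_image)

lemma permutes_transpose:
  "u permutes S \<Longrightarrow> i \<in> S \<Longrightarrow> j \<in> S \<Longrightarrow> u \<circ> Transposition.transpose i j permutes S"
  by (intro permutes_compose permutes_swap_id)

text \<open>Multiplication by the transposition that leaves h invariant matches the three even terms
  with the three odd ones.\<close>

lemma tl_relation_if_invariant:
  assumes u: "u permutes {1..n}" and mem: "i \<in> {1..n}" "j \<in> {1..n}" "k \<in> {1..n}"
    and ne: "i \<noteq> j" "j \<noteq> k" "i \<noteq> k"
    and inv: "(\<forall>v. v permutes {1..n} \<longrightarrow> h (v \<circ> Transposition.transpose i j) = h v) \<or>
      (\<forall>v. v permutes {1..n} \<longrightarrow> h (v \<circ> Transposition.transpose j k) = h v) \<or>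
      (\<forall>v. v permutes {1..n} \<longrightarrow> h (v \<circ> Transposition.transpose i k) = h v)"
  shows "tl_relation h u i j k"
proof -
  let ?ij = "Transposition.transpose i j" and ?jk = "Transposition.transpose j k"
    and ?ik = "Transposition.transpose i k"
  have p: "u \<circ> ?ij permutes {1..n}" "u \<circ> ?jk permutes {1..n}" "u \<circ> ?ik permutes {1..n}"
    using u mem by (auto intro: permutes_transpose)
  have ij_jk: "u \<circ> ?ij \<circ> ?jk = u \<circ> ?ik \<circ> ?ij" "u \<circ> ?ij \<circ> ?jk = u \<circ> ?jk \<circ> ?ik"
    using transpose_three_cycle[OF ne] by (metis o_assoc)+
  have jk_ij: "u \<circ> ?jk \<circ> ?ij = u \<circ> ?ik \<circ> ?jk" "u \<circ> ?jk \<circ> ?ij = u \<circ> ?ij \<circ> ?ik"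
    using transpose_three_cycle[of k j i] ne by (simp_all add: transpose_commute o_assoc[symmetric] del: comp_apply)
  from inv show ?thesis
    unfolding tl_relation_def
  proof (elim disjE)
    assume "\<forall>v. v permutes {1..n} \<longrightarrow> h (v \<circ> ?ij) = h v"
    then show "h u + h (u \<circ> ?ij \<circ> ?jk) + h (u \<circ> ?jk \<circ> ?ij) = h (u \<circ> ?ij) + h (u \<circ> ?jk) + h (u \<circ> ?ik)"
      using u p unfolding ij_jk(1) by (simp del: comp_apply)
  next
    assume "\<forall>v. v permutes {1..n} \<longrightarrow> h (v \<circ> ?jk) = h v"
    then show "h u + h (u \<circ> ?ij \<circ> ?jk) + h (u \<circ> ?jk \<circ> ?ij) = h (u \<circ> ?ij) + h (u \<circ> ?jk) + h (u \<circ> ?ik)"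
      using u p unfolding jk_ij(1) by (simp del: comp_apply)
  next
    assume "\<forall>v. v permutes {1..n} \<longrightarrow> h (v \<circ> ?ik) = h v"
    then show "h u + h (u \<circ> ?ij \<circ> ?jk) + h (u \<circ> ?jk \<circ> ?ij) = h (u \<circ> ?ij) + h (u \<circ> ?jk) + h (u \<circ> ?ik)"
      using u p unfolding ij_jk(2) jk_ij(2) by (simp del: comp_apply)
  qed
qed

text \<open>Pigeonhole: two of any three positions share a class. Both the separating functionals
  and the indicator functions of single shapes arise in this way.\<close>

lemma tl_functional_two_classes:
  fixes cls :: "nat \<Rightarrow> 'a"
  assumes inv: "\<And>u i j. u permutes {1..n} \<Longrightarrow> i \<in> {1..n} \<Longrightarrow> j \<in> {1..n} \<Longrightarrow> cls i = cls j \<Longrightarrow>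
      h (u \<circ> Transposition.transpose i j) = h u"
    and two: "\<And>i. i \<in> {1..n} \<Longrightarrow> cls i = a \<or> cls i = b"
  shows "tl_functional n h"
  unfolding tl_functional_def
proof (intro allI impI)
  fix u i j k
  assume u: "u permutes {1..n}" and "{i, j, k} \<subseteq> {1..n}" and ne: "i \<noteq> j" "j \<noteq> k" "i \<noteq> k"
  then have mem: "i \<in> {1..n}" "j \<in> {1..n}" "k \<in> {1..n}" by auto
  have "cls i = cls j \<or> cls j = cls k \<or> cls i = cls k" using two mem by metis
  then show "tl_relation h u i j k"
    using inv mem by (intro tl_relation_if_invariant[OF u mem ne]) blast
qed

lemma inv_comp_transpose:
  assumes "u permutes S"
  shows "Hilbert_Choice.inv (u \<circ> Transposition.transpose i j) =
    Hilbert_Choice.inv u \<circ> Transposition.transpose (u i) (u j)"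
proof -
  have "bij u" using assms by (rule permutes_bij)
  then have "Hilbert_Choice.inv (u \<circ> Transposition.transpose i j) =
      Transposition.transpose i j \<circ> Hilbert_Choice.inv u"
    by (simp add: o_inv_distrib)
  also have "\<dots> = Transposition.transpose (Hilbert_Choice.inv u (u i)) (Hilbert_Choice.inv u (u j))
      \<circ> Hilbert_Choice.inv u"
    using assms by (simp add: permutes_inverses)
  also have "\<dots> = Hilbert_Choice.inv u \<circ> Transposition.transpose (u i) (u j)"
    by (rule transpose_comp_perm) (use assms permutes_inj permutes_inv in blast)
  finally show ?thesis .
qed

text \<open>Inversion turns the six rearrangements of u at three positions into those of its inverse
  at the three values, interchanging the two 3-cycles. Statements about rows thereby transfer to
  columns.\<close>

lemma tl_relation_inv:
  assumes u: "u permutes {1..n}" and mem: "i \<in> {1..n}" "j \<in> {1..n}" "k \<in> {1..n}"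
    and ne: "i \<noteq> j" "j \<noteq> k" "i \<noteq> k"
  shows "tl_relation (\<lambda>u. h (Hilbert_Choice.inv u)) u i j k \<longleftrightarrow>
    tl_relation h (Hilbert_Choice.inv u) (u i) (u j) (u k)"
proof -
  let ?v = "Hilbert_Choice.inv u"
  let ?ij = "Transposition.transpose i j" and ?jk = "Transposition.transpose j k"
  let ?ij' = "Transposition.transpose (u i) (u j)" and ?jk' = "Transposition.transpose (u j) (u k)"
    and ?ik' = "Transposition.transpose (u i) (u k)"
  have inj: "inj u" using u by (rule permutes_inj)
  have ne': "u i \<noteq> u j" "u j \<noteq> u k" "u i \<noteq> u k" using ne inj by (auto dest: injD)
  have "Hilbert_Choice.inv (u \<circ> ?ij \<circ> ?jk) =
      ?v \<circ> ?ij' \<circ> Transposition.transpose ((u \<circ> ?ij) j) ((u \<circ> ?ij) k)"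
    using u mem by (simp add: inv_comp_transpose[of _ "{1..n}"] permutes_transpose)
  also have "\<dots> = ?v \<circ> (?ij' \<circ> ?ik')" using ne by (simp add: o_assoc)
  also have "?ij' \<circ> ?ik' = ?jk' \<circ> ?ij'"
    using transpose_three_cycle[of "u k" "u j" "u i"] ne' by (simp add: transpose_commute)
  finally have 1: "Hilbert_Choice.inv (u \<circ> ?ij \<circ> ?jk) = ?v \<circ> ?jk' \<circ> ?ij'"
    unfolding o_assoc .
  have "Hilbert_Choice.inv (u \<circ> ?jk \<circ> ?ij) =
      ?v \<circ> ?jk' \<circ> Transposition.transpose ((u \<circ> ?jk) i) ((u \<circ> ?jk) j)"
    using u mem by (simp add: inv_comp_transpose[of _ "{1..n}"] permutes_transpose)
  also have "\<dots> = ?v \<circ> (?jk' \<circ> ?ik')" using ne by (simp add: o_assoc)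
  also have "?jk' \<circ> ?ik' = ?ij' \<circ> ?jk'"
    using transpose_three_cycle(2)[OF ne'] by simp
  finally have 2: "Hilbert_Choice.inv (u \<circ> ?jk \<circ> ?ij) = ?v \<circ> ?ij' \<circ> ?jk'"
    unfolding o_assoc .
  show ?thesis
    unfolding tl_relation_def 1 2 inv_comp_transpose[OF u] by (simp add: algebra_simps del: comp_apply)
qed

lemma tl_functional_inv:
  assumes h: "tl_functional n h"
  shows "tl_functional n (\<lambda>u. h (Hilbert_Choice.inv u))"
  unfolding tl_functional_def
proof (intro allI impI)
  fix u i j k
  assume u: "u permutes {1..n}" and "{i, j, k} \<subseteq> {1..n}" and ne: "i \<noteq> j" "j \<noteq> k" "i \<noteq> k"
  then have mem: "i \<in> {1..n}" "j \<in> {1..n}" "k \<in> {1..n}" by auto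
  have "{u i, u j, u k} \<subseteq> {1..n}" using mem[THEN permutes_mem[OF u]] by simp
  moreover have "u i \<noteq> u j" "u j \<noteq> u k" "u i \<noteq> u k"
    using ne permutes_inj[OF u] by (auto dest: injD)
  ultimately show "tl_relation (\<lambda>u. h (Hilbert_Choice.inv u)) u i j k"
    unfolding tl_relation_inv[OF u mem ne] using h permutes_inv[OF u] by (simp add: tl_functional_def)
qed

lemma tl_functional_right_translate:
  assumes h: "tl_functional n h" and s: "s permutes {1..n}"
  shows "tl_functional n (\<lambda>u. h (u \<circ> s))"
  unfolding tl_functional_def tl_relation_def
proof (intro allI impI)
  fix u i j k
  assume u: "u permutes {1..n}" and "{i, j, k} \<subseteq> {1..n}" and ne: "i \<noteq> j" "j \<noteq> k" "i \<noteq> k"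
  then have mem: "i \<in> {1..n}" "j \<in> {1..n}" "k \<in> {1..n}" by auto
  define r where "r = Hilbert_Choice.inv s"
  have r: "r permutes {1..n}" unfolding r_def using s by (rule permutes_inv)
  have mem': "r i \<in> {1..n}" "r j \<in> {1..n}" "r k \<in> {1..n}"
    using mem r by (simp_all only: permutes_mem)
  have ne': "r i \<noteq> r j" "r j \<noteq> r k" "r i \<noteq> r k"
    using ne permutes_inj[OF r] by (auto dest: injD)
  have conj: "v \<circ> Transposition.transpose x y \<circ> s = v \<circ> s \<circ> Transposition.transpose (r x) (r y)" for v x y
    using transpose_comp_perm[OF permutes_inj[OF s], of "r x" "r y"] s
    by (simp add: r_def permutes_inverses o_assoc[symmetric])
  have "u \<circ> s permutes {1..n}" using s u by (rule permutes_compose)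
  from tl_functionalD[OF h this mem' ne']
  show "h (u \<circ> s) + h (u \<circ> Transposition.transpose i j \<circ> Transposition.transpose j k \<circ> s)
      + h (u \<circ> Transposition.transpose j k \<circ> Transposition.transpose i j \<circ> s) =
      h (u \<circ> Transposition.transpose i j \<circ> s) + h (u \<circ> Transposition.transpose j k \<circ> s)
      + h (u \<circ> Transposition.transpose i k \<circ> s)"
    unfolding conj .
qed

lemma tl_functional_diff:
  assumes "tl_functional n h" "tl_functional n g"
  shows "tl_functional n (\<lambda>u. h u - g u)"
  unfolding tl_functional_def tl_relation_def
proof (intro allI impI)
  fix u i j k
  assume "u permutes {1..n}" "{i, j, k} \<subseteq> {1..n}" "i \<noteq> j" "j \<noteq> k" "i \<noteq> k"
  then have "i \<in> {1..n}" "j \<in> {1..n}" "k \<in> {1..n}" "u permutes {1..n}" "i \<noteq> j" "j \<noteq> k" "i \<noteq> k" by auto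
  note D = tl_functionalD[OF _ this(4,1,2,3,5,6,7)]
  from D[OF assms(1)] D[OF assms(2)] show "h u - g u
      + (h (u \<circ> Transposition.transpose i j \<circ> Transposition.transpose j k)
          - g (u \<circ> Transposition.transpose i j \<circ> Transposition.transpose j k))
      + (h (u \<circ> Transposition.transpose j k \<circ> Transposition.transpose i j)
          - g (u \<circ> Transposition.transpose j k \<circ> Transposition.transpose i j)) =
      (h (u \<circ> Transposition.transpose i j) - g (u \<circ> Transposition.transpose i j))
      + (h (u \<circ> Transposition.transpose j k) - g (u \<circ> Transposition.transpose j k))
      + (h (u \<circ> Transposition.transpose i k) - g (u \<circ> Transposition.transpose i k))"
    by (simp add: algebra_simps)
qed

text \<open>\<open>word_action [i\<^sub>1, \<dots>, i\<^sub>k] h u\<close> is the value at $u (1 - s_{i_1}) \cdots (1 - s_{i_k})$ of the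
  linear extension of \<open>h\<close> to the group algebra.\<close>

primrec word_action :: "nat list \<Rightarrow> ((nat \<Rightarrow> nat) \<Rightarrow> complex) \<Rightarrow> (nat \<Rightarrow> nat) \<Rightarrow> complex" where
  "word_action [] h u = h u"
| "word_action (i # x) h u = word_action x h u - word_action x h (u \<circ> simple_transposition i)"

lemma word_action_append: "word_action (x @ y) h u = word_action x (word_action y h) u"
  by (induction x arbitrary: u) auto

lemma word_action_left_translate:
  "word_action x (\<lambda>u. h (a \<circ> u)) u = word_action x h (a \<circ> u)"
  by (induction x arbitrary: u) (auto simp: o_assoc)

lemma word_action_cong:
  assumes "\<And>u. u permutes {1..n} \<Longrightarrow> h u = g u" "x \<in> lists {1..<n}" "u permutes {1..n}"
  shows "word_action x h u = word_action x g u"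
  using assms(2,3)
proof (induction x arbitrary: u)
  case (Cons i x)
  then have "u \<circ> simple_transposition i permutes {1..n}"
    by (intro permutes_compose simple_transposition_permutes) auto
  then show ?case using Cons by auto
qed (use assms(1) in auto)

lemma word_action_0 [simp]: "word_action x (\<lambda>_. 0) u = 0"
  by (induction x arbitrary: u) auto

lemma word_action_zero:
  assumes "\<And>u. u permutes {1..n} \<Longrightarrow> h u = 0" "x \<in> lists {1..<n}" "u permutes {1..n}"
  shows "word_action x h u = 0"
  using word_action_cong[of n h "\<lambda>_. 0", OF assms] by simp

lemma word_action_scale: "word_action x (\<lambda>u. c * h u) u = c * word_action x h u"
  by (induction x arbitrary: u) (auto simp: algebra_simps)

lemma word_action_sum: "word_action x (\<lambda>u. \<Sum>y\<in>A. h y u) u = (\<Sum>y\<in>A. word_action x (h y) u)"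
  by (induction x arbitrary: u) (auto simp: sum_subtractf)

lemma tl_functional_word_action:
  assumes "tl_functional n h" "x \<in> lists {1..<n}"
  shows "tl_functional n (word_action x h)"
  using assms(2)
proof (induction x)
  case Nil
  then show ?case using assms(1) by (simp add: eta_contract_eq)
next
  case (Cons i x)
  then have IH: "tl_functional n (word_action x h)" and i: "i \<in> {1..<n}" by auto
  have "tl_functional n (\<lambda>u. word_action x h u - word_action x h (u \<circ> simple_transposition i))"
    by (rule tl_functional_diff[OF IH tl_functional_right_translate[OF IH simple_transposition_permutes[OF i]]])
  then show ?case by (simp add: eta_contract_eq)
qed

lemma word_action_square:
  "word_action [i, i] h u = 2 * word_action [i] h u"
  by (simp add: o_assoc[symmetric] del: comp_apply)

lemma word_action_commute:
  assumes "\<bar>int i - int j\<bar> \<ge> 2"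
  shows "word_action [i, j] h u = word_action [j, i] h u"
proof -
  have "simple_transposition i \<circ> simple_transposition j = simple_transposition j \<circ> simple_transposition i"
    using assms by (auto simp: fun_eq_iff Transposition.transpose_def)
  then have "u \<circ> simple_transposition i \<circ> simple_transposition j =
      u \<circ> simple_transposition j \<circ> simple_transposition i" by (metis o_assoc)
  then show ?thesis by simp
qed

text \<open>The expansion of (1 - s_i)(1 - s_j)(1 - s_i) - (1 - s_i) is exactly the alternating sum
  over the permutations of the three positions involved.\<close>

lemma word_action_braid:
  assumes h: "tl_functional n h" and u: "u permutes {1..n}"
    and ij: "i \<in> {1..<n}" "j \<in> {1..<n}" "\<bar>int i - int j\<bar> = 1"
  shows "word_action [i, j, i] h u = word_action [i] h u"
proof -
  define a b c where "a = min i j" and "b = Suc (min i j)" and "c = Suc (Suc (min i j))"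
  let ?ab = "Transposition.transpose a b" and ?bc = "Transposition.transpose b c"
    and ?ac = "Transposition.transpose a c"
  have mem: "a \<in> {1..n}" "b \<in> {1..n}" "c \<in> {1..n}" and ne: "a \<noteq> b" "b \<noteq> c" "a \<noteq> c"
    using ij by (auto simp: a_def b_def c_def)
  note rel = tl_functionalD[OF h u mem ne]
  have triple: "v \<circ> ?ab \<circ> ?bc \<circ> ?ab = v \<circ> ?ac" "v \<circ> ?bc \<circ> ?ab \<circ> ?bc = v \<circ> ?ac" for v :: "nat \<Rightarrow> nat"
    using ne by (auto simp: fun_eq_iff Transposition.transpose_def)
  have sq: "v \<circ> Transposition.transpose x y \<circ> Transposition.transpose x y = v"
    for v :: "nat \<Rightarrow> nat" and x y :: nat
    by (simp add: o_assoc[symmetric] del: comp_apply)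
  consider "simple_transposition i = ?ab" "simple_transposition j = ?bc"
    | "simple_transposition i = ?bc" "simple_transposition j = ?ab"
  proof (cases "i < j")
    case True
    then have "i = a" "Suc i = b" "j = b" "Suc j = c" using ij by (auto simp: a_def b_def c_def)
    then show ?thesis using that(1) by simp
  next
    case False
    then have "j = a" "Suc j = b" "i = b" "Suc i = c" using ij by (auto simp: a_def b_def c_def)
    then show ?thesis using that(2) by simp
  qed
  then show ?thesis
  proof cases
    case 1
    show ?thesis
      unfolding word_action.simps 1 triple sq using rel by (simp add: algebra_simps del: comp_apply)
  next
    case 2
    show ?thesis
      unfolding word_action.simps 2 triple sq using rel by (simp add: algebra_simps del: comp_apply)
  qed
qed

text \<open>Expanding the product along a reduced word of w produces products of subwords, all of
  which lie below w. The induction splits off the last letter, and the lifting property keeps the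
  permutations below w.\<close>

lemma word_action_vanishes:
  assumes "reduced_word n w x" "\<And>u. u permutes {1..n} \<Longrightarrow> bruhat_le u w \<Longrightarrow> h u = 0"
  shows "word_action x h id = 0"
  using assms
proof (induction x arbitrary: w h rule: rev_induct)
  case Nil
  then have "w = id" by (simp add: reduced_word_iff)
  then have "h id = 0" by (intro Nil.prems(2)) (simp_all only: permutes_id bruhat_le_refl)
  then show ?case by (simp del: id_apply)
next
  case (snoc i x)
  let ?s = "simple_transposition i"
  note w = reduced_word_snocD[OF snoc.prems(1)]
  have asc: "(w \<circ> ?s) i < (w \<circ> ?s) (Suc i)" using w(2) by simp
  have ws: "(w \<circ> ?s) \<circ> ?s = w" by (simp add: o_assoc[symmetric] del: comp_apply)
  have "word_action [i] h u = 0" if "u permutes {1..n}" "bruhat_le u (w \<circ> ?s)" for u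
  proof -
    have "bruhat_le (w \<circ> ?s) w" using bruhat_le_ascent[OF asc] unfolding ws .
    then have "bruhat_le u w" using that(2) bruhat_le_trans by blast
    moreover have "bruhat_le (u \<circ> ?s) w" using bruhat_le_lift[OF that(2) asc] w(3) unfolding ws by simp
    moreover have "u \<circ> ?s permutes {1..n}"
      using that(1) w(3) by (intro permutes_compose simple_transposition_permutes)
    ultimately show ?thesis using snoc.prems(2) that(1) by simp
  qed
  then show ?case unfolding word_action_append by (rule snoc.IH[OF w(1)])
qed

text \<open>In the same expansion only the full word reaches w itself, and each letter contributes a
  sign.\<close>

lemma word_action_leading:
  assumes "reduced_word n w x"
    "\<And>u. u permutes {1..n} \<Longrightarrow> bruhat_le u w \<Longrightarrow> u \<noteq> w \<Longrightarrow> h u = 0"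
  shows "word_action x h id = (-1) ^ length x * h w"
  using assms
proof (induction x arbitrary: w h rule: rev_induct)
  case Nil
  then show ?case by (simp add: reduced_word_iff)
next
  case (snoc i x)
  let ?s = "simple_transposition i"
  note w = reduced_word_snocD[OF snoc.prems(1)]
  have asc: "(w \<circ> ?s) i < (w \<circ> ?s) (Suc i)" using w(2) by simp
  have ws: "(w \<circ> ?s) \<circ> ?s = w" "u \<circ> ?s = w \<Longrightarrow> u = w \<circ> ?s" for u
    by (auto simp: o_assoc[symmetric] simp del: comp_apply)
  have below: "bruhat_le (w \<circ> ?s) w" using bruhat_le_ascent[OF asc] unfolding ws .
  have p: "w \<circ> ?s permutes {1..n}"
    using w(3,4) by (intro permutes_compose simple_transposition_permutes)
  have "word_action [i] h u = 0"
    if "u permutes {1..n}" "bruhat_le u (w \<circ> ?s)" "u \<noteq> w \<circ> ?s" for u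
  proof -
    have "bruhat_le u w" using that(2) below bruhat_le_trans by blast
    moreover have "u \<noteq> w" using that below bruhat_le_antisym by blast
    moreover have "bruhat_le (u \<circ> ?s) w" using bruhat_le_lift[OF that(2) asc] w(3) unfolding ws by simp
    moreover have "u \<circ> ?s \<noteq> w" using ws(2) that(3) by blast
    moreover have "u \<circ> ?s permutes {1..n}"
      using that(1) w(3) by (intro permutes_compose simple_transposition_permutes)
    ultimately show ?thesis using snoc.prems(2) that(1) by simp
  qed
  then have "word_action x (word_action [i] h) id = (-1) ^ length x * word_action [i] h (w \<circ> ?s)"
    by (rule snoc.IH[OF w(1)])
  moreover have "w \<circ> ?s \<noteq> w" using w(2) by (metis comp_apply less_irrefl transpose_apply_first)
  then have "word_action [i] h (w \<circ> ?s) = - h w"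
    using snoc.prems(2)[OF p below] ws(1) by (metis word_action.simps diff_0)
  ultimately show ?case unfolding word_action_append by simp
qed

section \<open>Rewriting words in the generators\<close>

text \<open>No bounds on the positions: the members of an inversion of a permutation of
  \<open>{1..n}\<close> lie in this range automatically.\<close>

definition has_321 :: "(nat \<Rightarrow> nat) \<Rightarrow> bool"
  where "has_321 w \<longleftrightarrow> (\<exists>a b c. a < b \<and> b < c \<and> w c < w b \<and> w b < w a)"

lemma contains_321_iff_has_321:
  assumes "w permutes {1..n}"
  shows "contains_pattern n w [3,2,1] \<longleftrightarrow> has_321 w"
proof
  assume "has_321 w"
  then obtain a b c where abc: "a < b" "b < c" "w c < w b" "w b < w a" by (auto simp: has_321_def)
  then have "(a, b) \<in> inversions w" "(b, c) \<in> inversions w" by (auto simp: inversions_def)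
  then have "1 \<le> a" "c \<le> n" using inversions_subset[OF assms] by auto
  then show "contains_pattern n w [3,2,1]" unfolding contains_321_iff[OF assms] using abc by blast
qed (auto simp: contains_321_iff[OF assms] has_321_def)

lemma avoiders_321_iff: "w \<in> avoiders_321 n \<longleftrightarrow> w permutes {1..n} \<and> \<not> has_321 w"
  using contains_321_iff_has_321 by (auto simp: avoiders_321_def)

lemma simple_transposition_less:
  "a < b \<Longrightarrow> \<not> (a = i \<and> b = Suc i) \<Longrightarrow> simple_transposition i a < simple_transposition i b"
  by (auto simp: Transposition.transpose_def)

lemma not_has_321_descent:
  assumes "\<not> has_321 w" "w (Suc i) < w i"
  shows "\<not> has_321 (w \<circ> simple_transposition i)"
proof
  let ?s = "simple_transposition i"
  assume "has_321 (w \<circ> ?s)"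
  then obtain a b c where abc: "a < b" "b < c" "w (?s c) < w (?s b)" "w (?s b) < w (?s a)"
    by (auto simp: has_321_def)
  have "?s a < ?s b" using abc assms(2) by (intro simple_transposition_less) auto
  moreover have "?s b < ?s c" using abc assms(2) by (intro simple_transposition_less) auto
  ultimately show False using assms(1) abc unfolding has_321_def by blast
qed

lemma descent_range:
  assumes "w permutes {1..n}" "w (Suc i) < w i"
  shows "i \<in> {1..<n}"
proof -
  have "(i, Suc i) \<in> inversions w" using assms(2) by (simp add: inversions_def)
  then show ?thesis using inversions_subset[OF assms(1)] by auto
qed

lemma exists_descent:
  fixes w :: "nat \<Rightarrow> nat"
  assumes "a < b" "w b < w a"
  shows "\<exists>j. a \<le> j \<and> j < b \<and> w (Suc j) < w j"
proof (rule ccontr)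
  assume "\<not> ?thesis"
  then have asc: "w j \<le> w (Suc j)" if "a \<le> j" "j < b" for j using that by auto
  have "k \<le> b \<longrightarrow> w a \<le> w k" if "a \<le> k" for k
    using that by (induction k rule: dec_induct) (auto, meson asc Suc_le_lessD order_trans)
  from this[of b] show False using assms by simp
qed

text \<open>\<open>tl_reduces n x c y\<close> stands for the equation x = c y between monomials.
  Every relation of the algebra equates a monomial with a multiple of a monomial, so rewriting never
  produces sums, and a scalar is all that has to be carried along.\<close>

inductive tl_reduces :: "nat \<Rightarrow> nat list \<Rightarrow> complex \<Rightarrow> nat list \<Rightarrow> bool" for n where
  refl: "x \<in> lists {1..<n} \<Longrightarrow> tl_reduces n x 1 x"
| trans: "tl_reduces n x c y \<Longrightarrow> tl_reduces n y d z \<Longrightarrow> tl_reduces n x (c * d) z"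
| in_context: "a \<in> lists {1..<n} \<Longrightarrow> b \<in> lists {1..<n} \<Longrightarrow> tl_reduces n x c y \<Longrightarrow>
    tl_reduces n (a @ x @ b) c (a @ y @ b)"
| square: "i \<in> {1..<n} \<Longrightarrow> tl_reduces n [i, i] 2 [i]"
| commute: "i \<in> {1..<n} \<Longrightarrow> j \<in> {1..<n} \<Longrightarrow> \<bar>int i - int j\<bar> \<ge> 2 \<Longrightarrow> tl_reduces n [i, j] 1 [j, i]"
| braid: "i \<in> {1..<n} \<Longrightarrow> j \<in> {1..<n} \<Longrightarrow> \<bar>int i - int j\<bar> = 1 \<Longrightarrow> tl_reduces n [i, j, i] 1 [i]"

lemma tl_reduces_lists:
  "tl_reduces n x c y \<Longrightarrow> x \<in> lists {1..<n} \<and> y \<in> lists {1..<n}"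
  by (induction rule: tl_reduces.induct) auto

lemma tl_reduces_trans1:
  "tl_reduces n x 1 y \<Longrightarrow> tl_reduces n y c z \<Longrightarrow> tl_reduces n x c z"
  using tl_reduces.trans[of n x 1 y c z] by simp

lemma tl_reduces_snoc:
  "tl_reduces n x c y \<Longrightarrow> i \<in> {1..<n} \<Longrightarrow> tl_reduces n (x @ [i]) c (y @ [i])"
  using tl_reduces.in_context[of "[]" n "[i]" x c y] by simp

lemma tl_reduces_prefix:
  "tl_reduces n x c y \<Longrightarrow> a \<in> lists {1..<n} \<Longrightarrow> tl_reduces n (a @ x) c (a @ y)"
  using tl_reduces.in_context[of a n "[]" x c y] by simp

lemma tl_reduces_commute_snoc:
  assumes "z \<in> lists {1..<n}" "i \<in> {1..<n}" "j \<in> {1..<n}" "\<bar>int i - int j\<bar> \<ge> 2"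
  shows "tl_reduces n ((z @ [i]) @ [j]) 1 ((z @ [j]) @ [i])"
  using tl_reduces_prefix[OF tl_reduces.commute[OF assms(2-4)] assms(1)] by simp

text \<open>Full commutativity of 321-avoiding permutations: descents at i and i + 1 would form a
  321, so distinct last letters i and j commute. By induction both words can be brought to a common
  beginning followed by i and j in the two orders.\<close>

lemma reduced_words_equivalent:
  assumes "\<not> has_321 w" "reduced_word n w x" "reduced_word n w y"
  shows "tl_reduces n x 1 y"
  using assms
proof (induction "length x" arbitrary: w x y rule: less_induct)
  case less
  have len: "length x = length y" and y: "y \<in> lists {1..<n}" and x: "x \<in> lists {1..<n}"
    using less.prems by (auto simp: reduced_word_iff)
  show ?case
  proof (cases x rule: rev_cases)
    case Nil
    then show ?thesis using len y by (auto intro: tl_reduces.refl)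
  next
    case xi: (snoc x' i)
    then obtain y' j where yj: "y = y' @ [j]" using len by (cases y rule: rev_cases) auto
    note ri = reduced_word_snocD[OF less.prems(2)[unfolded xi]]
    note rj = reduced_word_snocD[OF less.prems(3)[unfolded yj]]
    have av: "\<not> has_321 (w \<circ> simple_transposition i)" "\<not> has_321 (w \<circ> simple_transposition j)"
      using not_has_321_descent less.prems(1) ri(2) rj(2) by blast+
    have len': "length x' < length x" "length y' < length x" using xi yj len by auto
    show ?thesis
    proof (cases "i = j")
      case True
      then have "tl_reduces n x' 1 y'" using less.hyps[OF len'(1) av(1) ri(1)] rj(1) by simp
      then show ?thesis using tl_reduces_snoc[OF _ ri(3)] True by (simp add: xi yj)
    next
      case False
      have "j \<noteq> Suc i" "i \<noteq> Suc j" using less.prems(1) ri(2) rj(2) unfolding has_321_def by blast+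
      then have far: "\<bar>int j - int i\<bar> \<ge> 2" using False by auto
      let ?si = "simple_transposition i" and ?sj = "simple_transposition j"
      have di: "(w \<circ> ?sj) (Suc i) < (w \<circ> ?sj) i" and dj: "(w \<circ> ?si) (Suc j) < (w \<circ> ?si) j"
        using ri(2) rj(2) far by (auto simp: Transposition.transpose_def)
      have p: "w \<circ> ?si permutes {1..n}" "w \<circ> ?sj permutes {1..n}"
        using ri(3,4) rj(3) by (auto intro!: permutes_compose simple_transposition_permutes simp del: comp_apply)
      have comm: "(w \<circ> ?si) \<circ> ?sj = (w \<circ> ?sj) \<circ> ?si"
        using far by (auto simp: fun_eq_iff Transposition.transpose_def)
      have "(w \<circ> ?si) \<circ> ?sj permutes {1..n}"
        by (rule permutes_compose[OF simple_transposition_permutes[OF rj(3)] p(1)])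
      then obtain z where z: "reduced_word n ((w \<circ> ?si) \<circ> ?sj) z"
        using exists_reduced_word by blast
      have zj: "reduced_word n (w \<circ> ?si) (z @ [j])"
        by (rule reduced_word_snocI[OF p(1) dj rj(3) z])
      have zi: "reduced_word n (w \<circ> ?sj) (z @ [i])"
        by (rule reduced_word_snocI[OF p(2) di ri(3) z[unfolded comm]])
      have len_z: "length (z @ [i]) < length x"
        using zi rj(1) len' by (simp add: reduced_word_iff)
      have "tl_reduces n x 1 ((z @ [j]) @ [i])"
        unfolding xi by (rule tl_reduces_snoc[OF less.hyps[OF len'(1) av(1) ri(1) zj] ri(3)])
      also have "tl_reduces n ((z @ [j]) @ [i]) 1 ((z @ [i]) @ [j])"
        by (rule tl_reduces_commute_snoc) (use z ri(3) rj(3) far in \<open>auto simp: reduced_word_iff\<close>)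
      finally (tl_reduces_trans1) have "tl_reduces n x 1 ((z @ [i]) @ [j])" .
      also have "tl_reduces n ((z @ [i]) @ [j]) 1 y"
        unfolding yj by (rule tl_reduces_snoc[OF less.hyps[OF len_z av(2) zi rj(1)] rj(3)])
      finally (tl_reduces_trans1) show ?thesis .
    qed
  qed
qed

text \<open>The 321 created by s_i involves the positions i and i + 1 and a third one. If the
  neighbour of i on that side is a descent j, the word can be made to end in i j, and appending i
  allows the braid relation to remove two letters. Otherwise there is a descent j between the third
  position and that neighbour; it commutes with i, and the induction hypothesis applies to w
  s_j.\<close>

lemma word_shortens:
  assumes "\<not> has_321 w" "reduced_word n w x" "i \<in> {1..<n}" "w i < w (Suc i)"
    "has_321 (w \<circ> simple_transposition i)"
  shows "\<exists>y. tl_reduces n (x @ [i]) 1 y \<and> length y < length (x @ [i])"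
  using assms
proof (induction "length x" arbitrary: w x rule: less_induct)
  case less
  let ?si = "simple_transposition i"
  have w: "w permutes {1..n}" using less.prems(2) word_perm_permutes by (auto simp: reduced_word_iff)
  have inj: "inj w" by (rule permutes_inj[OF w])
  obtain a b c where abc: "a < b" "b < c" "(w \<circ> ?si) c < (w \<circ> ?si) b" "(w \<circ> ?si) b < (w \<circ> ?si) a"
    using less.prems(5) by (auto simp: has_321_def)
  have "\<not> (?si a < ?si b \<and> ?si b < ?si c)"
    using less.prems(1) abc unfolding has_321_def comp_apply by blast
  then have "a = i \<and> b = Suc i \<or> b = i \<and> c = Suc i"
    using simple_transposition_less abc(1,2) by blast
  then have side: "(\<exists>a<i. w (Suc i) < w a) \<or> (\<exists>c>Suc i. w c < w i)"
    using abc by (auto simp: Transposition.transpose_def split: if_splits)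
  have by_braid: ?case if j: "\<bar>int i - int j\<bar> = 1" "w (Suc j) < w j"
      "(w \<circ> simple_transposition j) (Suc i) < (w \<circ> simple_transposition j) i" for j
  proof -
    let ?sj = "simple_transposition j"
    have jn: "j \<in> {1..<n}" by (rule descent_range[OF w j(2)])
    have p: "w \<circ> ?sj permutes {1..n}" by (rule permutes_compose[OF simple_transposition_permutes[OF jn] w])
    have "(w \<circ> ?sj) \<circ> ?si permutes {1..n}"
      by (rule permutes_compose[OF simple_transposition_permutes[OF less.prems(3)] p])
    then obtain z where z: "reduced_word n ((w \<circ> ?sj) \<circ> ?si) z" using exists_reduced_word by blast
    have "reduced_word n (w \<circ> ?sj) (z @ [i])" by (rule reduced_word_snocI[OF p j(3) less.prems(3) z])
    then have zw: "reduced_word n w ((z @ [i]) @ [j])" by (rule reduced_word_snocI[OF w j(2) jn])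
    have zl: "z \<in> lists {1..<n}" using z by (simp add: reduced_word_iff)
    have "tl_reduces n (x @ [i]) 1 (((z @ [i]) @ [j]) @ [i])"
      by (rule tl_reduces_snoc[OF reduced_words_equivalent[OF less.prems(1,2) zw] less.prems(3)])
    also have "tl_reduces n (((z @ [i]) @ [j]) @ [i]) 1 (z @ [i])"
      using tl_reduces_prefix[OF tl_reduces.braid[OF less.prems(3) jn j(1)] zl] by simp
    finally (tl_reduces_trans1) have "tl_reduces n (x @ [i]) 1 (z @ [i])" .
    moreover have "length x = length ((z @ [i]) @ [j])"
      using zw less.prems(2) by (simp add: reduced_word_iff)
    ultimately show ?thesis by (intro exI[of _ "z @ [i]"]) simp
  qed
  have by_commute: ?case if j: "\<bar>int i - int j\<bar> \<ge> 2" "w (Suc j) < w j"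
      "has_321 ((w \<circ> simple_transposition j) \<circ> ?si)" for j
  proof -
    let ?sj = "simple_transposition j"
    have jn: "j \<in> {1..<n}" by (rule descent_range[OF w j(2)])
    have p: "w \<circ> ?sj permutes {1..n}" by (rule permutes_compose[OF simple_transposition_permutes[OF jn] w])
    then obtain z where z: "reduced_word n (w \<circ> ?sj) z" using exists_reduced_word by blast
    have zw: "reduced_word n w (z @ [j])" by (rule reduced_word_snocI[OF w j(2) jn z])
    have len: "length x = Suc (length z)" using zw less.prems(2) by (simp add: reduced_word_iff)
    have zl: "z \<in> lists {1..<n}" using z by (simp add: reduced_word_iff)
    have "(w \<circ> ?sj) i < (w \<circ> ?sj) (Suc i)"
      using less.prems(4) j(1) by (auto simp: Transposition.transpose_def)
    then obtain y where y: "tl_reduces n (z @ [i]) 1 y" "length y < length (z @ [i])"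
      using less.hyps[OF _ not_has_321_descent[OF less.prems(1) j(2)] z less.prems(3) _ j(3)] len by auto
    have "tl_reduces n (x @ [i]) 1 ((z @ [j]) @ [i])"
      by (rule tl_reduces_snoc[OF reduced_words_equivalent[OF less.prems(1,2) zw] less.prems(3)])
    also have "tl_reduces n ((z @ [j]) @ [i]) 1 ((z @ [i]) @ [j])"
      by (rule tl_reduces_commute_snoc) (use zl jn less.prems(3) j(1) in auto)
    finally (tl_reduces_trans1) have "tl_reduces n (x @ [i]) 1 ((z @ [i]) @ [j])" .
    also have "tl_reduces n ((z @ [i]) @ [j]) 1 (y @ [j])"
      by (rule tl_reduces_snoc[OF y(1) jn])
    finally (tl_reduces_trans1) show ?thesis using y(2) len by (intro exI[of _ "y @ [j]"]) simp
  qed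
  from side show ?case
  proof (elim disjE exE conjE)
    fix a assume a: "a < i" "w (Suc i) < w a"
    obtain k where k: "i = Suc k" using a by (cases i) auto
    show ?case
    proof (cases "w i < w k")
      case True
      \<comment> \<open>For a distinct from k, the inequality w k < w a would make the positions a,
        k, i a 321.\<close>
      have "w (Suc i) < w k"
      proof (cases "a = k")
        case False
        then have "a < k" "k < i" using a k by auto
        then have "\<not> w k < w a" using less.prems(1) True unfolding has_321_def by blast
        then show ?thesis using a(2) by simp
      qed (use a in simp)
      then show ?thesis using True k
        by (intro by_braid[of k]) (auto simp: Transposition.transpose_def)
    next
      case False
      then have "w k < w i" using inj k by (metis injD linorder_neqE_nat n_not_Suc_n)
      then have "w k < w a" using less.prems(4) a(2) by simp
      then have "a < k" using a(1) k by (metis less_Suc_eq less_irrefl)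
      then obtain j where j: "a \<le> j" "j < k" "w (Suc j) < w j"
        using exists_descent[of a k w] \<open>w k < w a\<close> by blast
      let ?sj = "simple_transposition j"
      have "?sj a < i" using j(1,2) k \<open>a < k\<close> by (auto simp: Transposition.transpose_def)
      moreover have "((w \<circ> ?sj) \<circ> ?si) (?sj a) = w a"
        using j k \<open>a < k\<close> by (auto simp: Transposition.transpose_def)
      moreover have "((w \<circ> ?sj) \<circ> ?si) i = w (Suc i)" "((w \<circ> ?sj) \<circ> ?si) (Suc i) = w i"
        using j k by (auto simp: Transposition.transpose_def)
      ultimately have "has_321 ((w \<circ> ?sj) \<circ> ?si)"
        using a(2) less.prems(4) unfolding has_321_def by (metis lessI)
      then show ?thesis using j k by (intro by_commute[of j]) auto
    qed
  next
    fix c assume c: "Suc i < c" "w c < w i"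
    show ?case
    proof (cases "w (Suc (Suc i)) < w (Suc i)")
      case True
      have "w (Suc (Suc i)) < w i"
      proof (cases "c = Suc (Suc i)")
        case False
        then have "Suc (Suc i) < c" "Suc i < Suc (Suc i)" using c by auto
        then have "\<not> w c < w (Suc (Suc i))" using less.prems(1) True unfolding has_321_def by blast
        then show ?thesis using c(2) by simp
      qed (use c in simp)
      then show ?thesis using True
        by (intro by_braid[of "Suc i"]) (auto simp: Transposition.transpose_def)
    next
      case False
      let ?k = "Suc (Suc i)"
      have "w (Suc i) < w ?k" using False inj by (metis injD linorder_neqE_nat n_not_Suc_n)
      then have "w c < w ?k" using less.prems(4) c(2) by simp
      then have "?k < c" using c(1) by (metis Suc_leI less_irrefl le_neq_implies_less)
      then obtain j where j: "?k \<le> j" "j < c" "w (Suc j) < w j"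
        using exists_descent[of ?k c w] \<open>w c < w ?k\<close> by blast
      let ?sj = "simple_transposition j"
      have "Suc i < ?sj c" using j(1,2) \<open>?k < c\<close> by (auto simp: Transposition.transpose_def)
      moreover have "((w \<circ> ?sj) \<circ> ?si) (?sj c) = w c"
        using j \<open>?k < c\<close> by (auto simp: Transposition.transpose_def)
      moreover have "((w \<circ> ?sj) \<circ> ?si) i = w (Suc i)" "((w \<circ> ?sj) \<circ> ?si) (Suc i) = w i"
        using j by (auto simp: Transposition.transpose_def)
      ultimately have "has_321 ((w \<circ> ?sj) \<circ> ?si)"
        using c(2) less.prems(4) unfolding has_321_def by (metis lessI)
      then show ?thesis using j by (intro by_commute[of j]) auto
    qed
  qed
qed

text \<open>Appending i to a reduced word of w has three outcomes: a descent at i gives a square and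
  the factor 2; w s_i is longer and still avoids 321; or the word shortens. The bound on the length
  of y ensures that in the last case the result is shorter than x, so that the induction applies
  again.\<close>

lemma word_reduces:
  assumes "x \<in> lists {1..<n}"
  shows "\<exists>c y w. tl_reduces n x c y \<and> length y \<le> length x \<and> w \<in> avoiders_321 n \<and> reduced_word n w y"
  using assms
proof (induction "length x" arbitrary: x rule: less_induct)
  case less
  show ?case
  proof (cases x rule: rev_cases)
    case Nil
    have "id \<in> avoiders_321 n" by (auto simp: avoiders_321_iff has_321_def permutes_id simp del: id_apply)
      (simp add: id_def)
    moreover have "reduced_word n id []" by (simp add: reduced_word_def)
    moreover have "tl_reduces n x 1 []" using Nil by (simp add: tl_reduces.refl)
    ultimately show ?thesis using Nil by blast
  next
    case (snoc x' i)
    then have i: "i \<in> {1..<n}" and x': "x' \<in> lists {1..<n}" "length x' < length x"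
      using less.prems by auto
    obtain c y w where y: "tl_reduces n x' c y" "length y \<le> length x'" "w \<in> avoiders_321 n"
        "reduced_word n w y"
      using less.hyps[OF x'(2,1)] by blast
    have w: "w permutes {1..n}" "\<not> has_321 w" using y(3) by (auto simp: avoiders_321_iff)
    have red: "tl_reduces n x c (y @ [i])" unfolding snoc by (rule tl_reduces_snoc[OF y(1) i])
    let ?s = "simple_transposition i"
    have p: "w \<circ> ?s permutes {1..n}" by (rule permutes_compose[OF simple_transposition_permutes[OF i] w(1)])
    consider "w (Suc i) < w i" | "w i < w (Suc i)" "\<not> has_321 (w \<circ> ?s)" | "w i < w (Suc i)" "has_321 (w \<circ> ?s)"
      using ascent_or_descent[OF w(1)] by blast
    then show ?thesis
    proof cases
      case 1
      obtain z where z: "reduced_word n (w \<circ> ?s) z" using exists_reduced_word[OF p] by blast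
      have zi: "reduced_word n w (z @ [i])" by (rule reduced_word_snocI[OF w(1) 1 i z])
      have zl: "z \<in> lists {1..<n}" using z by (simp add: reduced_word_iff)
      have "tl_reduces n (y @ [i]) 1 ((z @ [i]) @ [i])"
        by (rule tl_reduces_snoc[OF reduced_words_equivalent[OF w(2) y(4) zi] i])
      also have "tl_reduces n ((z @ [i]) @ [i]) 2 (z @ [i])"
        using tl_reduces_prefix[OF tl_reduces.square[OF i] zl] by simp
      finally (tl_reduces_trans1) have "tl_reduces n x (c * 2) (z @ [i])"
        using tl_reduces.trans[OF red] by blast
      moreover have "length (z @ [i]) \<le> length x"
        using zi y(2,4) snoc by (simp add: reduced_word_iff)
      ultimately show ?thesis using y(3) zi by blast
    next
      case 2
      have ws: "(w \<circ> ?s) \<circ> ?s = w" by (simp add: o_assoc[symmetric] del: comp_apply)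
      have "(w \<circ> ?s) (Suc i) < (w \<circ> ?s) i" using 2(1) by simp
      then have "reduced_word n (w \<circ> ?s) (y @ [i])"
        using y(4) by (intro reduced_word_snocI[OF p _ i]) (auto simp only: ws)
      moreover have "w \<circ> ?s \<in> avoiders_321 n" using p 2(2) by (simp add: avoiders_321_iff)
      moreover have "length (y @ [i]) \<le> length x" using y(2) snoc by simp
      ultimately show ?thesis using red by blast
    next
      case 3
      obtain z where z: "tl_reduces n (y @ [i]) 1 z" "length z < length (y @ [i])"
        using word_shortens[OF w(2) y(4) i 3] by blast
      have xz: "tl_reduces n x c z" using tl_reduces.trans[OF red z(1)] by simp
      have "length z < length x" using z(2) y(2) snoc by simp
      then obtain d v u where u: "tl_reduces n z d v" "length v \<le> length z" "u \<in> avoiders_321 n"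
          "reduced_word n u v"
        using less.hyps tl_reduces_lists[OF z(1)] by blast
      have "tl_reduces n x (c * d) v" by (rule tl_reduces.trans[OF xz u(1)])
      then show ?thesis using u \<open>length z < length x\<close> by (meson less_imp_le order_trans)
    qed
  qed
qed

text \<open>The same choice as in \<open>tl_basis\<close>, so that the basis elements are literally
  the classes of these words.\<close>

definition basis_word :: "nat \<Rightarrow> (nat \<Rightarrow> nat) \<Rightarrow> nat list"
  where "basis_word n w = (SOME x. reduced_word n w x)"

lemma reduced_basis_word: "w permutes {1..n} \<Longrightarrow> reduced_word n w (basis_word n w)"
  unfolding basis_word_def using exists_reduced_word by (rule someI_ex)

lemma word_reduces_to_basis_word:
  assumes "x \<in> lists {1..<n}"
  shows "\<exists>c w. w \<in> avoiders_321 n \<and> tl_reduces n x c (basis_word n w)"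
proof -
  obtain c y w where y: "tl_reduces n x c y" "w \<in> avoiders_321 n" "reduced_word n w y"
    using word_reduces[OF assms] by blast
  then have "tl_reduces n y 1 (basis_word n w)"
    using reduced_words_equivalent reduced_basis_word by (auto simp: avoiders_321_iff)
  then show ?thesis using tl_reduces.trans[OF y(1)] y(2) by fastforce
qed

section \<open>Monoid algebras\<close>

lemma poly_mapping_expand:
  assumes "finite K" "Poly_Mapping.keys p \<subseteq> K"
  shows "p = (\<Sum>v\<in>K. Poly_Mapping.single v (Poly_Mapping.lookup p v))"
proof (rule poly_mapping_eqI)
  fix k
  have "(\<Sum>v\<in>K. Poly_Mapping.lookup p v when v = k) =
      (\<Sum>v\<in>K. if v = k then Poly_Mapping.lookup p k else 0)"
    by (intro sum.cong) (auto simp: when_def)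
  also have "\<dots> = Poly_Mapping.lookup p k"
    using assms by (auto simp: not_in_keys_iff_lookup_eq_zero)
  finally show "Poly_Mapping.lookup p k =
      Poly_Mapping.lookup (\<Sum>v\<in>K. Poly_Mapping.single v (Poly_Mapping.lookup p v)) k"
    by (simp add: lookup_sum lookup_single)
qed

text \<open>Index sets larger than the supports are allowed because the support of a sum can shrink
  by cancellation; products can then be compared over one common index set.\<close>

lemma monoid_algebra_mult:
  assumes "finite K" "Poly_Mapping.keys p \<subseteq> K" "finite L" "Poly_Mapping.keys q \<subseteq> L"
  shows "p \<otimes>\<^bsub>monoid_algebra G\<^esub> q = (\<Sum>v\<in>K. \<Sum>w\<in>L.
    Poly_Mapping.single (v \<otimes>\<^bsub>G\<^esub> w) (Poly_Mapping.lookup p v * Poly_Mapping.lookup q w))"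
proof -
  have "p \<otimes>\<^bsub>monoid_algebra G\<^esub> q = (\<Sum>v\<in>Poly_Mapping.keys p. \<Sum>w\<in>L.
      Poly_Mapping.single (v \<otimes>\<^bsub>G\<^esub> w) (Poly_Mapping.lookup p v * Poly_Mapping.lookup q w))"
    unfolding monoid_algebra_def monoid.simps
    by (intro sum.cong refl sum.mono_neutral_left) (use assms in \<open>auto simp: not_in_keys_iff_lookup_eq_zero\<close>)
  also have "\<dots> = (\<Sum>v\<in>K. \<Sum>w\<in>L.
      Poly_Mapping.single (v \<otimes>\<^bsub>G\<^esub> w) (Poly_Mapping.lookup p v * Poly_Mapping.lookup q w))"
    using assms by (intro sum.mono_neutral_left) (auto simp: not_in_keys_iff_lookup_eq_zero)
  finally show ?thesis .
qed

lemma monoid_algebra_mult_single: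
  "Poly_Mapping.single v a \<otimes>\<^bsub>monoid_algebra G\<^esub> Poly_Mapping.single w b =
    Poly_Mapping.single (v \<otimes>\<^bsub>G\<^esub> w) (a * b)"
  by (subst monoid_algebra_mult[of "{v}" _ "{w}"]) auto

lemma monoid_algebra_add: "p \<oplus>\<^bsub>monoid_algebra G\<^esub> q = p + q"
  by (simp add: monoid_algebra_def)

lemma monoid_algebra_distrib:
  "(p + q) \<otimes>\<^bsub>monoid_algebra G\<^esub> r = p \<otimes>\<^bsub>monoid_algebra G\<^esub> r + q \<otimes>\<^bsub>monoid_algebra G\<^esub> r"
  "r \<otimes>\<^bsub>monoid_algebra G\<^esub> (p + q) = r \<otimes>\<^bsub>monoid_algebra G\<^esub> p + r \<otimes>\<^bsub>monoid_algebra G\<^esub> q"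
proof -
  let ?K = "Poly_Mapping.keys p \<union> Poly_Mapping.keys q" and ?L = "Poly_Mapping.keys r"
  have sub: "Poly_Mapping.keys (p + q) \<subseteq> ?K" by (rule keys_add)
  show "(p + q) \<otimes>\<^bsub>monoid_algebra G\<^esub> r = p \<otimes>\<^bsub>monoid_algebra G\<^esub> r + q \<otimes>\<^bsub>monoid_algebra G\<^esub> r"
    using sub by (simp add: monoid_algebra_mult[where K = ?K and L = ?L] lookup_add distrib_right
        single_add sum.distrib)
  show "r \<otimes>\<^bsub>monoid_algebra G\<^esub> (p + q) = r \<otimes>\<^bsub>monoid_algebra G\<^esub> p + r \<otimes>\<^bsub>monoid_algebra G\<^esub> q"
    using sub by (simp add: monoid_algebra_mult[where K = ?L and L = ?K] lookup_add distrib_left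
        single_add sum.distrib)
qed

lemma monoid_algebra_mult_zero:
  "0 \<otimes>\<^bsub>monoid_algebra G\<^esub> r = 0" "r \<otimes>\<^bsub>monoid_algebra G\<^esub> 0 = 0"
  by (simp_all add: monoid_algebra_def)

lemma monoid_algebra_mult_sum:
  "sum f A \<otimes>\<^bsub>monoid_algebra G\<^esub> r = (\<Sum>x\<in>A. f x \<otimes>\<^bsub>monoid_algebra G\<^esub> r)"
  "r \<otimes>\<^bsub>monoid_algebra G\<^esub> sum f A = (\<Sum>x\<in>A. r \<otimes>\<^bsub>monoid_algebra G\<^esub> f x)"
  by (induction A rule: infinite_finite_induct)
    (auto simp: monoid_algebra_distrib monoid_algebra_mult_zero)

lemma monoid_algebra_carrier: "p \<in> carrier (monoid_algebra G) \<longleftrightarrow> Poly_Mapping.keys p \<subseteq> carrier G"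
  by (simp add: monoid_algebra_def)

lemma monoid_algebra_add_closed:
  "p \<in> carrier (monoid_algebra G) \<Longrightarrow> q \<in> carrier (monoid_algebra G) \<Longrightarrow> p + q \<in> carrier (monoid_algebra G)"
  using keys_add[of p q] by (auto simp: monoid_algebra_carrier)

lemma monoid_algebra_uminus_closed:
  "p \<in> carrier (monoid_algebra G) \<Longrightarrow> - p \<in> carrier (monoid_algebra G)"
  by (simp add: monoid_algebra_carrier)

lemma monoid_algebra_diff_closed:
  "p \<in> carrier (monoid_algebra G) \<Longrightarrow> q \<in> carrier (monoid_algebra G) \<Longrightarrow> p - q \<in> carrier (monoid_algebra G)"
  using keys_diff[of p q] by (auto simp: monoid_algebra_carrier)

lemma monoid_algebra_sum_closed:
  "(\<And>x. x \<in> A \<Longrightarrow> f x \<in> carrier (monoid_algebra G)) \<Longrightarrow> sum f A \<in> carrier (monoid_algebra G)"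
  by (induction A rule: infinite_finite_induct)
    (auto simp: monoid_algebra_add_closed, auto simp: monoid_algebra_carrier)

lemma monoid_algebra_single_closed:
  "v \<in> carrier G \<Longrightarrow> Poly_Mapping.single v a \<in> carrier (monoid_algebra G)"
  by (simp add: monoid_algebra_carrier)

context monoid
begin

lemma monoid_algebra_mult_closed:
  assumes "p \<in> carrier (monoid_algebra G)" "q \<in> carrier (monoid_algebra G)"
  shows "p \<otimes>\<^bsub>monoid_algebra G\<^esub> q \<in> carrier (monoid_algebra G)"
proof -
  have "v \<in> carrier G" if "v \<in> Poly_Mapping.keys p \<union> Poly_Mapping.keys q" for v
    using that assms by (auto simp: monoid_algebra_carrier)
  then show ?thesis
    by (subst monoid_algebra_mult[OF finite_keys order_refl finite_keys order_refl])
      (intro monoid_algebra_sum_closed monoid_algebra_single_closed m_closed, auto)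
qed

lemma monoid_algebra_assoc:
  assumes "p \<in> carrier (monoid_algebra G)" "q \<in> carrier (monoid_algebra G)" "r \<in> carrier (monoid_algebra G)"
  shows "p \<otimes>\<^bsub>monoid_algebra G\<^esub> q \<otimes>\<^bsub>monoid_algebra G\<^esub> r =
    p \<otimes>\<^bsub>monoid_algebra G\<^esub> (q \<otimes>\<^bsub>monoid_algebra G\<^esub> r)"
proof -
  note e = poly_mapping_expand[OF finite_keys order_refl]
  show ?thesis
    using assms
    by (subst (1 2) e[of p], subst (1 2) e[of q], subst (1 2) e[of r])
      (auto simp: monoid_algebra_mult_sum monoid_algebra_mult_single monoid_algebra_carrier
        subset_iff m_assoc mult.assoc intro!: sum.cong)
qed

lemma monoid_algebra_one:
  assumes "p \<in> carrier (monoid_algebra G)"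
  shows "\<one>\<^bsub>monoid_algebra G\<^esub> \<otimes>\<^bsub>monoid_algebra G\<^esub> p = p"
    "p \<otimes>\<^bsub>monoid_algebra G\<^esub> \<one>\<^bsub>monoid_algebra G\<^esub> = p"
proof -
  note e = poly_mapping_expand[OF finite_keys order_refl]
  have one: "\<one>\<^bsub>monoid_algebra G\<^esub> = Poly_Mapping.single \<one> 1" by (simp add: monoid_algebra_def)
  have "\<one>\<^bsub>monoid_algebra G\<^esub> \<otimes>\<^bsub>monoid_algebra G\<^esub> p =
      (\<Sum>v\<in>Poly_Mapping.keys p. Poly_Mapping.single v (Poly_Mapping.lookup p v))"
    unfolding one using assms
    by (subst e[of p]) (auto simp: monoid_algebra_mult_sum monoid_algebra_mult_single monoid_algebra_carrier
        subset_iff intro!: sum.cong)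
  then show "\<one>\<^bsub>monoid_algebra G\<^esub> \<otimes>\<^bsub>monoid_algebra G\<^esub> p = p" using e[of p] by simp
  have "p \<otimes>\<^bsub>monoid_algebra G\<^esub> \<one>\<^bsub>monoid_algebra G\<^esub> =
      (\<Sum>v\<in>Poly_Mapping.keys p. Poly_Mapping.single v (Poly_Mapping.lookup p v))"
    unfolding one using assms
    by (subst e[of p]) (auto simp: monoid_algebra_mult_sum monoid_algebra_mult_single monoid_algebra_carrier
        subset_iff intro!: sum.cong)
  then show "p \<otimes>\<^bsub>monoid_algebra G\<^esub> \<one>\<^bsub>monoid_algebra G\<^esub> = p" using e[of p] by simp
qed

lemma ring_monoid_algebra: "ring (monoid_algebra G)"
proof (rule ringI)
  show "abelian_group (monoid_algebra G)"
  proof (rule abelian_groupI)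
    fix p assume p: "p \<in> carrier (monoid_algebra G)"
    show "\<exists>q\<in>carrier (monoid_algebra G). q \<oplus>\<^bsub>monoid_algebra G\<^esub> p = \<zero>\<^bsub>monoid_algebra G\<^esub>"
      using monoid_algebra_uminus_closed[OF p]
      by (intro bexI[of _ "- p"]) (auto simp: monoid_algebra_def)
  qed (auto simp: monoid_algebra_add monoid_algebra_add_closed add.assoc add.commute,
      auto simp: monoid_algebra_def)
  show "Group.monoid (monoid_algebra G)"
    by (rule monoidI) (auto simp: monoid_algebra_mult_closed monoid_algebra_assoc monoid_algebra_one,
        simp add: monoid_algebra_def)
qed (auto simp: monoid_algebra_add monoid_algebra_distrib)

end

lemma monoid_algebra_a_minus:
  assumes "Group.monoid G" "p \<in> carrier (monoid_algebra G)" "q \<in> carrier (monoid_algebra G)"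
  shows "p \<ominus>\<^bsub>monoid_algebra G\<^esub> q = p - q"
proof -
  interpret ring "monoid_algebra G" by (rule monoid.ring_monoid_algebra[OF assms(1)])
  have "\<ominus>\<^bsub>monoid_algebra G\<^esub> q = - q"
    by (rule minus_equality) (use assms monoid_algebra_uminus_closed in \<open>auto simp: monoid_algebra_add monoid_algebra_def\<close>)
  then show ?thesis by (simp add: a_minus_def monoid_algebra_add)
qed

lemma monoid_free_monoid: "Group.monoid (free_monoid A)"
  by (rule monoidI) (auto simp: free_monoid_def)

lemma free_monoid_simps [simp]:
  "carrier (free_monoid A) = lists A" "x \<otimes>\<^bsub>free_monoid A\<^esub> y = x @ y" "\<one>\<^bsub>free_monoid A\<^esub> = []"
  by (simp_all add: free_monoid_def)

lemma ring_free_algebra: "ring (free_algebra n)"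
  by (rule monoid.ring_monoid_algebra[OF monoid_free_monoid])

lemma smult_monoid_algebra:
  "c \<odot>\<^bsub>monoid_algebra G\<^esub> p = Poly_Mapping.map ((*) c) p"
  by (simp add: monoid_algebra_def)

lemma lookup_scale: "Poly_Mapping.lookup (Poly_Mapping.map ((*) c) p) k = (c::complex) * Poly_Mapping.lookup p k"
  by (simp add: Poly_Mapping.map.rep_eq when_def)

lemma keys_scale: "Poly_Mapping.keys (Poly_Mapping.map ((*) c) p) \<subseteq> Poly_Mapping.keys (p :: _ \<Rightarrow>\<^sub>0 complex)"
proof
  fix k assume "k \<in> Poly_Mapping.keys (Poly_Mapping.map ((*) c) p)"
  then have "c * Poly_Mapping.lookup p k \<noteq> 0"
    unfolding lookup_not_eq_zero_eq_in_keys[symmetric] lookup_scale .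
  then show "k \<in> Poly_Mapping.keys p" unfolding lookup_not_eq_zero_eq_in_keys[symmetric] by simp
qed

lemma scale_single: "Poly_Mapping.map ((*) c) (Poly_Mapping.single k d) = Poly_Mapping.single k (c * d :: complex)"
  by (rule poly_mapping_eqI) (simp add: lookup_scale lookup_single when_def)

section \<open>The action of the free algebra on functionals\<close>

definition poly_action :: "(nat list \<Rightarrow>\<^sub>0 complex) \<Rightarrow> ((nat \<Rightarrow> nat) \<Rightarrow> complex) \<Rightarrow> (nat \<Rightarrow> nat) \<Rightarrow> complex"
  where "poly_action p h u = (\<Sum>x\<in>Poly_Mapping.keys p. Poly_Mapping.lookup p x * word_action x h u)"

lemma poly_action_superset:
  assumes "finite K" "Poly_Mapping.keys p \<subseteq> K"
  shows "poly_action p h u = (\<Sum>x\<in>K. Poly_Mapping.lookup p x * word_action x h u)"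
  unfolding poly_action_def using assms
  by (intro sum.mono_neutral_left) (auto simp: not_in_keys_iff_lookup_eq_zero)

lemma poly_action_single [simp]: "poly_action (Poly_Mapping.single x c) h u = c * word_action x h u"
  by (subst poly_action_superset[of "{x}"]) auto

lemma poly_action_0 [simp]: "poly_action 0 h u = 0"
  by (simp add: poly_action_def)

lemma poly_action_add: "poly_action (p + q) h u = poly_action p h u + poly_action q h u"
proof -
  let ?K = "Poly_Mapping.keys p \<union> Poly_Mapping.keys q"
  show ?thesis
    using keys_add[of p q]
    by (simp add: poly_action_superset[where K = ?K] lookup_add distrib_right sum.distrib)
qed

lemma poly_action_uminus: "poly_action (- p) h u = - poly_action p h u"
  by (simp add: poly_action_def sum_negf)

lemma poly_action_diff: "poly_action (p - q) h u = poly_action p h u - poly_action q h u"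
  using poly_action_add[of p "- q" h u] poly_action_uminus[of q h u] by simp

lemma poly_action_sum: "poly_action (sum f A) h u = (\<Sum>y\<in>A. poly_action (f y) h u)"
  by (induction A rule: infinite_finite_induct) (auto simp: poly_action_add)

lemma poly_action_scale: "poly_action (Poly_Mapping.map ((*) c) p) h u = c * poly_action p h u"
proof -
  have "poly_action (Poly_Mapping.map ((*) c) p) h u =
      (\<Sum>x\<in>Poly_Mapping.keys p. Poly_Mapping.lookup (Poly_Mapping.map ((*) c) p) x * word_action x h u)"
    by (rule poly_action_superset) (simp_all add: keys_scale)
  then show ?thesis by (simp add: lookup_scale poly_action_def sum_distrib_left mult.assoc)
qed

text \<open>Concatenation acts by composition with the first word outermost, which makes the
  functions a left module over the free algebra.\<close>

lemma poly_action_mult: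
  "poly_action (p \<otimes>\<^bsub>free_algebra n\<^esub> q) h u = poly_action p (poly_action q h) u"
proof -
  have "poly_action (p \<otimes>\<^bsub>free_algebra n\<^esub> q) h u =
      (\<Sum>x\<in>Poly_Mapping.keys p. \<Sum>y\<in>Poly_Mapping.keys q.
        Poly_Mapping.lookup p x * Poly_Mapping.lookup q y * word_action (x @ y) h u)"
    by (subst monoid_algebra_mult[OF finite_keys order_refl finite_keys order_refl])
      (simp add: poly_action_sum)
  also have "\<dots> = (\<Sum>x\<in>Poly_Mapping.keys p. Poly_Mapping.lookup p x * word_action x (poly_action q h) u)"
    unfolding poly_action_def[of q, abs_def] word_action_sum word_action_scale word_action_append sum_distrib_left
    by (simp add: mult.assoc)
  finally show ?thesis by (simp add: poly_action_def)
qed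

lemma tl_functional_scale_add:
  assumes "tl_functional n h" "tl_functional n g"
  shows "tl_functional n (\<lambda>u. c * h u + g u)"
proof -
  have "tl_functional n (\<lambda>u. (0 - c) * h u)"
    using assms(1) unfolding tl_functional_def tl_relation_def by (metis (no_types, lifting) distrib_left)
  from tl_functional_diff[OF assms(2) this] show ?thesis by (simp add: add.commute)
qed

lemma tl_functional_0: "tl_functional n (\<lambda>_. 0)"
  by (simp add: tl_functional_def tl_relation_def)

lemma tl_functional_poly_action:
  assumes "tl_functional n h" "p \<in> carrier (free_algebra n)"
  shows "tl_functional n (poly_action p h)"
proof -
  have "tl_functional n (\<lambda>u. \<Sum>x\<in>K. Poly_Mapping.lookup p x * word_action x h u)"
    if "K \<subseteq> lists {1..<n}" for K
    using that
    by (induction K rule: infinite_finite_induct)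
      (auto intro!: tl_functional_0 tl_functional_scale_add tl_functional_word_action assms(1))
  from this[of "Poly_Mapping.keys p"] show ?thesis
    using assms(2) unfolding poly_action_def[abs_def] by (simp add: monoid_algebra_carrier)
qed

lemma poly_action_zero:
  assumes "\<And>u. u permutes {1..n} \<Longrightarrow> h u = 0" "p \<in> carrier (free_algebra n)" "u permutes {1..n}"
  shows "poly_action p h u = 0"
proof -
  have "word_action x h u = 0" if "x \<in> Poly_Mapping.keys p" for x
    by (rule word_action_zero[OF assms(1) _ assms(3)]) (use that assms(2) in \<open>auto simp: monoid_algebra_carrier\<close>)
  then show ?thesis by (simp add: poly_action_def)
qed

text \<open>A concrete candidate for the relation ideal; the two are identified in
  \<open>tl_ideal_eq_annihilator\<close>.\<close>

definition annihilator :: "nat \<Rightarrow> (nat list \<Rightarrow>\<^sub>0 complex) set"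
  where "annihilator n = {p \<in> carrier (free_algebra n).
    \<forall>h u. tl_functional n h \<longrightarrow> u permutes {1..n} \<longrightarrow> poly_action p h u = 0}"

text \<open>A left factor is applied to a function that already vanishes on all permutations. A
  right factor acts first, and it turns a functional into another functional; hence the ideal is
  two-sided.\<close>

lemma ideal_annihilator: "ideal (annihilator n) (free_algebra n)"
proof (rule idealI[OF ring_free_algebra])
  interpret ring "free_algebra n" by (rule ring_free_algebra)
  show "subgroup (annihilator n) (add_monoid (free_algebra n))"
  proof (rule group.subgroupI[OF a_group])
    show "annihilator n \<noteq> {}" by (auto simp: annihilator_def monoid_algebra_carrier intro!: exI[of _ 0])
    fix p assume p: "p \<in> annihilator n"
    have "\<ominus>\<^bsub>free_algebra n\<^esub> p = - p"
      using p by (intro minus_equality)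
        (auto simp: annihilator_def monoid_algebra_uminus_closed monoid_algebra_add monoid_algebra_def)
    then have "inv\<^bsub>add_monoid (free_algebra n)\<^esub> p = - p" by (simp add: a_inv_def)
    then show "inv\<^bsub>add_monoid (free_algebra n)\<^esub> p \<in> annihilator n"
      using p by (simp add: annihilator_def monoid_algebra_uminus_closed poly_action_uminus)
  qed (auto simp: annihilator_def monoid_algebra_add monoid_algebra_add_closed poly_action_add)
  fix p q assume p: "p \<in> annihilator n" and q: "q \<in> carrier (free_algebra n)"
  then have pc: "p \<in> carrier (free_algebra n)"
    and p0: "tl_functional n h \<Longrightarrow> u permutes {1..n} \<Longrightarrow> poly_action p h u = 0" for h u
    by (auto simp: annihilator_def)
  show "q \<otimes>\<^bsub>free_algebra n\<^esub> p \<in> annihilator n"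
    using pc q poly_action_zero[OF p0] by (auto simp: annihilator_def poly_action_mult)
  show "p \<otimes>\<^bsub>free_algebra n\<^esub> q \<in> annihilator n"
    using pc q p0 by (auto simp: annihilator_def poly_action_mult tl_functional_poly_action)
qed

lemma tl_relators_subset: "tl_relators n \<subseteq> annihilator n"
proof
  have mem: "Poly_Mapping.single x c - Poly_Mapping.single y d \<in> carrier (free_algebra n)"
    if "set x \<subseteq> {1..<n}" "set y \<subseteq> {1..<n}" for x y and c d :: complex
    using that by (intro monoid_algebra_diff_closed monoid_algebra_single_closed) auto
  fix p assume "p \<in> tl_relators n"
  then consider
    (square) i where "p = Poly_Mapping.single [i, i] 1 - Poly_Mapping.single [i] 2" "i \<in> {1..<n}"
  | (commute) i j where "p = Poly_Mapping.single [i, j] 1 - Poly_Mapping.single [j, i] 1"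
      "i \<in> {1..<n}" "j \<in> {1..<n}" "\<bar>int i - int j\<bar> \<ge> 2"
  | (braid) i j where "p = Poly_Mapping.single [i, j, i] 1 - Poly_Mapping.single [i] 1"
      "i \<in> {1..<n}" "j \<in> {1..<n}" "\<bar>int i - int j\<bar> = 1"
    unfolding tl_relators_def by auto
  then show "p \<in> annihilator n"
  proof cases
    case square
    then show ?thesis unfolding annihilator_def
      by (auto simp: poly_action_diff word_action_square simp del: word_action.simps intro!: mem)
  next
    case commute
    then show ?thesis unfolding annihilator_def
      by (auto simp: poly_action_diff word_action_commute simp del: word_action.simps intro!: mem)
  next
    case braid
    then show ?thesis unfolding annihilator_def
      by (auto simp: poly_action_diff word_action_braid simp del: word_action.simps intro!: mem)
  qed
qed

lemma tl_ideal_subset_annihilator: "tl_ideal n \<subseteq> annihilator n"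
  unfolding tl_ideal_def
  by (rule ring.genideal_minimal[OF ring_free_algebra ideal_annihilator tl_relators_subset])

lemma ideal_tl_ideal: "ideal (tl_ideal n) (free_algebra n)"
  unfolding tl_ideal_def
  by (rule ring.genideal_ideal[OF ring_free_algebra])
    (use tl_relators_subset in \<open>auto simp: annihilator_def\<close>)

lemma tl_ideal_closed:
  "p \<in> tl_ideal n \<Longrightarrow> q \<in> tl_ideal n \<Longrightarrow> p + q \<in> tl_ideal n"
  "p \<in> tl_ideal n \<Longrightarrow> q \<in> carrier (free_algebra n) \<Longrightarrow> p \<otimes>\<^bsub>free_algebra n\<^esub> q \<in> tl_ideal n"
  "p \<in> tl_ideal n \<Longrightarrow> q \<in> carrier (free_algebra n) \<Longrightarrow> q \<otimes>\<^bsub>free_algebra n\<^esub> p \<in> tl_ideal n"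
  "0 \<in> tl_ideal n"
proof -
  interpret ideal "tl_ideal n" "free_algebra n" by (rule ideal_tl_ideal)
  show "p \<in> tl_ideal n \<Longrightarrow> q \<in> tl_ideal n \<Longrightarrow> p + q \<in> tl_ideal n"
    using additive_subgroup.a_closed[OF ideal.axioms(1)[OF ideal_tl_ideal]] by (simp add: monoid_algebra_add)
  show "0 \<in> tl_ideal n" 
    using additive_subgroup.zero_closed[OF ideal.axioms(1)[OF ideal_tl_ideal]] by (simp add: monoid_algebra_def)
qed (auto intro: ideal.I_r_closed[OF ideal_tl_ideal] ideal.I_l_closed[OF ideal_tl_ideal])

lemma tl_ideal_scale:
  assumes "Poly_Mapping.single x c - Poly_Mapping.single y d \<in> tl_ideal n"
  shows "Poly_Mapping.single x (e * c) - Poly_Mapping.single y (e * d) \<in> tl_ideal n"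
proof -
  have "Poly_Mapping.single [] e \<otimes>\<^bsub>free_algebra n\<^esub>
      (Poly_Mapping.single x c + Poly_Mapping.single y (- d)) \<in> tl_ideal n"
    using assms by (intro tl_ideal_closed(3)) (auto simp: monoid_algebra_carrier single_uminus)
  then show ?thesis
    unfolding monoid_algebra_distrib monoid_algebra_mult_single by (simp add: single_uminus)
qed

lemma tl_reduces_tl_ideal:
  "tl_reduces n x c y \<Longrightarrow> Poly_Mapping.single x 1 - Poly_Mapping.single y c \<in> tl_ideal n"
proof (induction rule: tl_reduces.induct)
  case (refl x)
  then show ?case by (simp add: tl_ideal_closed)
next
  case (trans x c y d z)
  have "Poly_Mapping.single y c - Poly_Mapping.single z (c * d) \<in> tl_ideal n"
    using tl_ideal_scale[OF trans.IH(2), of c] by simp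
  from tl_ideal_closed(1)[OF trans.IH(1) this] show ?case by simp
next
  case (in_context a b x c y)
  have "Poly_Mapping.single a 1 \<otimes>\<^bsub>free_algebra n\<^esub>
      ((Poly_Mapping.single x 1 + Poly_Mapping.single y (- c)) \<otimes>\<^bsub>free_algebra n\<^esub> Poly_Mapping.single b 1)
      \<in> tl_ideal n"
    using in_context
    by (intro tl_ideal_closed(3)[OF tl_ideal_closed(2)] monoid_algebra_single_closed) (auto simp: single_uminus)
  then show ?case
    unfolding monoid_algebra_distrib monoid_algebra_mult_single by (simp add: single_uminus)
next
  case (square i)
  then have "Poly_Mapping.single [i, i] 1 - Poly_Mapping.single [i] 2 \<in> tl_relators n"
    by (auto simp: tl_relators_def)
  then show ?case unfolding tl_ideal_def
    using ring.genideal_self[OF ring_free_algebra] tl_relators_subset by (auto simp: annihilator_def)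
next
  case (commute i j)
  then have "Poly_Mapping.single [i, j] 1 - Poly_Mapping.single [j, i] 1 \<in> tl_relators n"
    unfolding tl_relators_def by blast
  then show ?case unfolding tl_ideal_def
    using ring.genideal_self[OF ring_free_algebra] tl_relators_subset by (auto simp: annihilator_def)
next
  case (braid i j)
  then have "Poly_Mapping.single [i, j, i] 1 - Poly_Mapping.single [i] 1 \<in> tl_relators n"
    unfolding tl_relators_def by blast
  then show ?case unfolding tl_ideal_def
    using ring.genideal_self[OF ring_free_algebra] tl_relators_subset by (auto simp: annihilator_def)
qed

section \<open>Separating functionals\<close>

text \<open>For \<open>w\<close> avoiding 321, \<open>w\<close> is increasing on the set of positions with a smaller value to the
  right and on its complement, so \<open>w\<close> is the least permutation mapping this set to its image.\<close>

definition excess_positions :: "(nat \<Rightarrow> nat) \<Rightarrow> nat set"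
  where "excess_positions w = {i. \<exists>j>i. w j < w i}"

definition separating :: "(nat \<Rightarrow> nat) \<Rightarrow> (nat \<Rightarrow> nat) \<Rightarrow> complex"
  where "separating w u = (if u ` excess_positions w = w ` excess_positions w then 1 else 0)"

lemma tl_functional_separating: "tl_functional n (separating w)"
proof (rule tl_functional_two_classes[where cls = "\<lambda>i. i \<in> excess_positions w" and a = True and b = False])
  fix u i j assume "(i \<in> excess_positions w) = (j \<in> excess_positions w)"
  then show "separating w (u \<circ> Transposition.transpose i j) = separating w u"
    by (simp add: separating_def image_comp[symmetric] transpose_image_eq del: comp_apply)
qed auto

text \<open>If some position of X up to a has a w-value above b, then by monotonicity all positions
  of X with w-value at most b come before it. The right-hand side then counts all values up to b in
  the common image, which bounds the left-hand side.\<close>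

lemma card_le_of_increasing:
  fixes u w :: "nat \<Rightarrow> nat"
  assumes inj: "inj u" "inj w" and im: "u ` X = w ` X"
    and inc: "\<And>i j. i \<in> X \<Longrightarrow> j \<in> X \<Longrightarrow> i < j \<Longrightarrow> w i < w j"
  shows "card {k \<in> X. k \<le> a \<and> u k \<le> b} \<le> card {k \<in> X. k \<le> a \<and> w k \<le> b}"
proof (cases "\<forall>k\<in>X. k \<le> a \<longrightarrow> w k \<le> b")
  case True
  then show ?thesis by (intro card_mono) auto
next
  case False
  then obtain k0 where k0: "k0 \<in> X" "k0 \<le> a" "b < w k0" by auto
  have "{k \<in> X. w k \<le> b} = {k \<in> X. k \<le> a \<and> w k \<le> b}"
    using k0 inc by (metis (no_types, opaque_lifting) le_trans linorder_not_le nat_le_linear order_le_less)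
  moreover have "card {k \<in> X. w k \<le> b} = card {k \<in> X. u k \<le> b}"
  proof -
    have "card {k \<in> X. w k \<le> b} = card (w ` {k \<in> X. w k \<le> b})"
      using inj(2) by (simp add: card_image inj_on_subset)
    also have "w ` {k \<in> X. w k \<le> b} = u ` {k \<in> X. u k \<le> b}"
      using im by (auto simp: image_iff set_eq_iff) metis+
    also have "card \<dots> = card {k \<in> X. u k \<le> b}"
      using inj(1) by (simp add: card_image inj_on_subset)
    finally show ?thesis .
  qed
  moreover have "finite {k \<in> X. u k \<le> b}"
    using finite_vimageI[OF finite_atMost[of b] inj(1)] by (rule finite_subset[rotated]) auto
  then have "card {k \<in> X. k \<le> a \<and> u k \<le> b} \<le> card {k \<in> X. u k \<le> b}"
    by (intro card_mono) auto
  ultimately show ?thesis by simp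
qed

lemma separating_bruhat_le:
  assumes w: "w permutes {1..n}" "\<not> has_321 w" and u: "u permutes {1..n}"
    and nz: "separating w u \<noteq> 0"
  shows "bruhat_le w u"
proof -
  let ?X = "excess_positions w"
  have inj: "inj u" "inj w" and bij: "bij u" "bij w"
    using w(1) u permutes_inj permutes_bij by blast+
  have im: "u ` ?X = w ` ?X" using nz by (simp add: separating_def split: if_splits)
  then have im': "u ` (- ?X) = w ` (- ?X)" using bij by (simp add: bij_image_Compl_eq)
  have inc: "w i < w j" if ij: "i \<in> ?X" "j \<in> ?X" "i < j" for i j
  proof (rule ccontr)
    assume "\<not> w i < w j"
    then have "w j < w i" using inj(2) ij(3) by (metis injD less_irrefl linorder_neqE_nat)
    moreover obtain k where "j < k" "w k < w j" using ij(2) by (auto simp: excess_positions_def)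
    ultimately show False using w(2) ij(3) unfolding has_321_def by blast
  qed
  have inc': "w i < w j" if "i \<in> - ?X" "j \<in> - ?X" "i < j" for i j
  proof -
    have "\<not> w j < w i" using that by (auto simp: excess_positions_def)
    then show ?thesis using inj(2) that(3) by (metis injD less_irrefl linorder_neqE_nat)
  qed
  have split: "rank_count v a b = card {k \<in> ?X. k \<le> a \<and> v k \<le> b} + card {k \<in> - ?X. k \<le> a \<and> v k \<le> b}"
    for v a b
  proof -
    have "{k. k \<le> a \<and> v k \<le> b} = {k \<in> ?X. k \<le> a \<and> v k \<le> b} \<union> {k \<in> - ?X. k \<le> a \<and> v k \<le> b}" by auto
    then have "rank_count v a b = card ({k \<in> ?X. k \<le> a \<and> v k \<le> b} \<union> {k \<in> - ?X. k \<le> a \<and> v k \<le> b})"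
      by (simp only: rank_count_def)
    also have "\<dots> = card {k \<in> ?X. k \<le> a \<and> v k \<le> b} + card {k \<in> - ?X. k \<le> a \<and> v k \<le> b}"
      by (rule card_Un_disjoint) auto
    finally show ?thesis .
  qed
  show ?thesis
    unfolding bruhat_le_def split
    by (intro allI add_mono card_le_of_increasing[OF inj im inc] card_le_of_increasing[OF inj im' inc'])
qed

lemma basis_word_action_separating:
  assumes "w \<in> avoiders_321 n" "v permutes {1..n}"
    "word_action (basis_word n v) (separating w) id \<noteq> 0"
  shows "bruhat_le w v"
proof (rule ccontr)
  assume not_le: "\<not> bruhat_le w v"
  have "word_action (basis_word n v) (separating w) id = 0"
  proof (rule word_action_vanishes[OF reduced_basis_word[OF assms(2)]])
    fix u assume u: "u permutes {1..n}" "bruhat_le u v"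
    show "separating w u = 0"
      using separating_bruhat_le[of w n u] u assms(1) not_le bruhat_le_trans
      unfolding avoiders_321_iff by blast
  qed
  then show False using assms(3) by simp
qed

lemma basis_word_action_separating_self:
  assumes "w \<in> avoiders_321 n"
  shows "word_action (basis_word n w) (separating w) id = (-1) ^ length (basis_word n w)"
proof -
  have w: "w permutes {1..n}" "\<not> has_321 w" using assms by (auto simp: avoiders_321_iff)
  have "word_action (basis_word n w) (separating w) id = (-1) ^ length (basis_word n w) * separating w w"
  proof (rule word_action_leading[OF reduced_basis_word[OF w(1)]])
    fix u assume u: "u permutes {1..n}" "bruhat_le u w" "u \<noteq> w"
    show "separating w u = 0"
      using separating_bruhat_le[OF w u(1)] u(2,3) bruhat_le_antisym by blast
  qed
  then show ?thesis by (simp add: separating_def)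
qed

lemma finite_avoiders_321: "finite (avoiders_321 n)"
  by (rule finite_subset[OF _ finite_permutations[of "{1..n}"]]) (auto simp: avoiders_321_iff)

text \<open>The pairing of separating functionals with basis words is triangular for Bruhat order,
  with signs on the diagonal. If v minimises \<open>rank_sum\<close> on the support of c, it is
  Bruhat-maximal there, so \<open>separating v\<close> sees only the coefficient at v.\<close>

lemma basis_coefficients_zero:
  assumes zero: "\<And>h. tl_functional n h \<Longrightarrow>
      (\<Sum>w\<in>avoiders_321 n. c w * word_action (basis_word n w) h id) = 0"
    and w: "w \<in> avoiders_321 n"
  shows "c w = 0"
proof (rule ccontr)
  assume "c w \<noteq> 0"
  then obtain v where v: "v \<in> avoiders_321 n" "c v \<noteq> 0"
      and min: "\<And>u. u \<in> avoiders_321 n \<Longrightarrow> c u \<noteq> 0 \<Longrightarrow> rank_sum n v \<le> rank_sum n u"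
    using ex_has_least_nat[of "\<lambda>u. u \<in> avoiders_321 n \<and> c u \<noteq> 0" w "rank_sum n"] w by blast
  have "(\<Sum>u\<in>avoiders_321 n. c u * word_action (basis_word n u) (separating v) id) =
      (\<Sum>u\<in>avoiders_321 n. if u = v then c v * (-1) ^ length (basis_word n v) else 0)"
  proof (rule sum.cong)
    fix u assume u: "u \<in> avoiders_321 n"
    have "c u * word_action (basis_word n u) (separating v) id = 0" if "u \<noteq> v"
    proof (rule ccontr)
      assume nz: "c u * word_action (basis_word n u) (separating v) id \<noteq> 0"
      then have "bruhat_le v u"
        using basis_word_action_separating[OF v(1), of u] u by (auto simp: avoiders_321_iff)
      then have "rank_sum n u < rank_sum n v"
        using rank_sum_less[of v n u] u v(1) that by (auto simp: avoiders_321_iff)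
      then show False using min[OF u] nz by auto
    qed
    then show "c u * word_action (basis_word n u) (separating v) id =
        (if u = v then c v * (-1) ^ length (basis_word n v) else 0)"
      using basis_word_action_separating_self[OF v(1)] by auto
  qed simp
  also have "\<dots> = c v * (-1) ^ length (basis_word n v)"
    using v(1) by (simp add: finite_avoiders_321)
  finally show False using zero[OF tl_functional_separating[of n v]] v(2) by simp
qed

section \<open>Spanning by the basis words, and the relation ideal as an annihilator\<close>

lemma basis_expansion:
  assumes "p \<in> carrier (free_algebra n)"
  shows "\<exists>c. p - (\<Sum>w\<in>avoiders_321 n. Poly_Mapping.single (basis_word n w) (c w)) \<in> tl_ideal n"
proof -
  have "\<exists>c. (\<Sum>x\<in>K. Poly_Mapping.single x (a x)) -
      (\<Sum>w\<in>avoiders_321 n. Poly_Mapping.single (basis_word n w) (c w)) \<in> tl_ideal n"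
    if "finite K" "K \<subseteq> lists {1..<n}" for K and a :: "nat list \<Rightarrow> complex"
    using that
  proof (induction K rule: finite_induct)
    case empty
    then show ?case by (intro exI[of _ "\<lambda>_. 0"]) (simp add: tl_ideal_closed)
  next
    case (insert x K)
    then obtain c where c: "(\<Sum>x\<in>K. Poly_Mapping.single x (a x)) -
      (\<Sum>w\<in>avoiders_321 n. Poly_Mapping.single (basis_word n w) (c w)) \<in> tl_ideal n" by auto
    obtain d v where v: "v \<in> avoiders_321 n" "tl_reduces n x d (basis_word n v)"
      using word_reduces_to_basis_word[of x n] insert.prems by auto
    have x: "Poly_Mapping.single x (a x) - Poly_Mapping.single (basis_word n v) (a x * d) \<in> tl_ideal n"
      using tl_ideal_scale[OF tl_reduces_tl_ideal[OF v(2)], of "a x"] by simp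
    let ?c = "\<lambda>w. c w + (if w = v then a x * d else 0)"
    have "(\<Sum>w\<in>avoiders_321 n. Poly_Mapping.single (basis_word n w) (if w = v then a x * d else 0)) =
        (\<Sum>w\<in>avoiders_321 n. if w = v then Poly_Mapping.single (basis_word n v) (a x * d) else 0)"
      by (intro sum.cong) auto
    also have "\<dots> = Poly_Mapping.single (basis_word n v) (a x * d)"
      using v(1) by (simp add: finite_avoiders_321)
    finally have "(\<Sum>x\<in>insert x K. Poly_Mapping.single x (a x)) -
        (\<Sum>w\<in>avoiders_321 n. Poly_Mapping.single (basis_word n w) (?c w)) =
        (Poly_Mapping.single x (a x) - Poly_Mapping.single (basis_word n v) (a x * d)) +
        ((\<Sum>x\<in>K. Poly_Mapping.single x (a x)) -
          (\<Sum>w\<in>avoiders_321 n. Poly_Mapping.single (basis_word n w) (c w)))"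
      using insert.hyps by (simp add: single_add sum.distrib algebra_simps)
    then show ?case using tl_ideal_closed(1)[OF x c] by (intro exI[of _ ?c]) (simp only:)
  qed
  from this[of "Poly_Mapping.keys p" "Poly_Mapping.lookup p"] show ?thesis
    using assms poly_mapping_expand[OF finite_keys order_refl, of p] by (simp add: monoid_algebra_carrier)
qed

text \<open>Modulo the ideal, an element is a combination of basis words. If it kills all
  functionals, the triangular pairing makes the coefficients zero.\<close>

lemma tl_ideal_eq_annihilator: "tl_ideal n = annihilator n"
proof
  show "annihilator n \<subseteq> tl_ideal n"
  proof
    fix p assume p: "p \<in> annihilator n"
    then have pc: "p \<in> carrier (free_algebra n)" by (simp add: annihilator_def)
    obtain c where c: "p - (\<Sum>w\<in>avoiders_321 n. Poly_Mapping.single (basis_word n w) (c w)) \<in> tl_ideal n"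
      (is "p - ?q \<in> _") using basis_expansion[OF pc] by blast
    have "c w = 0" if "w \<in> avoiders_321 n" for w
    proof (rule basis_coefficients_zero[OF _ that])
      fix h assume h: "tl_functional n h"
      have id: "id permutes {1..n}" by (rule permutes_id)
      have "poly_action p h id = 0" using p h id unfolding annihilator_def by blast
      moreover have "poly_action (p - ?q) h id = 0"
        using c tl_ideal_subset_annihilator h id unfolding annihilator_def by blast
      ultimately show "(\<Sum>w\<in>avoiders_321 n. c w * word_action (basis_word n w) h id) = 0"
        by (simp add: poly_action_diff poly_action_sum del: id_apply)
    qed
    then show "p \<in> tl_ideal n" using c by simp
  qed
qed (rule tl_ideal_subset_annihilator)

section \<open>The Temperley-Lieb algebra as a quotient\<close>

definition tl_class :: "nat \<Rightarrow> (nat list \<Rightarrow>\<^sub>0 complex) \<Rightarrow> (nat list \<Rightarrow>\<^sub>0 complex) set"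
  where "tl_class n p = tl_ideal n +>\<^bsub>free_algebra n\<^esub> p"

text \<open>Turns equality of cosets into a pointwise computation. Well-defined scalar multiples,
  multiplicativity of theta and the existence of coordinates are all checked through it.\<close>

lemma tl_class_eq_iff:
  assumes "p \<in> carrier (free_algebra n)" "q \<in> carrier (free_algebra n)"
  shows "tl_class n p = tl_class n q \<longleftrightarrow>
    (\<forall>h u. tl_functional n h \<longrightarrow> u permutes {1..n} \<longrightarrow> poly_action p h u = poly_action q h u)"
proof -
  have "tl_class n p = tl_class n q \<longleftrightarrow> p - q \<in> tl_ideal n"
    using ring.quotient_eq_iff_same_a_r_cos[OF ring_free_algebra ideal_tl_ideal assms]
    by (simp add: tl_class_def monoid_algebra_a_minus[OF monoid_free_monoid assms])
  then show ?thesis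
    unfolding tl_ideal_eq_annihilator annihilator_def
    using monoid_algebra_diff_closed[OF assms] by (simp add: poly_action_diff)
qed

lemma TL_simps:
  "carrier (TL n) = a_rcosets\<^bsub>free_algebra n\<^esub> (tl_ideal n)"
  "X \<otimes>\<^bsub>TL n\<^esub> Y = rcoset_mult (free_algebra n) (tl_ideal n) X Y"
  "\<one>\<^bsub>TL n\<^esub> = tl_class n \<one>\<^bsub>free_algebra n\<^esub>"
  "\<zero>\<^bsub>TL n\<^esub> = tl_ideal n"
  "X \<oplus>\<^bsub>TL n\<^esub> Y = set_add (free_algebra n) X Y"
  "c \<odot>\<^bsub>TL n\<^esub> X = (\<Union>x\<in>X. tl_class n (c \<odot>\<^bsub>free_algebra n\<^esub> x))"
  by (simp_all add: TL_def quotient_algebra_def ring.extend_def FactRing_def tl_class_def)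

lemma TL_mult:
  assumes "p \<in> carrier (free_algebra n)" "q \<in> carrier (free_algebra n)"
  shows "tl_class n p \<otimes>\<^bsub>TL n\<^esub> tl_class n q = tl_class n (p \<otimes>\<^bsub>free_algebra n\<^esub> q)"
  unfolding TL_simps tl_class_def by (rule ideal.rcoset_mult_add[OF ideal_tl_ideal assms])

lemma abelian_subgroup_tl_ideal: "abelian_subgroup (tl_ideal n) (free_algebra n)"
  by (rule abelian_subgroupI3[OF ideal.axioms(1)[OF ideal_tl_ideal]])
    (rule ring.is_abelian_group[OF ring_free_algebra])

lemma TL_add:
  assumes "p \<in> carrier (free_algebra n)" "q \<in> carrier (free_algebra n)"
  shows "tl_class n p \<oplus>\<^bsub>TL n\<^esub> tl_class n q = tl_class n (p + q)"
  unfolding TL_simps tl_class_def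
  using abelian_subgroup.a_rcos_sum[OF abelian_subgroup_tl_ideal assms] by (simp add: monoid_algebra_add)

lemma tl_class_carrier:
  "p \<in> carrier (free_algebra n) \<Longrightarrow> tl_class n p \<in> carrier (TL n)"
  unfolding TL_simps tl_class_def A_RCOSETS_defs a_r_coset_def RCOSETS_def by auto

lemma TL_carrier:
  assumes "X \<in> carrier (TL n)"
  obtains p where "p \<in> carrier (free_algebra n)" "X = tl_class n p"
  using assms unfolding TL_simps tl_class_def A_RCOSETS_defs a_r_coset_def RCOSETS_def by auto

lemma scale_carrier:
  "p \<in> carrier (free_algebra n) \<Longrightarrow> Poly_Mapping.map ((*) c) p \<in> carrier (free_algebra n)"
  using keys_scale[of c p] by (auto simp: monoid_algebra_carrier)

text \<open>The scalar multiple of a coset is defined as a union over its members; all members give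
  the same coset because actions scale.\<close>

lemma TL_smult:
  assumes "p \<in> carrier (free_algebra n)"
  shows "c \<odot>\<^bsub>TL n\<^esub> tl_class n p = tl_class n (Poly_Mapping.map ((*) c) p)"
proof -
  have self: "p \<in> tl_class n p"
    unfolding tl_class_def by (rule abelian_subgroup.a_rcos_self[OF abelian_subgroup_tl_ideal assms])
  have "tl_class n (Poly_Mapping.map ((*) c) q) = tl_class n (Poly_Mapping.map ((*) c) p)"
    if "q \<in> tl_class n p" for q
  proof -
    have q: "q \<in> carrier (free_algebra n)"
      using that abelian_subgroup.a_elemrcos_carrier[OF abelian_subgroup_tl_ideal assms]
      by (simp add: tl_class_def)
    have "q \<ominus>\<^bsub>free_algebra n\<^esub> p \<in> tl_ideal n"
      using that abelian_subgroup.a_rcos_module_minus[OF abelian_subgroup_tl_ideal ring_free_algebra assms q]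
      by (simp add: tl_class_def)
    then have "tl_class n q = tl_class n p"
      unfolding tl_class_def
      by (simp add: ring.quotient_eq_iff_same_a_r_cos[OF ring_free_algebra ideal_tl_ideal q assms])
    then show ?thesis
      unfolding tl_class_eq_iff[OF q assms] tl_class_eq_iff[OF scale_carrier[OF q] scale_carrier[OF assms]]
      by (simp add: poly_action_scale)
  qed
  then show ?thesis unfolding TL_simps smult_monoid_algebra using self by blast
qed

lemma TL_zero: "\<zero>\<^bsub>TL n\<^esub> = tl_class n 0"
proof -
  interpret R: ring "free_algebra n" by (rule ring_free_algebra)
  have "tl_ideal n +>\<^bsub>free_algebra n\<^esub> \<zero>\<^bsub>free_algebra n\<^esub> = tl_ideal n"
    by (rule R.a_coset_add_zero) (use tl_ideal_subset_annihilator in \<open>auto simp: annihilator_def\<close>)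
  then show ?thesis unfolding tl_class_def TL_simps by (simp add: monoid_algebra_def)
qed

lemma zero_carrier: "0 \<in> carrier (free_algebra n)"
  by (simp add: monoid_algebra_carrier)

lemma abelian_group_TL: "abelian_group (TL n)"
proof (rule abelian_groupI)
  fix X assume "X \<in> carrier (TL n)"
  then obtain p where p: "p \<in> carrier (free_algebra n)" "X = tl_class n p" by (rule TL_carrier)
  show "\<exists>Y\<in>carrier (TL n). Y \<oplus>\<^bsub>TL n\<^esub> X = \<zero>\<^bsub>TL n\<^esub>"
    using p monoid_algebra_uminus_closed[OF p(1)]
    by (intro bexI[of _ "tl_class n (- p)"]) (simp_all add: TL_add TL_zero tl_class_carrier)
  show "\<zero>\<^bsub>TL n\<^esub> \<oplus>\<^bsub>TL n\<^esub> X = X" using p by (simp add: TL_zero TL_add zero_carrier)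
qed (auto elim!: TL_carrier simp: TL_add TL_zero tl_class_carrier monoid_algebra_add_closed zero_carrier
    add.assoc add.commute add.left_commute)

lemma TL_minus:
  assumes "p \<in> carrier (free_algebra n)" "q \<in> carrier (free_algebra n)"
  shows "tl_class n p \<ominus>\<^bsub>TL n\<^esub> tl_class n q = tl_class n (p - q)"
proof -
  interpret abelian_group "TL n" by (rule abelian_group_TL)
  have "tl_class n p = tl_class n (p - q) \<oplus>\<^bsub>TL n\<^esub> tl_class n q"
    using TL_add[OF monoid_algebra_diff_closed[OF assms] assms(2)] by simp
  then show ?thesis
    using tl_class_carrier assms monoid_algebra_diff_closed[OF assms]
    by (simp add: a_minus_def a_assoc r_neg)
qed

lemma TL_finsum:
  assumes "finite A" "\<And>x. x \<in> A \<Longrightarrow> f x \<in> carrier (free_algebra n)"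
  shows "(\<Oplus>\<^bsub>TL n\<^esub> x \<in> A. tl_class n (f x)) = tl_class n (sum f A)"
proof -
  interpret abelian_group "TL n" by (rule abelian_group_TL)
  show ?thesis
    using assms
  proof (induction A rule: finite_induct)
    case (insert x A)
    then show ?case
      by (simp add: finsum_insert Pi_iff tl_class_carrier TL_add monoid_algebra_sum_closed)
  qed (simp add: TL_zero)
qed

lemma basis_word_carrier:
  "w \<in> avoiders_321 n \<Longrightarrow> Poly_Mapping.single (basis_word n w) c \<in> carrier (free_algebra n)"
  using reduced_basis_word[of w n]
  by (intro monoid_algebra_single_closed) (auto simp: avoiders_321_iff reduced_word_iff)

lemma tl_basis_eq:
  assumes "w permutes {1..n}"
  shows "tl_basis n w = tl_class n (Poly_Mapping.single (basis_word n w) 1)"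
proof -
  have "foldr (\<lambda>i x. tl_gen n i \<otimes>\<^bsub>TL n\<^esub> x) y \<one>\<^bsub>TL n\<^esub> = tl_class n (Poly_Mapping.single y 1)"
    if "y \<in> lists {1..<n}" for y
    using that
  proof (induction y)
    case Nil
    then show ?case by (simp add: TL_simps monoid_algebra_def)
  next
    case (Cons i y)
    then have "tl_gen n i \<otimes>\<^bsub>TL n\<^esub> tl_class n (Poly_Mapping.single y 1) =
        tl_class n (Poly_Mapping.single [i] 1 \<otimes>\<^bsub>free_algebra n\<^esub> Poly_Mapping.single y 1)"
      unfolding tl_gen_def tl_class_def[symmetric]
      by (intro TL_mult monoid_algebra_single_closed) auto
    then show ?case using Cons by (simp add: monoid_algebra_mult_single)
  qed
  then show ?thesis
    using reduced_basis_word[OF assms] unfolding tl_basis_def basis_word_def[symmetric]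
    by (simp add: reduced_word_iff)
qed

lemma tl_basis_combination:
  "(\<Oplus>\<^bsub>TL n\<^esub> w \<in> avoiders_321 n. c w \<odot>\<^bsub>TL n\<^esub> tl_basis n w) =
    tl_class n (\<Sum>w\<in>avoiders_321 n. Poly_Mapping.single (basis_word n w) (c w))"
proof -
  interpret abelian_group "TL n" by (rule abelian_group_TL)
  have "(\<Oplus>\<^bsub>TL n\<^esub> w \<in> avoiders_321 n. c w \<odot>\<^bsub>TL n\<^esub> tl_basis n w) =
      (\<Oplus>\<^bsub>TL n\<^esub> w \<in> avoiders_321 n. tl_class n (Poly_Mapping.single (basis_word n w) (c w)))"
    by (rule finsum_cong')
      (auto simp: tl_basis_eq avoiders_321_iff TL_smult basis_word_carrier scale_single intro!: tl_class_carrier)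
  also have "\<dots> = tl_class n (\<Sum>w\<in>avoiders_321 n. Poly_Mapping.single (basis_word n w) (c w))"
    by (rule TL_finsum[OF finite_avoiders_321 basis_word_carrier])
  finally show ?thesis .
qed

section \<open>The coefficients of the Temperley-Lieb immanants\<close>

text \<open>A lift of theta(s_i s_j ...) to the free algebra, with one factor t_i - 1 for each
  letter.\<close>

primrec generator_product :: "nat \<Rightarrow> nat list \<Rightarrow> (nat list \<Rightarrow>\<^sub>0 complex)" where
  "generator_product n [] = Poly_Mapping.single [] 1"
| "generator_product n (i # x) =
    (Poly_Mapping.single [i] 1 - Poly_Mapping.single [] 1) \<otimes>\<^bsub>free_algebra n\<^esub> generator_product n x"

lemma generator_carrier:
  "i \<in> {1..<n} \<Longrightarrow> Poly_Mapping.single [i] 1 - Poly_Mapping.single [] 1 \<in> carrier (free_algebra n)"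
  by (intro monoid_algebra_diff_closed monoid_algebra_single_closed) auto

lemma generator_product_carrier:
  "x \<in> lists {1..<n} \<Longrightarrow> generator_product n x \<in> carrier (free_algebra n)"
proof (induction x)
  case Nil
  then show ?case by (simp add: monoid_algebra_carrier)
next
  case (Cons i x)
  then have i: "i \<in> {1..<n}" and x: "x \<in> lists {1..<n}" by auto
  show ?case
    unfolding generator_product.simps
    by (rule monoid.monoid_algebra_mult_closed[OF monoid_free_monoid generator_carrier[OF i] Cons.IH[OF x]])
qed

text \<open>As t_i acts by 1 - s_i, the factor t_i - 1 acts by - s_i. The action therefore depends
  only on the permutation and the parity of the word; here the sign twist originates.\<close>

lemma poly_action_generator_product:
  "poly_action (generator_product n x) h u = (-1) ^ length x * h (u \<circ> word_perm x)"
  by (induction x arbitrary: u) (simp_all add: poly_action_mult poly_action_diff o_assoc del: comp_apply id_apply)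

definition perm_poly :: "nat \<Rightarrow> (nat \<Rightarrow> nat) \<Rightarrow> (nat list \<Rightarrow>\<^sub>0 complex)"
  where "perm_poly n u = generator_product n (basis_word n u)"

lemma basis_word_props:
  assumes "u permutes {1..n}"
  shows "basis_word n u \<in> lists {1..<n}" "word_perm (basis_word n u) = u"
    "(-1) ^ length (basis_word n u) = (of_int (sign u) :: complex)"
  using reduced_basis_word[OF assms] sign_word_perm[of "basis_word n u" n] by (auto simp: reduced_word_iff)

lemma perm_poly_carrier: "u permutes {1..n} \<Longrightarrow> perm_poly n u \<in> carrier (free_algebra n)"
  unfolding perm_poly_def by (intro generator_product_carrier basis_word_props)

lemma poly_action_perm_poly:
  "v permutes {1..n} \<Longrightarrow> poly_action (perm_poly n v) h u = of_int (sign v) * h (u \<circ> v)"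
  unfolding perm_poly_def poly_action_generator_product by (simp only: basis_word_props)

text \<open>The sign-twisted right translation that theta has to induce on functionals.\<close>

definition group_action :: "((nat \<Rightarrow> nat) \<Rightarrow>\<^sub>0 complex) \<Rightarrow> ((nat \<Rightarrow> nat) \<Rightarrow> complex) \<Rightarrow> (nat \<Rightarrow> nat) \<Rightarrow> complex"
  where "group_action p h u =
    (\<Sum>v\<in>Poly_Mapping.keys p. Poly_Mapping.lookup p v * (of_int (sign v) * h (u \<circ> v)))"

lemma group_action_superset:
  assumes "finite K" "Poly_Mapping.keys p \<subseteq> K"
  shows "group_action p h u = (\<Sum>v\<in>K. Poly_Mapping.lookup p v * (of_int (sign v) * h (u \<circ> v)))"
  unfolding group_action_def using assms
  by (intro sum.mono_neutral_left) (auto simp: not_in_keys_iff_lookup_eq_zero)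

lemma group_action_single: "group_action (Poly_Mapping.single v c) h u = c * (of_int (sign v) * h (u \<circ> v))"
  by (subst group_action_superset[of "{v}"]) auto

lemma group_action_add: "group_action (p + q) h u = group_action p h u + group_action q h u"
proof -
  let ?K = "Poly_Mapping.keys p \<union> Poly_Mapping.keys q"
  show ?thesis
    using keys_add[of p q]
    by (simp add: group_action_superset[where K = ?K] lookup_add distrib_right sum.distrib)
qed

lemma group_action_sum: "group_action (sum f A) h u = (\<Sum>y\<in>A. group_action (f y) h u)"
  by (induction A rule: infinite_finite_induct) (auto simp: group_action_add, auto simp: group_action_def)

lemma group_action_scale: "group_action (Poly_Mapping.map ((*) c) p) h u = c * group_action p h u"
proof -
  have "group_action (Poly_Mapping.map ((*) c) p) h u =
      (\<Sum>v\<in>Poly_Mapping.keys p. Poly_Mapping.lookup (Poly_Mapping.map ((*) c) p) v * (of_int (sign v) * h (u \<circ> v)))"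
    by (rule group_action_superset) (simp_all add: keys_scale)
  then show ?thesis by (simp add: lookup_scale group_action_def sum_distrib_left mult.assoc)
qed

lemma sym_group_simps:
  "carrier (sym_group n) = {p. p permutes {1..n}}" "x \<otimes>\<^bsub>sym_group n\<^esub> y = x \<circ> y" "\<one>\<^bsub>sym_group n\<^esub> = id"
  by (simp_all add: sym_group_def)

lemma monoid_sym_group: "Group.monoid (sym_group n)"
  by (rule group.is_monoid) (rule sym_group_is_group)

lemma group_action_mult:
  assumes "p \<in> carrier (group_algebra n)" "q \<in> carrier (group_algebra n)"
  shows "group_action (p \<otimes>\<^bsub>group_algebra n\<^esub> q) h u = group_action p (group_action q h) u"
proof -
  have perm: "permutation v" if "v \<in> Poly_Mapping.keys p \<union> Poly_Mapping.keys q" for v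
    using that assms permutation_permutes by (fastforce simp: monoid_algebra_carrier sym_group_simps)
  have "group_action (p \<otimes>\<^bsub>group_algebra n\<^esub> q) h u =
      (\<Sum>v\<in>Poly_Mapping.keys p. \<Sum>w\<in>Poly_Mapping.keys q. Poly_Mapping.lookup p v * Poly_Mapping.lookup q w *
        (of_int (sign (v \<circ> w)) * h (u \<circ> (v \<circ> w))))"
    by (subst monoid_algebra_mult[OF finite_keys order_refl finite_keys order_refl])
      (simp add: group_action_sum group_action_single sym_group_simps del: comp_apply)
  also have "\<dots> = (\<Sum>v\<in>Poly_Mapping.keys p. \<Sum>w\<in>Poly_Mapping.keys q. Poly_Mapping.lookup p v *
        (of_int (sign v) * (Poly_Mapping.lookup q w * (of_int (sign w) * h (u \<circ> v \<circ> w)))))"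
  proof (intro sum.cong HOL.refl)
    fix v w assume "v \<in> Poly_Mapping.keys p" "w \<in> Poly_Mapping.keys q"
    then have "sign (v \<circ> w) = sign v * sign w" by (simp add: sign_compose perm)
    then show "Poly_Mapping.lookup p v * Poly_Mapping.lookup q w *
        (complex_of_int (sign (v \<circ> w)) * h (u \<circ> (v \<circ> w))) = Poly_Mapping.lookup p v *
        (of_int (sign v) * (Poly_Mapping.lookup q w * (of_int (sign w) * h (u \<circ> v \<circ> w))))"
      by (simp only: o_assoc of_int_mult mult_ac)
  qed
  finally show ?thesis by (simp only: group_action_def sum_distrib_left)
qed

definition theta_map :: "nat \<Rightarrow> ((nat \<Rightarrow> nat) \<Rightarrow>\<^sub>0 complex) \<Rightarrow> (nat list \<Rightarrow>\<^sub>0 complex)"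
  where "theta_map n p =
    (\<Sum>v\<in>Poly_Mapping.keys p. Poly_Mapping.map ((*) (Poly_Mapping.lookup p v)) (perm_poly n v))"

lemma theta_map_carrier:
  assumes "p \<in> carrier (group_algebra n)"
  shows "theta_map n p \<in> carrier (free_algebra n)"
  unfolding theta_map_def
  by (intro monoid_algebra_sum_closed scale_carrier perm_poly_carrier)
    (use assms in \<open>auto simp: monoid_algebra_carrier sym_group_simps\<close>)

lemma poly_action_theta_map:
  assumes "p \<in> carrier (group_algebra n)"
  shows "poly_action (theta_map n p) h u = group_action p h u"
  unfolding theta_map_def group_action_def poly_action_sum poly_action_scale
  by (intro sum.cong refl) (use assms in \<open>auto simp: monoid_algebra_carrier sym_group_simps poly_action_perm_poly\<close>)

text \<open>Multiplicativity is a comparison of actions: both sides act on functionals as the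
  composite of the two twisted translations. Existence is what gives the choice in
  \<open>tl_theta\<close> its defining properties.\<close>

lemma theta_exists:
  "(\<lambda>p. tl_class n (theta_map n p)) \<in> algebra_hom (group_algebra n) (TL n)"
    (is "?h \<in> _")
proof -
  have "?h \<in> ring_hom (group_algebra n) (TL n)"
  proof (rule ring_hom_memI)
    fix p q assume p: "p \<in> carrier (group_algebra n)" and q: "q \<in> carrier (group_algebra n)"
    note pq = monoid.monoid_algebra_mult_closed[OF monoid_sym_group p q]
    note c = theta_map_carrier[OF p] theta_map_carrier[OF q]
    have "tl_class n (theta_map n (p \<otimes>\<^bsub>group_algebra n\<^esub> q)) =
        tl_class n (theta_map n p \<otimes>\<^bsub>free_algebra n\<^esub> theta_map n q)"
    proof (subst tl_class_eq_iff)
      have "group_action p (poly_action (theta_map n q) h) u = group_action p (group_action q h) u"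
        if "u permutes {1..n}" for h u
        unfolding group_action_def[of p] by (simp add: poly_action_theta_map[OF q])
      then show "\<forall>h u. tl_functional n h \<longrightarrow> u permutes {1..n} \<longrightarrow>
          poly_action (theta_map n (p \<otimes>\<^bsub>group_algebra n\<^esub> q)) h u =
          poly_action (theta_map n p \<otimes>\<^bsub>free_algebra n\<^esub> theta_map n q) h u"
        by (simp add: poly_action_mult poly_action_theta_map p pq group_action_mult q)
    qed (auto intro: theta_map_carrier pq monoid.monoid_algebra_mult_closed[OF monoid_free_monoid] c)
    then show "?h (p \<otimes>\<^bsub>group_algebra n\<^esub> q) = ?h p \<otimes>\<^bsub>TL n\<^esub> ?h q" by (simp add: TL_mult c)
    have add: "p + q \<in> carrier (group_algebra n)" by (rule monoid_algebra_add_closed[OF p q])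
    have "tl_class n (theta_map n (p + q)) = tl_class n (theta_map n p + theta_map n q)"
      by (subst tl_class_eq_iff)
        (auto simp: poly_action_add poly_action_theta_map p q add group_action_add
          intro: theta_map_carrier add monoid_algebra_add_closed c)
    then show "?h (p \<oplus>\<^bsub>group_algebra n\<^esub> q) = ?h p \<oplus>\<^bsub>TL n\<^esub> ?h q"
      by (simp add: TL_add c monoid_algebra_add)
  next
    show "?h p \<in> carrier (TL n)" if "p \<in> carrier (group_algebra n)" for p
      using that by (intro tl_class_carrier theta_map_carrier)
  next
    have one: "\<one>\<^bsub>group_algebra n\<^esub> = Poly_Mapping.single id 1" "\<one>\<^bsub>free_algebra n\<^esub> = Poly_Mapping.single [] 1"
      by (simp_all add: monoid_algebra_def sym_group_simps)
    have c: "Poly_Mapping.single id 1 \<in> carrier (group_algebra n)"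
      by (rule monoid_algebra_single_closed) (simp add: sym_group_simps permutes_id del: id_apply)
    show "?h \<one>\<^bsub>group_algebra n\<^esub> = \<one>\<^bsub>TL n\<^esub>"
      unfolding one TL_simps
      by (subst tl_class_eq_iff)
        (auto simp: poly_action_theta_map c group_action_single sign_id simp del: id_apply
          intro: theta_map_carrier c monoid_algebra_single_closed)
  qed
  moreover have "?h (c \<odot>\<^bsub>group_algebra n\<^esub> p) = c \<odot>\<^bsub>TL n\<^esub> ?h p"
    if p: "p \<in> carrier (group_algebra n)" for c p
  proof -
    have cp: "Poly_Mapping.map ((*) c) p \<in> carrier (group_algebra n)"
      using p keys_scale[of c p] by (auto simp: monoid_algebra_carrier)
    show ?thesis
      unfolding smult_monoid_algebra TL_smult[OF theta_map_carrier[OF p]]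
      by (subst tl_class_eq_iff)
        (auto simp: poly_action_theta_map p cp group_action_scale poly_action_scale
          intro: theta_map_carrier cp scale_carrier p)
  qed
  ultimately show ?thesis by (simp add: algebra_hom_def)
qed

lemma tl_gen_minus_one:
  "i \<in> {1..<n} \<Longrightarrow> tl_gen n i \<ominus>\<^bsub>TL n\<^esub> \<one>\<^bsub>TL n\<^esub> =
    tl_class n (Poly_Mapping.single [i] 1 - Poly_Mapping.single [] 1)"
  unfolding tl_gen_def tl_class_def[symmetric] TL_simps
  by (subst TL_minus) (auto simp: monoid_algebra_def)

lemma tl_theta_props:
  "tl_theta n \<in> algebra_hom (group_algebra n) (TL n)"
  "i \<in> {1..<n} \<Longrightarrow> tl_theta n (Poly_Mapping.single (simple_transposition i) 1) =
    tl_class n (Poly_Mapping.single [i] 1 - Poly_Mapping.single [] 1)"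
proof -
  have "tl_class n (theta_map n (Poly_Mapping.single (simple_transposition i) 1)) =
      tl_gen n i \<ominus>\<^bsub>TL n\<^esub> \<one>\<^bsub>TL n\<^esub>" if i: "i \<in> {1..<n}" for i
  proof -
    have c: "Poly_Mapping.single (simple_transposition i) 1 \<in> carrier (group_algebra n)"
      by (rule monoid_algebra_single_closed) (simp add: sym_group_simps simple_transposition_permutes[OF i])
    show ?thesis
      unfolding tl_gen_minus_one[OF i]
      by (subst tl_class_eq_iff)
        (auto simp: poly_action_theta_map c group_action_single poly_action_diff sign_swap_id
          intro: theta_map_carrier c generator_carrier[OF i] simp del: comp_apply)
  qed
  then have "\<exists>h. h \<in> algebra_hom (group_algebra n) (TL n) \<and>
      (\<forall>i\<in>{1..<n}. h (Poly_Mapping.single (simple_transposition i) 1) = tl_gen n i \<ominus>\<^bsub>TL n\<^esub> \<one>\<^bsub>TL n\<^esub>)"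
    using theta_exists by blast
  then have *: "tl_theta n \<in> algebra_hom (group_algebra n) (TL n) \<and>
      (\<forall>i\<in>{1..<n}. tl_theta n (Poly_Mapping.single (simple_transposition i) 1) = tl_gen n i \<ominus>\<^bsub>TL n\<^esub> \<one>\<^bsub>TL n\<^esub>)"
    unfolding tl_theta_def by (rule someI_ex)
  then show "tl_theta n \<in> algebra_hom (group_algebra n) (TL n)" by blast
  show "tl_theta n (Poly_Mapping.single (simple_transposition i) 1) =
    tl_class n (Poly_Mapping.single [i] 1 - Poly_Mapping.single [] 1)" if "i \<in> {1..<n}"
    using * that tl_gen_minus_one[OF that] by simp
qed

text \<open>A homomorphism is determined on words by its values at the s_i, so the chosen theta is
  known at every permutation.\<close>

lemma tl_theta_word:
  assumes "x \<in> lists {1..<n}"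
  shows "tl_theta n (Poly_Mapping.single (word_perm x) 1) = tl_class n (generator_product n x)"
  using assms
proof (induction x)
  case Nil
  have "tl_theta n \<one>\<^bsub>group_algebra n\<^esub> = \<one>\<^bsub>TL n\<^esub>"
    using tl_theta_props(1)[of n] by (simp add: algebra_hom_def ring_hom_one)
  then show ?case
    by (simp add: monoid_algebra_def sym_group_simps TL_simps del: id_apply)
next
  case (Cons i x)
  then have i: "i \<in> {1..<n}" and x: "x \<in> lists {1..<n}" by auto
  have c: "Poly_Mapping.single (simple_transposition i) 1 \<in> carrier (group_algebra n)"
    "Poly_Mapping.single (word_perm x) 1 \<in> carrier (group_algebra n)"
    by (intro monoid_algebra_single_closed,
        simp add: sym_group_simps simple_transposition_permutes[OF i] word_perm_permutes[OF x])+
  have "Poly_Mapping.single (word_perm (i # x)) 1 = Poly_Mapping.single (simple_transposition i) 1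
      \<otimes>\<^bsub>group_algebra n\<^esub> (Poly_Mapping.single (word_perm x) 1 :: _ \<Rightarrow>\<^sub>0 complex)"
    unfolding monoid_algebra_mult_single sym_group_simps word_perm_Cons by simp
  then have "tl_theta n (Poly_Mapping.single (word_perm (i # x)) 1) =
      tl_theta n (Poly_Mapping.single (simple_transposition i) 1) \<otimes>\<^bsub>TL n\<^esub>
      tl_theta n (Poly_Mapping.single (word_perm x) 1)"
    using tl_theta_props(1)[of n] c ring_hom_mult unfolding algebra_hom_def by fastforce
  also have "\<dots> = tl_class n (generator_product n (i # x))"
    using Cons.IH x by (simp add: tl_theta_props(2)[OF i] TL_mult generator_carrier[OF i]
        generator_product_carrier[OF x])
  finally show ?case .
qed

text \<open>The expansion of theta(u) in the basis, applied to h and evaluated at a. On the left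
  stands the twisted translation by u.\<close>

lemma tl_coefficient_expansion:
  assumes u: "u permutes {1..n}" and h: "tl_functional n h" and a: "a permutes {1..n}"
  shows "of_int (sign u) * h (a \<circ> u) =
    (\<Sum>w\<in>avoiders_321 n. tl_coefficient n w u * word_action (basis_word n w) h a)"
proof -
  let ?sum = "\<lambda>c. \<Sum>w\<in>avoiders_321 n. Poly_Mapping.single (basis_word n w) (c w)"
  have theta: "tl_theta n (Poly_Mapping.single u 1) = tl_class n (perm_poly n u)"
    using tl_theta_word[OF basis_word_props(1)[OF u]] basis_word_props(2)[OF u] by (simp add: perm_poly_def)
  note pc = perm_poly_carrier[OF u]
  have sc: "?sum c \<in> carrier (free_algebra n)" for c
    by (intro monoid_algebra_sum_closed basis_word_carrier)
  obtain c where c: "perm_poly n u - ?sum c \<in> tl_ideal n"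
    using basis_expansion[OF pc] by blast
  have "tl_class n (perm_poly n u) = tl_class n (?sum c)"
    using c unfolding tl_class_eq_iff[OF pc sc] tl_ideal_eq_annihilator annihilator_def
    by (simp add: poly_action_diff)
  then have "\<exists>c. tl_theta n (Poly_Mapping.single u 1) =
      (\<Oplus>\<^bsub>TL n\<^esub> w \<in> avoiders_321 n. c w \<odot>\<^bsub>TL n\<^esub> tl_basis n w)"
    unfolding theta tl_basis_combination by blast
  \<comment> \<open>Spanning provides some coordinates, hence the coordinates picked by the choice
    operator satisfy the expansion.\<close>
  then have "tl_theta n (Poly_Mapping.single u 1) = (\<Oplus>\<^bsub>TL n\<^esub> w \<in> avoiders_321 n.
      tl_coordinates n (tl_theta n (Poly_Mapping.single u 1)) w \<odot>\<^bsub>TL n\<^esub> tl_basis n w)"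
    unfolding tl_coordinates_def by (rule someI_ex)
  then have "tl_class n (perm_poly n u) = tl_class n (?sum (\<lambda>w. tl_coefficient n w u))"
    unfolding theta tl_basis_combination tl_coefficient_def .
  then show ?thesis
    unfolding tl_class_eq_iff[OF pc sc] using h a
    by (simp add: poly_action_perm_poly[OF u] poly_action_sum)
qed

text \<open>The sign undoes the twist in theta. The resulting functions are dual to the evaluations
  of the basis words at the identity.\<close>

definition tl_dual :: "nat \<Rightarrow> (nat \<Rightarrow> nat) \<Rightarrow> (nat \<Rightarrow> nat) \<Rightarrow> complex"
  where "tl_dual n w u = of_int (sign u) * tl_coefficient n w u"

lemma sign_sq: "(of_int (sign u) :: complex) * (of_int (sign u) * c) = c"
  by (cases u rule: sign_cases) auto

lemma tl_dual_expansion: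
  assumes "u permutes {1..n}" "tl_functional n h" "a permutes {1..n}"
  shows "h (a \<circ> u) = (\<Sum>w\<in>avoiders_321 n. tl_dual n w u * word_action (basis_word n w) h a)"
proof -
  have "h (a \<circ> u) = of_int (sign u) * (of_int (sign u) * h (a \<circ> u))" by (simp add: sign_sq)
  also have "\<dots> = (\<Sum>w\<in>avoiders_321 n. tl_dual n w u * word_action (basis_word n w) h a)"
    unfolding tl_coefficient_expansion[OF assms] by (simp add: tl_dual_def sum_distrib_left mult.assoc)
  finally show ?thesis .
qed

lemma tl_dual_expansion_id:
  assumes "u permutes {1..n}" "tl_functional n h"
  shows "h u = (\<Sum>w\<in>avoiders_321 n. tl_dual n w u * word_action (basis_word n w) h id)"
  using tl_dual_expansion[OF assms permutes_id] by simp

text \<open>Expanding the six values of a functional h in its relation gives a combination of basis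
  words that vanishes on every h; by independence its coefficient at w is zero.\<close>

lemma tl_functional_tl_dual:
  assumes w: "w \<in> avoiders_321 n"
  shows "tl_functional n (tl_dual n w)"
  unfolding tl_functional_def tl_relation_def
proof (intro allI impI)
  fix u i j k
  assume u: "u permutes {1..n}" and "{i, j, k} \<subseteq> {1..n}" and ne: "i \<noteq> j" "j \<noteq> k" "i \<noteq> k"
  then have mem: "i \<in> {1..n}" "j \<in> {1..n}" "k \<in> {1..n}" by auto
  let ?ij = "u \<circ> Transposition.transpose i j" and ?jk = "u \<circ> Transposition.transpose j k"
    and ?ik = "u \<circ> Transposition.transpose i k"
    and ?c = "u \<circ> Transposition.transpose i j \<circ> Transposition.transpose j k"
    and ?d = "u \<circ> Transposition.transpose j k \<circ> Transposition.transpose i j"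
  have p: "?ij permutes {1..n}" "?jk permutes {1..n}" "?ik permutes {1..n}"
      "?c permutes {1..n}" "?d permutes {1..n}"
    using u mem by (simp_all only: permutes_transpose)
  let ?b = "\<lambda>w. tl_dual n w u + tl_dual n w ?c + tl_dual n w ?d
      - tl_dual n w ?ij - tl_dual n w ?jk - tl_dual n w ?ik"
  have "?b w = 0"
  proof (rule basis_coefficients_zero[OF _ w])
    fix h assume h: "tl_functional n h"
    have "(\<Sum>w\<in>avoiders_321 n. ?b w * word_action (basis_word n w) h id) =
        h u + h ?c + h ?d - h ?ij - h ?jk - h ?ik"
      unfolding tl_dual_expansion_id[OF u h] p[THEN tl_dual_expansion_id[OF _ h]]
      by (simp add: sum.distrib sum_subtractf algebra_simps del: comp_apply)
    also have "\<dots> = 0" using tl_functionalD[OF h u mem ne] by (simp del: comp_apply)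
    finally show "(\<Sum>w\<in>avoiders_321 n. ?b w * word_action (basis_word n w) h id) = 0" .
  qed
  then show "tl_dual n w u + tl_dual n w ?c + tl_dual n w ?d =
      tl_dual n w ?ij + tl_dual n w ?jk + tl_dual n w ?ik" by (simp add: algebra_simps)
qed

text \<open>Take a counterexample v of least rank sum and expand \<open>separating v\<close> at u. A
  contributing x lies above v; if it differs from v, it has smaller rank sum and hence lies below u,
  which would put v below u. Only v remains, so \<open>separating v u\<close> is non-zero, and again
  v is below u.\<close>

lemma tl_dual_bruhat_le:
  assumes w: "w \<in> avoiders_321 n" and u: "u permutes {1..n}" and nz: "tl_dual n w u \<noteq> 0"
  shows "bruhat_le w u"
proof (rule ccontr)
  assume "\<not> bruhat_le w u"
  then obtain v where v: "v \<in> avoiders_321 n" "tl_dual n v u \<noteq> 0" "\<not> bruhat_le v u"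
      and min: "\<And>x. x \<in> avoiders_321 n \<Longrightarrow> tl_dual n x u \<noteq> 0 \<Longrightarrow> \<not> bruhat_le x u \<Longrightarrow> rank_sum n v \<le> rank_sum n x"
    using ex_has_least_nat[of "\<lambda>x. x \<in> avoiders_321 n \<and> tl_dual n x u \<noteq> 0 \<and> \<not> bruhat_le x u" w "rank_sum n"]
      w nz by blast
  have "separating v u = (\<Sum>x\<in>avoiders_321 n. tl_dual n x u * word_action (basis_word n x) (separating v) id)"
    by (rule tl_dual_expansion_id[OF u tl_functional_separating])
  also have "\<dots> = (\<Sum>x\<in>avoiders_321 n. if x = v then tl_dual n v u * (-1) ^ length (basis_word n v) else 0)"
  proof (rule sum.cong)
    fix x assume x: "x \<in> avoiders_321 n"
    have "tl_dual n x u * word_action (basis_word n x) (separating v) id = 0" if "x \<noteq> v"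
    proof (rule ccontr)
      assume nz: "tl_dual n x u * word_action (basis_word n x) (separating v) id \<noteq> 0"
      then have le: "bruhat_le v x"
        using basis_word_action_separating[OF v(1), of x] x by (auto simp: avoiders_321_iff)
      then have "rank_sum n x < rank_sum n v"
        using rank_sum_less[of v n x] x v(1) that by (auto simp: avoiders_321_iff)
      then have "bruhat_le x u" using min[OF x] nz by force
      then show False using le v(3) bruhat_le_trans by blast
    qed
    then show "tl_dual n x u * word_action (basis_word n x) (separating v) id =
        (if x = v then tl_dual n v u * (-1) ^ length (basis_word n v) else 0)"
      using basis_word_action_separating_self[OF v(1)] by auto
  qed simp
  also have "\<dots> = tl_dual n v u * (-1) ^ length (basis_word n v)"
    using v(1) by (simp add: finite_avoiders_321)
  finally have "separating v u \<noteq> 0" using v(2) by simp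
  then show False using separating_bruhat_le[of v n u] v u by (auto simp: avoiders_321_iff)
qed

text \<open>When \<open>separating w\<close> is expanded at w, a contributing x lies both above and
  below w.\<close>

lemma tl_dual_self:
  assumes w: "w \<in> avoiders_321 n"
  shows "tl_dual n w w = of_int (sign w)"
proof -
  have wp: "w permutes {1..n}" using w by (simp add: avoiders_321_iff)
  have "separating w w = (\<Sum>x\<in>avoiders_321 n. tl_dual n x w * word_action (basis_word n x) (separating w) id)"
    by (rule tl_dual_expansion_id[OF wp tl_functional_separating])
  also have "\<dots> = (\<Sum>x\<in>avoiders_321 n. if x = w then tl_dual n w w * of_int (sign w) else 0)"
  proof (rule sum.cong)
    fix x assume x: "x \<in> avoiders_321 n"
    have "tl_dual n x w * word_action (basis_word n x) (separating w) id = 0" if "x \<noteq> w"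
      using basis_word_action_separating[OF w, of x] tl_dual_bruhat_le[OF x wp] bruhat_le_antisym[of x w] that x
      by (auto simp: avoiders_321_iff)
    then show "tl_dual n x w * word_action (basis_word n x) (separating w) id =
        (if x = w then tl_dual n w w * of_int (sign w) else 0)"
      using basis_word_action_separating_self[OF w] basis_word_props(3)[OF wp] by auto
  qed simp
  also have "\<dots> = tl_dual n w w * of_int (sign w)"
    using w by (simp add: finite_avoiders_321)
  finally have "tl_dual n w w * of_int (sign w) = 1" by (simp add: separating_def)
  then show ?thesis by (cases w rule: sign_cases) (auto simp: minus_equation_iff)
qed

text \<open>A single term of the expansion of h survives, so h is a multiple of the dual function;
  the value at w fixes the factor.\<close>

lemma tl_dual_characterisation:
  assumes w: "w \<in> avoiders_321 n" and h: "tl_functional n h" and hw: "h w = 1"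
    and zero: "\<And>v. v \<in> avoiders_321 n \<Longrightarrow> v \<noteq> w \<Longrightarrow> word_action (basis_word n v) h id = 0"
    and u: "u permutes {1..n}"
  shows "h u = of_int (sign w) * tl_dual n w u"
proof -
  have wp: "w permutes {1..n}" using w by (simp add: avoiders_321_iff)
  have *: "h v = tl_dual n w v * word_action (basis_word n w) h id" if "v permutes {1..n}" for v
  proof -
    have "h v = (\<Sum>x\<in>avoiders_321 n. tl_dual n x v * word_action (basis_word n x) h id)"
      by (rule tl_dual_expansion_id[OF that h])
    also have "\<dots> = (\<Sum>x\<in>avoiders_321 n. if x = w then tl_dual n w v * word_action (basis_word n w) h id else 0)"
      using zero by (intro sum.cong) auto
    finally show ?thesis using w by (simp add: finite_avoiders_321)
  qed
  have "of_int (sign w) * word_action (basis_word n w) h id = 1"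
    using *[OF wp] hw tl_dual_self[OF w] by simp
  then have "word_action (basis_word n w) h id = of_int (sign w)"
    using sign_sq[of w "word_action (basis_word n w) h id"] by simp
  then show ?thesis using *[OF u] by simp
qed

section \<open>Coefficients of immanants\<close>

definition perm_exponents :: "nat \<Rightarrow> (nat \<Rightarrow> nat) \<Rightarrow> (nat \<times> nat) \<Rightarrow>\<^sub>0 nat"
  where "perm_exponents n u = (\<Sum>i\<in>{1..n}. Poly_Mapping.single (i, u i) 1)"

lemma perm_monomial_eq: "perm_monomial n u = Poly_Mapping.single (perm_exponents n u) 1"
proof -
  have "(\<Prod>i\<in>A. var_poly i (u i)) = Poly_Mapping.single (\<Sum>i\<in>A. Poly_Mapping.single (i, u i) 1) 1"
    if "finite A" for A
    using that by (induction A rule: finite_induct) (auto simp: var_poly_def mult_single)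
  then show ?thesis by (simp add: perm_monomial_def perm_exponents_def)
qed

lemma perm_exponents_inj:
  assumes "u permutes {1..n}" "v permutes {1..n}" "perm_exponents n u = perm_exponents n v"
  shows "u = v"
proof
  fix i
  have lookup: "Poly_Mapping.lookup (perm_exponents n w) (i, w i) = (1::nat)" if "i \<in> {1..n}" for w
  proof -
    have "Poly_Mapping.lookup (perm_exponents n w) (i, w i) = (\<Sum>k\<in>{1..n}. if k = i then 1 else 0)"
      unfolding perm_exponents_def lookup_sum by (intro sum.cong) (auto simp: lookup_single when_def)
    then show ?thesis using that by simp
  qed
  show "u i = v i"
  proof (cases "i \<in> {1..n}")
    case True
    have "Poly_Mapping.lookup (perm_exponents n v) (i, u i) = (1::nat)" using lookup[OF True, of u] assms(3) by simp
    then have "(\<Sum>k\<in>{1..n}. (1::nat) when (k, v k) = (i, u i)) \<noteq> 0"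
      unfolding perm_exponents_def lookup_sum lookup_single by simp
    then obtain k where "((1::nat) when (k, v k) = (i, u i)) \<noteq> 0" by (meson sum.neutral)
    then show ?thesis by (auto simp: when_def split: if_splits)
  next
    case False
    then show ?thesis using assms(1,2) by (simp add: permutes_not_in)
  qed
qed

lemma const_poly_mult: "const_poly c * p = Poly_Mapping.map ((*) c) p"
  by (simp add: const_poly_def mult_map_scale_conv_mult)

definition perm_sum :: "nat \<Rightarrow> ((nat \<Rightarrow> nat) \<Rightarrow> complex) \<Rightarrow> matrix_poly"
  where "perm_sum n c = (\<Sum>u | u permutes {1..n}. const_poly (c u) * perm_monomial n u)"

lemma lookup_perm_sum:
  assumes "v permutes {1..n}"
  shows "Poly_Mapping.lookup (perm_sum n c) (perm_exponents n v) = c v"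
proof -
  have "Poly_Mapping.lookup (perm_sum n c) (perm_exponents n v) =
      (\<Sum>u | u permutes {1..n}. if u = v then c v else 0)"
    unfolding perm_sum_def lookup_sum const_poly_mult perm_monomial_eq scale_single
    by (intro sum.cong) (auto simp: lookup_single when_def dest: perm_exponents_inj[OF _ assms])
  then show ?thesis using assms by (simp add: finite_permutations)
qed

lemma tl_immanant_eq: "tl_immanant n w = perm_sum n (tl_coefficient n w)"
  by (simp add: tl_immanant_def perm_sum_def)

lemma of_int_matrix_poly: "(of_int k :: matrix_poly) = const_poly (of_int k)"
  by (simp add: const_poly_def single_of_int)

lemma percent_immanant_eq:
  "percent_immanant n l m = perm_sum n (\<lambda>u. if lies_in n l m u then of_int (sign u) else 0)"
proof -
  have "perm_sum n (\<lambda>u. if lies_in n l m u then of_int (sign u) else 0) =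
      (\<Sum>u | u permutes {1..n}. if lies_in n l m u then of_int (sign u) * perm_monomial n u else 0)"
    unfolding perm_sum_def by (intro sum.cong) (auto simp: of_int_matrix_poly, auto simp: const_poly_def)
  also have "\<dots> = percent_immanant n l m"
    unfolding percent_immanant_def
    by (subst sum.inter_filter[symmetric]) (auto simp: finite_permutations intro!: sum.cong)
  finally show ?thesis by simp
qed

lemma perm_sum_add: "perm_sum n c + perm_sum n d = perm_sum n (\<lambda>u. c u + d u)"
  unfolding perm_sum_def sum.distrib[symmetric]
  by (simp add: const_poly_def single_add distrib_right)

lemma perm_sum_cong: "(\<And>u. u permutes {1..n} \<Longrightarrow> c u = d u) \<Longrightarrow> perm_sum n c = perm_sum n d"
  unfolding perm_sum_def by (intro sum.cong) auto

lemma of_int_mult_perm_sum: "of_int k * perm_sum n c = perm_sum n (\<lambda>u. of_int k * c u)"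
proof -
  have "of_int k * (const_poly a * p) = const_poly (of_int k * a) * p" for a p
    unfolding of_int_matrix_poly mult.assoc[symmetric] const_poly_def mult_single by simp
  then show ?thesis by (simp add: perm_sum_def sum_distrib_left)
qed

section \<open>Linear combinations of percent immanants\<close>

text \<open>Multiplied by the sign of u, the coefficient of a percent immanant at x_u is 1 or 0
  according to whether u lies in the shape.\<close>

lemma linear_combination_invariant:
  assumes lin: "is_linear_combination (tl_immanant n w) (percent_immanants n)"
    and u: "u permutes {1..n}" and v: "v permutes {1..n}"
    and same: "\<And>l m. skew_shape n l m \<Longrightarrow> lies_in n l m u \<longleftrightarrow> lies_in n l m v"
  shows "tl_dual n w u = tl_dual n w v"
proof -
  obtain T c where T: "T \<subseteq> percent_immanants n"
      "tl_immanant n w = (\<Sum>p\<in>T. const_poly (c p) * p)"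
    using lin unfolding is_linear_combination_def by blast
  have dual: "tl_dual n w x = (\<Sum>p\<in>T. c p *
      (of_int (sign x) * Poly_Mapping.lookup p (perm_exponents n x)))" if "x permutes {1..n}" for x
  proof -
    have "tl_coefficient n w x = Poly_Mapping.lookup (tl_immanant n w) (perm_exponents n x)"
      unfolding tl_immanant_eq lookup_perm_sum[OF that] ..
    also have "\<dots> = (\<Sum>p\<in>T. c p * Poly_Mapping.lookup p (perm_exponents n x))"
      unfolding T(2) lookup_sum const_poly_mult lookup_scale ..
    finally show ?thesis by (simp add: tl_dual_def sum_distrib_left mult_ac)
  qed
  have "of_int (sign u) * Poly_Mapping.lookup p (perm_exponents n u) =
      (of_int (sign v) * Poly_Mapping.lookup p (perm_exponents n v) :: complex)" if pT: "p \<in> T" for p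
  proof -
    obtain l m where "skew_shape n l m" "p = percent_immanant n l m"
      using subsetD[OF T(1) pT] unfolding percent_immanants_def by blast
    then show ?thesis
      using same[of l m] sign_sq[of u 1] sign_sq[of v 1]
      by (simp add: percent_immanant_eq lookup_perm_sum u v)
  qed
  then show ?thesis by (simp add: dual u v)
qed

text \<open>A skew shape that contains the points of u in the rows a and d contains the rectangle
  they span, as \<open>m k \<le> m a < u a\<close> and \<open>u d \<le> l d \<le> l k\<close> for
  the rows k between them. Two points framed in this way can be exchanged without leaving the shape;
  all pattern arguments rest on this.\<close>

lemma lies_in_transpose:
  assumes shape: "skew_shape n l m" and u: "lies_in n l m u"
    and a: "1 \<le> a" "a < x" "u a < u x" "u a < u y" and xy: "x < y"
    and d: "y < d" "d \<le> n" "u x < u d" "u y < u d"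
  shows "lies_in n l m (u \<circ> Transposition.transpose x y)"
proof -
  have mono: "m j \<le> m i" "l j \<le> l i" if "1 \<le> i" "i \<le> j" "j \<le> n" for i j
    using shape that by (auto simp: skew_shape_def monotone_on_def)
  have inside: "m k < v \<and> v \<le> l k" if "a \<le> k" "k \<le> d" "u a \<le> v" "v \<le> u d" for k v
  proof -
    have "m k \<le> m a" "l d \<le> l k" using mono that a d by auto
    moreover have "m a < u a" "u d \<le> l d" using u a xy d by (auto simp: lies_in_def)
    ultimately show ?thesis using that by linarith
  qed
  have "m k < (u \<circ> Transposition.transpose x y) k \<and> (u \<circ> Transposition.transpose x y) k \<le> l k"
    if "k \<in> {1..n}" for k
  proof (cases "k = x \<or> k = y")
    case True
    then show ?thesis using inside[of k "u x"] inside[of k "u y"] a xy d by auto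
  next
    case False
    then show ?thesis using u that by (auto simp: lies_in_def Transposition.transpose_def)
  qed
  then show ?thesis by (simp add: lies_in_def)
qed

lemma lies_in_transpose_iff:
  assumes "skew_shape n l m" "1 \<le> a" "a < x" "x < y" "y < d" "d \<le> n"
    "u a < u x" "u a < u y" "u x < u d" "u y < u d"
  shows "lies_in n l m (u \<circ> Transposition.transpose x y) \<longleftrightarrow> lies_in n l m u"
proof
  let ?v = "u \<circ> Transposition.transpose x y"
  assume "lies_in n l m ?v"
  then have "lies_in n l m (?v \<circ> Transposition.transpose x y)"
    by (rule lies_in_transpose[OF assms(1), where a = a and d = d])
      (use assms in \<open>auto simp: Transposition.transpose_def\<close>)
  then show "lies_in n l m u" by (simp add: o_assoc[symmetric] del: comp_apply)
qed (rule lies_in_transpose[OF assms(1), where a = a and d = d], use assms in auto)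

text \<open>The rank at (a, b) is larger for u than for w: everything counted for w is counted for
  u, and position k is counted in addition.\<close>

lemma not_bruhat_leI:
  assumes "\<And>k. k \<le> a \<Longrightarrow> w k \<le> b \<Longrightarrow> u k \<le> b" "k \<le> a" "u k \<le> b" "b < w k"
  shows "\<not> bruhat_le w u"
proof -
  have "{k. k \<le> a \<and> w k \<le> b} \<subset> {k. k \<le> a \<and> u k \<le> b}"
    using assms by (auto simp: psubset_eq set_eq_iff intro!: exI[of _ k])
  then have "rank_count w a b < rank_count u a b"
    unfolding rank_count_def by (intro psubset_card_mono) auto
  then show ?thesis unfolding bruhat_le_def by (metis not_le)
qed

section \<open>Exclusion of the five patterns\<close>

locale shape_invariant =
  fixes n :: nat and w :: "nat \<Rightarrow> nat"
  assumes avoider: "w \<in> avoiders_321 n"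
    and invariant: "\<And>u v. u permutes {1..n} \<Longrightarrow> v permutes {1..n} \<Longrightarrow>
      (\<And>l m. skew_shape n l m \<Longrightarrow> lies_in n l m u \<longleftrightarrow> lies_in n l m v) \<Longrightarrow> tl_dual n w u = tl_dual n w v"
begin

lemma w_permutes: "w permutes {1..n}"
  using avoider by (simp add: avoiders_321_iff)

lemma dual_nonzero: "tl_dual n w w \<noteq> 0"
  using tl_dual_self[OF avoider] by (simp add: sign_def)

lemma dual_zero: "u permutes {1..n} \<Longrightarrow> \<not> bruhat_le w u \<Longrightarrow> tl_dual n w u = 0"
  using tl_dual_bruhat_le[OF avoider] by blast

lemma dual_transpose:
  assumes "u permutes {1..n}" "1 \<le> a" "a < x" "x < y" "y < d" "d \<le> n"
    "u a < u x" "u a < u y" "u x < u d" "u y < u d"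
  shows "tl_dual n w (u \<circ> Transposition.transpose x y) = tl_dual n w u"
proof (rule invariant)
  show "u \<circ> Transposition.transpose x y permutes {1..n}"
    using assms by (intro permutes_transpose) auto
  show "lies_in n l m (u \<circ> Transposition.transpose x y) \<longleftrightarrow> lies_in n l m u" if "skew_shape n l m" for l m
    by (rule lies_in_transpose_iff[OF that assms(2-)])
qed (rule assms)

text \<open>Exchanging the entries 3 and 2, which are framed by 1 and 4, does not affect membership
  in shapes, but it leads strictly below w, where the dual function vanishes.\<close>

lemma avoids_1324: "avoids_pattern n w [1, 3, 2, 4]"
proof
  assume "contains_pattern n w [1, 3, 2, 4]"
  then obtain a b c d where p: "1 \<le> a" "a < b" "b < c" "c < d" "d \<le> n"
      and v: "w a < w c" "w c < w b" "w b < w d"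
    unfolding contains_1324_iff[OF w_permutes] by blast
  let ?u = "w \<circ> Transposition.transpose b c"
  have "tl_dual n w ?u = tl_dual n w w"
    by (rule dual_transpose[OF w_permutes p]) (use v in auto)
  moreover have "?u permutes {1..n}" using w_permutes p by (intro permutes_transpose) auto
  moreover have "\<not> bruhat_le w ?u"
    by (rule not_bruhat_leI[where a = b and b = "w c" and k = b])
      (use p v in \<open>auto simp: Transposition.transpose_def\<close>)
  ultimately show False using dual_zero dual_nonzero by metis
qed

text \<open>In each of the remaining cases, the defining relation of \<^const>\<open>tl_functional\<close> at three of the
  positions contains two terms that cancel, because they lie in the same shapes, and three terms
  that vanish, because they are not above \<open>w\<close>; the sixth term must then vanish, too.\<close>

lemma relation:
  assumes "u permutes {1..n}" "1 \<le> i" "i < j" "j < k" "k \<le> n"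
    and "tl_dual n w (u \<circ> Transposition.transpose i j \<circ> Transposition.transpose j k) =
        tl_dual n w (u \<circ> Transposition.transpose i j) \<and>
      \<not> bruhat_le w (u \<circ> Transposition.transpose j k) \<and>
      \<not> bruhat_le w (u \<circ> Transposition.transpose j k \<circ> Transposition.transpose i j) \<or>
      tl_dual n w (u \<circ> Transposition.transpose j k \<circ> Transposition.transpose i j) =
        tl_dual n w (u \<circ> Transposition.transpose j k) \<and>
      \<not> bruhat_le w (u \<circ> Transposition.transpose i j) \<and>
      \<not> bruhat_le w (u \<circ> Transposition.transpose i j \<circ> Transposition.transpose j k)"
    and "\<not> bruhat_le w (u \<circ> Transposition.transpose i k)"
  shows "tl_dual n w u = 0"
proof -
  have mem: "i \<in> {1..n}" "j \<in> {1..n}" "k \<in> {1..n}" and ne: "i \<noteq> j" "j \<noteq> k" "i \<noteq> k"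
    using assms by auto
  note p = permutes_transpose[OF assms(1) mem(1,2)] permutes_transpose[OF assms(1) mem(2,3)]
    permutes_transpose[OF assms(1) mem(1,3)]
  note q = permutes_transpose[OF p(1) mem(2,3)] permutes_transpose[OF p(2) mem(1,2)]
  from tl_functionalD[OF tl_functional_tl_dual[OF avoider] assms(1) mem ne] assms(6,7)
  show ?thesis
    using dual_zero[OF p(1)] dual_zero[OF p(2)] dual_zero[OF p(3)] dual_zero[OF q(1)] dual_zero[OF q(2)]
    by (auto simp del: comp_apply)
qed

text \<open>The relation is taken at the entries 4, 1, 3. With 1 moved to the end, the other two are
  framed by 2 and 5, so 24351 and 23451 cancel. Not above w are the arrangements with 1 in second
  place and 23154.\<close>

lemma avoids_24153: "avoids_pattern n w [2, 4, 1, 5, 3]"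
proof
  assume "contains_pattern n w [2, 4, 1, 5, 3]"
  then obtain a b c d e where p: "1 \<le> a" "a < b" "b < c" "c < d" "d < e" "e \<le> n"
      and v: "w c < w a" "w a < w e" "w e < w b" "w b < w d"
    unfolding contains_24153_iff[OF w_permutes] by blast
  let ?bc = "Transposition.transpose b c" and ?ce = "Transposition.transpose c e"
    and ?be = "Transposition.transpose b e"
  have perm: "w \<circ> ?ce permutes {1..n}" using w_permutes p by (intro permutes_transpose) auto
  have 1: "tl_dual n w (w \<circ> ?ce \<circ> ?bc) = tl_dual n w (w \<circ> ?ce)"
    by (rule dual_transpose[OF perm p(1-4)]) (use p v in \<open>auto simp: Transposition.transpose_def\<close>)
  have 2: "\<not> bruhat_le w (w \<circ> ?bc)" "\<not> bruhat_le w (w \<circ> ?bc \<circ> ?ce)"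
    by (rule not_bruhat_leI[where a = b and b = "w c" and k = b];
        use p v in \<open>auto simp: Transposition.transpose_def\<close>)+
  have 3: "\<not> bruhat_le w (w \<circ> ?be)"
    by (rule not_bruhat_leI[where a = b and b = "w e" and k = b])
      (use p v in \<open>auto simp: Transposition.transpose_def\<close>)
  have "tl_dual n w w = 0"
    by (rule relation[OF w_permutes, of b c e]) (use p 1 2 3 in auto)
  then show False using dual_nonzero by simp
qed

text \<open>The relation is taken at the entries 3, 5, 2. With 5 moved to the front, the other two
  are framed by 1 and 4, so 51324 and 51234 cancel.\<close>

lemma avoids_31524: "avoids_pattern n w [3, 1, 5, 2, 4]"
proof
  assume "contains_pattern n w [3, 1, 5, 2, 4]"
  then obtain a b c d e where p: "1 \<le> a" "a < b" "b < c" "c < d" "d < e" "e \<le> n"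
      and v: "w b < w d" "w d < w a" "w a < w e" "w e < w c"
    unfolding contains_31524_iff[OF w_permutes] by blast
  let ?ac = "Transposition.transpose a c" and ?cd = "Transposition.transpose c d"
    and ?ad = "Transposition.transpose a d"
  have perm: "w \<circ> ?ac permutes {1..n}" using w_permutes p by (intro permutes_transpose) auto
  have 1: "tl_dual n w (w \<circ> ?ac \<circ> ?cd) = tl_dual n w (w \<circ> ?ac)"
    by (rule dual_transpose[OF perm, of b c d e]) (use p v in \<open>auto simp: Transposition.transpose_def\<close>)
  have 2: "\<not> bruhat_le w (w \<circ> ?ad)" "\<not> bruhat_le w (w \<circ> ?cd \<circ> ?ac)"
    by (rule not_bruhat_leI[where a = a and b = "w d" and k = a];
        use p v in \<open>auto simp: Transposition.transpose_def\<close>)+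
  have 3: "\<not> bruhat_le w (w \<circ> ?cd)"
    by (rule not_bruhat_leI[where a = c and b = "w d" and k = c])
      (use p v in \<open>auto simp: Transposition.transpose_def\<close>)
  have "tl_dual n w w = 0"
    by (rule relation[OF w_permutes, of a c d]) (use p 1 2 3 in auto)
  then show False using dual_nonzero by simp
qed

text \<open>Exchanging 3 and 5, framed by 2 and 6, keeps the dual value and gives 251364. Its
  entries 2, 5, 1, 6, 4 form a 24153 to which the argument for that pattern is applied, with Bruhat
  comparisons still made against w.\<close>

lemma avoids_231564: "avoids_pattern n w [2, 3, 1, 5, 6, 4]"
proof
  assume "contains_pattern n w [2, 3, 1, 5, 6, 4]"
  then obtain a b c d e f where p: "1 \<le> a" "a < b" "b < c" "c < d" "d < e" "e < f" "f \<le> n"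
      and v: "w c < w a" "w a < w b" "w b < w f" "w f < w d" "w d < w e"
    unfolding contains_231564_iff[OF w_permutes] by blast
  let ?x = "w \<circ> Transposition.transpose b d"
  let ?bc = "Transposition.transpose b c" and ?cf = "Transposition.transpose c f"
    and ?bf = "Transposition.transpose b f"
  have x: "?x permutes {1..n}" using w_permutes p by (intro permutes_transpose) auto
  have "tl_dual n w ?x = tl_dual n w w"
    by (rule dual_transpose[OF w_permutes, of a b d e]) (use p v in auto)
  moreover have perm: "?x \<circ> ?cf permutes {1..n}" by (rule permutes_transpose[OF x]) (use p in auto)
  have 1: "tl_dual n w (?x \<circ> ?cf \<circ> ?bc) = tl_dual n w (?x \<circ> ?cf)"
    by (rule dual_transpose[OF perm, of a b c e]) (use p v in \<open>auto simp: Transposition.transpose_def\<close>)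
  have 2: "\<not> bruhat_le w (?x \<circ> ?bc)" "\<not> bruhat_le w (?x \<circ> ?bc \<circ> ?cf)"
    by (rule not_bruhat_leI[where a = b and b = "w c" and k = b];
        use p v in \<open>auto simp: Transposition.transpose_def\<close>)+
  have 3: "\<not> bruhat_le w (?x \<circ> ?bf)"
    by (rule not_bruhat_leI[where a = d and b = "w f" and k = d])
      (use p v in \<open>auto simp: Transposition.transpose_def split: if_splits\<close>)
  have "tl_dual n w ?x = 0"
    by (rule relation[OF x, of b c f]) (use p 1 2 3 in auto)
  ultimately show False using dual_nonzero by simp
qed

text \<open>Exchanging 2 and 4, framed by 1 and 5, gives 314625 with the same dual value. Its
  entries 3, 1, 6, 2, 5 form a 31524.\<close>

lemma avoids_312645: "avoids_pattern n w [3, 1, 2, 6, 4, 5]"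
proof
  assume "contains_pattern n w [3, 1, 2, 6, 4, 5]"
  then obtain a b c d e f where p: "1 \<le> a" "a < b" "b < c" "c < d" "d < e" "e < f" "f \<le> n"
      and v: "w b < w c" "w c < w a" "w a < w e" "w e < w f" "w f < w d"
    unfolding contains_312645_iff[OF w_permutes] by blast
  let ?x = "w \<circ> Transposition.transpose c e"
  let ?ad = "Transposition.transpose a d" and ?de = "Transposition.transpose d e"
    and ?ae = "Transposition.transpose a e"
  have x: "?x permutes {1..n}" using w_permutes p by (intro permutes_transpose) auto
  have "tl_dual n w ?x = tl_dual n w w"
    by (rule dual_transpose[OF w_permutes, of b c e f]) (use p v in auto)
  moreover have perm: "?x \<circ> ?ad permutes {1..n}" by (rule permutes_transpose[OF x]) (use p in auto)
  have 1: "tl_dual n w (?x \<circ> ?ad \<circ> ?de) = tl_dual n w (?x \<circ> ?ad)"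
    by (rule dual_transpose[OF perm, of b d e f]) (use p v in \<open>auto simp: Transposition.transpose_def\<close>)
  have 2: "\<not> bruhat_le w (?x \<circ> ?ae)" "\<not> bruhat_le w (?x \<circ> ?de \<circ> ?ad)"
    by (rule not_bruhat_leI[where a = a and b = "w c" and k = a];
        use p v in \<open>auto simp: Transposition.transpose_def\<close>)+
  have 3: "\<not> bruhat_le w (?x \<circ> ?de)"
    by (rule not_bruhat_leI[where a = d and b = "w e" and k = d])
      (use p v in \<open>auto simp: Transposition.transpose_def split: if_splits\<close>)
  have "tl_dual n w ?x = 0"
    by (rule relation[OF x, of a d e]) (use p 1 2 3 in auto)
  ultimately show False using dual_nonzero by simp
qed

end

section \<open>Annihilated basis elements\<close>

lemma reduced_words_action:
  assumes "\<not> has_321 w" "reduced_word n w x" "reduced_word n w y" "tl_functional n h"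
  shows "word_action x h id = word_action y h id"
proof -
  have "Poly_Mapping.single x 1 - Poly_Mapping.single y 1 \<in> annihilator n"
    using tl_reduces_tl_ideal[OF reduced_words_equivalent[OF assms(1-3)]] tl_ideal_subset_annihilator by blast
  then have "poly_action (Poly_Mapping.single x 1 - Poly_Mapping.single y 1) h id = 0"
    using assms(4) permutes_id unfolding annihilator_def by blast
  then show ?thesis by (simp add: poly_action_diff)
qed

lemma basis_word_action_eq:
  assumes "v \<in> avoiders_321 n" "reduced_word n v x" "tl_functional n h"
  shows "word_action (basis_word n v) h id = word_action x h id"
  using assms by (intro reduced_words_action[of v n] reduced_basis_word) (auto simp: avoiders_321_iff)

text \<open>The reduced word can be chosen to end in i, and its last factor 1 - s_i already kills
  h.\<close>

lemma basis_word_action_right_invariant: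
  assumes v: "v \<in> avoiders_321 n" and h: "tl_functional n h" and desc: "v (Suc i) < v i"
    and inv: "\<And>u. u permutes {1..n} \<Longrightarrow> h (u \<circ> simple_transposition i) = h u"
  shows "word_action (basis_word n v) h id = 0"
proof -
  have vp: "v permutes {1..n}" using v by (simp add: avoiders_321_iff)
  have i: "i \<in> {1..<n}" by (rule descent_range[OF vp desc])
  obtain z where z: "reduced_word n (v \<circ> simple_transposition i) z"
    using exists_reduced_word[OF permutes_compose[OF simple_transposition_permutes[OF i] vp]] by blast
  have "word_action (basis_word n v) h id = word_action (z @ [i]) h id"
    by (rule basis_word_action_eq[OF v reduced_word_snocI[OF vp desc i z] h])
  also have "\<dots> = word_action z (word_action [i] h) id" by (rule word_action_append)
  also have "\<dots> = 0"
    by (rule word_action_zero[where n = n]) (use z inv in \<open>auto simp: reduced_word_iff permutes_id simp del: id_apply\<close>)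
  finally show ?thesis .
qed

text \<open>A descent of the inverse gives a reduced word that begins with i. Evaluated at the
  identity, s_i can be moved to the far left, where h ignores it, so the two terms of the first
  factor cancel.\<close>

lemma basis_word_action_left_invariant:
  assumes v: "v \<in> avoiders_321 n" and h: "tl_functional n h"
    and desc: "Hilbert_Choice.inv v (Suc i) < Hilbert_Choice.inv v i"
    and inv: "\<And>u. u permutes {1..n} \<Longrightarrow> h (simple_transposition i \<circ> u) = h u"
  shows "word_action (basis_word n v) h id = 0"
proof -
  have vp: "v permutes {1..n}" and ip: "Hilbert_Choice.inv v permutes {1..n}"
    using v permutes_inv by (auto simp: avoiders_321_iff)
  have i: "i \<in> {1..<n}" by (rule descent_range[OF ip desc])
  obtain z where "reduced_word n (Hilbert_Choice.inv v \<circ> simple_transposition i) z"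
    using exists_reduced_word[OF permutes_compose[OF simple_transposition_permutes[OF i] ip]] by blast
  from reduced_word_rev[OF reduced_word_snocI[OF ip desc i this]]
  have red: "reduced_word n v (i # rev z)" by (simp add: permutes_inv_inv[OF vp])
  then have z: "rev z \<in> lists {1..<n}" by (simp add: reduced_word_iff)
  have "word_action (rev z) h (id \<circ> simple_transposition i) =
      word_action (rev z) (\<lambda>u. h (simple_transposition i \<circ> u)) id"
    unfolding word_action_left_translate by (simp only: id_comp comp_id)
  also have "\<dots> = word_action (rev z) h id"
    by (rule word_action_cong[OF inv z permutes_id])
  finally have "word_action (i # rev z) h id = 0" by (simp del: id_apply)
  then show ?thesis using basis_word_action_eq[OF v red h] by simp
qed

lemma word_action_diff:
  "word_action x (\<lambda>u. h u - g u) u = word_action x h u - word_action x g u"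
  by (induction x arbitrary: u) auto

text \<open>Inversion turns right factors into left ones and reverses their order. The induction
  runs over all h, into which each left factor is absorbed.\<close>

lemma word_action_rev_inv:
  assumes "x \<in> lists {1..<n}" and u: "u permutes {1..n}"
  shows "word_action (rev x) (\<lambda>v. h (Hilbert_Choice.inv v)) u =
    word_action x (\<lambda>v. h (v \<circ> Hilbert_Choice.inv u)) id"
  using assms(1)
proof (induction x arbitrary: h)
  case (Cons i x)
  then have i: "i \<in> {1..<n}" and x: "x \<in> lists {1..<n}" by auto
  let ?s = "simple_transposition i"
  have "word_action (rev (i # x)) (\<lambda>v. h (Hilbert_Choice.inv v)) u =
      word_action (rev x) (word_action [i] (\<lambda>v. h (Hilbert_Choice.inv v))) u"
    by (simp add: word_action_append)
  also have "\<dots> = word_action (rev x) (\<lambda>v. h (Hilbert_Choice.inv v) - h (?s \<circ> Hilbert_Choice.inv v)) u"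
  proof (rule word_action_cong[where n = n])
    fix v assume "v permutes {1..n}"
    then have "Hilbert_Choice.inv (v \<circ> ?s) = ?s \<circ> Hilbert_Choice.inv v"
      by (simp add: o_inv_distrib permutes_bij)
    then show "word_action [i] (\<lambda>v. h (Hilbert_Choice.inv v)) v =
        h (Hilbert_Choice.inv v) - h (?s \<circ> Hilbert_Choice.inv v)"
      by simp
  qed (use x u in auto)
  also have "\<dots> = word_action x (\<lambda>v. h (v \<circ> Hilbert_Choice.inv u)
      - h (?s \<circ> (v \<circ> Hilbert_Choice.inv u))) id"
    by (rule Cons.IH)
  also have "\<dots> = word_action x (\<lambda>v. h (v \<circ> Hilbert_Choice.inv u)) id -
      word_action x (\<lambda>v. h ((?s \<circ> v) \<circ> Hilbert_Choice.inv u)) id"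
    by (simp only: word_action_diff o_assoc)
  also have "word_action x (\<lambda>v. h ((?s \<circ> v) \<circ> Hilbert_Choice.inv u)) id =
      word_action x (\<lambda>v. h (v \<circ> Hilbert_Choice.inv u)) (?s \<circ> id)"
    by (rule word_action_left_translate)
  finally show ?case by (simp only: word_action.simps id_comp comp_id)
qed (simp only: rev.simps word_action.simps id_comp)

section \<open>Block shapes\<close>

text \<open>The classes are numbered from left to right, so that different classes also compare
  their members.\<close>

definition block_class :: "nat \<Rightarrow> nat \<Rightarrow> nat \<Rightarrow> nat \<Rightarrow> nat"
  where "block_class n a z i = (if i \<le> a then 0 else if n - z < i then 2 else 1)"

lemma block_class_mono: "i \<le> j \<Longrightarrow> block_class n a z i \<le> block_class n a z j"
  by (auto simp: block_class_def)

lemma block_class_cases: "block_class n a z i = 0 \<or> block_class n a z i = 1 \<or> block_class n a z i = 2"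
  by (auto simp: block_class_def)

definition block_increasing :: "nat \<Rightarrow> nat \<Rightarrow> nat \<Rightarrow> (nat \<Rightarrow> nat) \<Rightarrow> bool"
  where "block_increasing n a z u \<longleftrightarrow>
    (\<forall>i j. 1 \<le> i \<longrightarrow> i < j \<longrightarrow> j \<le> n \<longrightarrow> block_class n a z i = block_class n a z j \<longrightarrow> u i < u j)"

lemma block_increasingD:
  "block_increasing n a z u \<Longrightarrow> i \<in> {1..n} \<Longrightarrow> j \<in> {1..n} \<Longrightarrow> i < j \<Longrightarrow>
    block_class n a z i = block_class n a z j \<Longrightarrow> u i < u j"
  by (auto simp: block_increasing_def)

lemma block_increasing_if_ascents:
  assumes "\<And>i. i \<in> {1..<n} \<Longrightarrow> block_class n a z i = block_class n a z (Suc i) \<Longrightarrow> u i < u (Suc i)"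
  shows "block_increasing n a z u"
  unfolding block_increasing_def
proof (intro allI impI)
  fix i j assume ij: "1 \<le> i" "i < j" "j \<le> n" "block_class n a z i = block_class n a z j"
  have "\<forall>k\<in>{i..<j}. u k < u (Suc k)"
  proof
    fix k assume k: "k \<in> {i..<j}"
    then have "block_class n a z i \<le> block_class n a z k" "block_class n a z k \<le> block_class n a z (Suc k)"
        "block_class n a z (Suc k) \<le> block_class n a z j"
      by (auto intro!: block_class_mono)
    then show "u k < u (Suc k)" using ij k by (intro assms) auto
  qed
  then show "u i < u j" by (rule ascents_imp_less) (use ij in auto)
qed

locale blocks =
  fixes n b c r s :: nat
  assumes rows_le: "b + r \<le> n" and cols_le: "c + s \<le> n"
begin

abbreviation row :: "nat \<Rightarrow> nat" where "row \<equiv> block_class n b r"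
abbreviation col :: "nat \<Rightarrow> nat" where "col \<equiv> block_class n c s"

definition in_cells :: "(nat \<Rightarrow> nat \<Rightarrow> bool) \<Rightarrow> (nat \<Rightarrow> nat) \<Rightarrow> bool"
  where "in_cells ok u \<longleftrightarrow> (\<forall>i\<in>{1..n}. ok (row i) (col (u i)))"

lemma in_cellsD: "in_cells ok u \<Longrightarrow> i \<in> {1..n} \<Longrightarrow> ok (row i) (col (u i))"
  by (simp add: in_cells_def)

lemma in_cells_right:
  assumes "i \<in> {1..n}" "j \<in> {1..n}" "row i = row j"
  shows "in_cells ok (u \<circ> Transposition.transpose i j) \<longleftrightarrow> in_cells ok u"
proof -
  have imp: "in_cells ok (v \<circ> Transposition.transpose i j)" if "in_cells ok v" for v
    unfolding in_cells_def
  proof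
    fix x assume x: "x \<in> {1..n}"
    then have "Transposition.transpose i j x \<in> {1..n}" "row (Transposition.transpose i j x) = row x"
      using assms by (auto simp: Transposition.transpose_def)
    then show "ok (row x) (col ((v \<circ> Transposition.transpose i j) x))"
      using in_cellsD[OF that, of "Transposition.transpose i j x"] by simp
  qed
  from imp[of u] imp[of "u \<circ> Transposition.transpose i j"] show ?thesis
    by (auto simp: o_assoc[symmetric] simp del: comp_apply)
qed

lemma in_cells_left:
  assumes "col p = col q"
  shows "in_cells ok (Transposition.transpose p q \<circ> u) \<longleftrightarrow> in_cells ok u"
proof -
  have "col (Transposition.transpose p q x) = col x" for x
    using assms by (auto simp: Transposition.transpose_def)
  then show ?thesis by (simp add: in_cells_def)
qed

lemma in_cells_inv:
  assumes "u permutes {1..n}"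
  shows "blocks.in_cells n c b s r (\<lambda>p q. ok q p) (Hilbert_Choice.inv u) \<longleftrightarrow> in_cells ok u"
proof -
  interpret swapped: blocks n c b s r using rows_le cols_le by unfold_locales
  have "in_cells ok u \<longleftrightarrow> (\<forall>j\<in>{1..n}. ok (row (Hilbert_Choice.inv u j)) (col (u (Hilbert_Choice.inv u j))))"
    unfolding in_cells_def
  proof safe
    fix j assume "\<forall>i\<in>{1..n}. ok (row i) (col (u i))" "j \<in> {1..n}"
    then show "ok (row (Hilbert_Choice.inv u j)) (col (u (Hilbert_Choice.inv u j)))"
      using permutes_mem[OF permutes_inv[OF assms]] by blast
  next
    fix i assume "\<forall>j\<in>{1..n}. ok (row (Hilbert_Choice.inv u j)) (col (u (Hilbert_Choice.inv u j)))" "i \<in> {1..n}"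
    then have "ok (row (Hilbert_Choice.inv u (u i))) (col (u (Hilbert_Choice.inv u (u i))))"
      using permutes_mem[OF assms] by blast
    then show "ok (row i) (col (u i))" by (simp add: permutes_inverses[OF assms])
  qed
  then show ?thesis by (simp add: swapped.in_cells_def permutes_inverses[OF assms])
qed

definition corner_ok :: "nat \<Rightarrow> nat \<Rightarrow> bool"
  where "corner_ok p q \<longleftrightarrow> \<not> (p = 0 \<and> q = 0) \<and> \<not> (p = 2 \<and> q = 2)"

text \<open>On three distinct classes the corner shape admits the reversal and two 3-cycles, one
  through the cells (0,1), (1,2), the other through (1,0), (2,1). To drop the 3-cycles and keep the
  reversal, one cell of each pair is forbidden. In the intended use \<open>b = 1 \<or> s = 1\<close>
  and \<open>c = 1 \<or> r = 1\<close>, and each choice falls on a cell with a singleton row or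
  column class, so that points outside the three chosen rows are not affected.\<close>

definition narrow_ok :: "nat \<Rightarrow> nat \<Rightarrow> bool"
  where "narrow_ok p q \<longleftrightarrow> corner_ok p q \<and>
    (if b = 1 then \<not> (p = 0 \<and> q = 1) else \<not> (p = 1 \<and> q = 2)) \<and>
    (if c = 1 then \<not> (p = 1 \<and> q = 0) else \<not> (p = 2 \<and> q = 1))"

subsection \<open>Block shapes are skew shapes\<close>

lemma shape_of_classes:
  assumes mono: "m 1 \<le> m 0" "m 2 \<le> m 1" "l 1 \<le> l 0" "l 2 \<le> l 1"
    and bounds: "m 0 \<le> l 0" "m 1 \<le> l 1" "m 2 \<le> l 2" "l 0 \<le> n"
    and cell: "\<And>p q. p \<in> {0, 1, 2} \<Longrightarrow> q \<in> {1..n} \<Longrightarrow> m p < q \<and> q \<le> l p \<longleftrightarrow> ok p (col q)"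
  shows "\<exists>l m. skew_shape n l m \<and> (\<forall>u. u permutes {1..n} \<longrightarrow> lies_in n l m u = in_cells ok u)"
proof (intro exI conjI allI impI)
  have row: "row i \<in> {0, 1, 2}" for i using block_class_cases[of n b r i] by blast
  have "m (row j) \<le> m (row i)" "l (row j) \<le> l (row i)" if "i \<le> j" for i j
    using block_class_mono[OF that, of n b r] block_class_cases[of n b r i] block_class_cases[of n b r j] mono
    by (elim disjE; force)+
  moreover have "m (row i) \<le> l (row i)" "l (row i) \<le> n" for i
    using row[of i] mono bounds by (elim insertE; force)+
  ultimately show "skew_shape n (\<lambda>i. l (row i)) (\<lambda>i. m (row i))"
    by (auto simp: skew_shape_def monotone_on_def)
  fix u assume u: "u permutes {1..n}"
  show "lies_in n (\<lambda>i. l (row i)) (\<lambda>i. m (row i)) u = in_cells ok u"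
    unfolding lies_in_def in_cells_def
    by (rule ball_cong[OF HOL.refl], rule cell[OF row permutes_mem[OF u]])
qed

lemma corner_shape:
  "\<exists>l m. skew_shape n l m \<and> (\<forall>u. u permutes {1..n} \<longrightarrow> lies_in n l m u = in_cells corner_ok u)"
  by (rule shape_of_classes[where m = "\<lambda>p. if p = 0 then c else 0" and l = "\<lambda>p. if p = 2 then n - s else n"])
    (use rows_le cols_le in \<open>auto simp: corner_ok_def block_class_def\<close>)

lemma narrow_shape:
  "\<exists>l m. skew_shape n l m \<and> (\<forall>u. u permutes {1..n} \<longrightarrow> lies_in n l m u = in_cells narrow_ok u)"
proof (rule shape_of_classes)
  \<comment> \<open>The bounds cut off the corners and the two cells selected by the conditionals of
    \<open>narrow_ok\<close>.\<close>
  let ?m = "\<lambda>p. if p = 0 then (if b = 1 then n - s else c) else if p = 1 \<and> c = 1 then c else 0"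
  let ?l = "\<lambda>p. if p = 2 then (if c = 1 then n - s else c) else if p = 1 \<and> b \<noteq> 1 then n - s else n"
  have cs: "c \<le> n - s" using cols_le by simp
  show "?m p < q \<and> q \<le> ?l p \<longleftrightarrow> narrow_ok p (col q)" if "p \<in> {0, 1, 2}" "q \<in> {1..n}" for p q :: nat
    using that cs by (elim insertE; simp add: narrow_ok_def corner_ok_def block_class_def)
qed (use cols_le in auto)

subsection \<open>The permutations in a block shape\<close>

lemma in_cells_corner_iff:
  "in_cells corner_ok u \<longleftrightarrow> (\<forall>i\<in>{1..n}. \<not> (i \<le> b \<and> u i \<le> c) \<and> \<not> (n - r < i \<and> n - s < u i))"
  unfolding in_cells_def corner_ok_def block_class_def using rows_le cols_le
  by (intro ball_cong HOL.refl) auto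

text \<open>The corner shape is an upper set: the number of points in the upper left corner is a
  rank up to the fixed position 0, the number in the lower right corner is a rank up to a constant,
  and ranks decrease upwards.\<close>

lemma in_cells_corner_bruhat:
  assumes u: "u permutes {1..n}" and v: "v permutes {1..n}" and le: "bruhat_le u v"
    and cells: "in_cells corner_ok u"
  shows "in_cells corner_ok v"
proof -
  have zero: "w 0 = 0" if "w permutes {1..n}" for w using that by (auto intro: permutes_not_in)
  have rank: "rank_count v x y \<le> rank_count u x y" for x y using le by (simp add: bruhat_le_def)
  have nw: "\<not> (i \<le> b \<and> v i \<le> c)" if "i \<in> {1..n}" for i
  proof
    assume i: "i \<le> b \<and> v i \<le> c"
    have "{k. k \<le> b \<and> u k \<le> c} \<subseteq> {0}"
    proof
      fix k assume "k \<in> {k. k \<le> b \<and> u k \<le> c}"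
      then show "k \<in> {0}" using cells rows_le unfolding in_cells_corner_iff by (cases "k = 0") auto
    qed
    then have "rank_count u b c \<le> 1"
      unfolding rank_count_def by (metis card.empty card_insert_disjoint card_mono empty_iff finite.emptyI finite.insertI One_nat_def)
    moreover have "card {0, i} \<le> rank_count v b c"
      unfolding rank_count_def by (intro card_mono) (use i zero[OF v] in auto)
    ultimately show False using rank[of b c] that by auto
  qed
  \<comment> \<open>Inclusion-exclusion over the positions 0, ..., n; each summand 1 accounts for
    the fixed position 0.\<close>
  have corner: "card {k. k \<le> n \<and> n - r < k \<and> n - s < w k} + (n - r + 1) + (n - s + 1) =
      (n + 1) + rank_count w (n - r) (n - s)" if w: "w permutes {1..n}" for w
  proof -
    let ?A = "{k. k \<le> n - r}" and ?B = "{k. k \<le> n \<and> w k \<le> n - s}"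
      and ?Q = "{k. k \<le> n \<and> n - r < k \<and> n - s < w k}"
    have "w ` ?B = {..n - s}"
    proof
      show "{..n - s} \<subseteq> w ` ?B"
      proof
        fix q assume q: "q \<in> {..n - s}"
        have w': "Hilbert_Choice.inv w permutes {1..n}" by (rule permutes_inv[OF w])
        have "Hilbert_Choice.inv w q \<le> n"
          using q permutes_mem[OF w', of q] permutes_not_in[OF w', of q] by (cases "q \<in> {1..n}") auto
        then show "q \<in> w ` ?B" using q permutes_inverses[OF w]
          by (intro image_eqI[of _ _ "Hilbert_Choice.inv w q"]) auto
      qed
    qed auto
    then have B: "card ?B = n - s + 1"
      using card_image[OF inj_on_subset[OF permutes_inj[OF w] subset_UNIV], of ?B] by simp
    have AB: "?A \<inter> ?B = {k. k \<le> n - r \<and> w k \<le> n - s}" by auto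
    have "card {..n} = card ((?A \<union> ?B) \<union> ?Q)" by (rule arg_cong[where f = card]) auto
    also have "\<dots> = card (?A \<union> ?B) + card ?Q" by (intro card_Un_disjoint) auto
    finally have 1: "n + 1 = card (?A \<union> ?B) + card ?Q" by simp
    have 2: "card ?A + card ?B = card (?A \<union> ?B) + rank_count w (n - r) (n - s)"
      unfolding rank_count_def AB[symmetric] by (rule card_Un_Int) auto
    have 3: "card ?A = n - r + 1" by (simp add: atMost_def[symmetric])
    show ?thesis using 1 2 3 B by linarith
  qed
  have "{k. k \<le> n \<and> n - r < k \<and> n - s < u k} = {}"
    using cells unfolding in_cells_corner_iff by force
  then have "card {k. k \<le> n \<and> n - r < k \<and> n - s < u k} = 0" by (simp only: card.empty)
  then have "card {k. k \<le> n \<and> n - r < k \<and> n - s < v k} = 0"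
    using corner[OF u] corner[OF v] rank[of "n - r" "n - s"] by linarith
  then have "{k. k \<le> n \<and> n - r < k \<and> n - s < v k} = {}" by simp
  then show ?thesis using nw unfolding in_cells_corner_iff by force
qed

definition cell_count :: "(nat \<Rightarrow> nat) \<Rightarrow> nat \<Rightarrow> nat \<Rightarrow> nat"
  where "cell_count u p q = card {i \<in> {1..n}. row i = p \<and> col (u i) = q}"

lemma cell_count_col:
  assumes "u permutes {1..n}"
  shows "cell_count u 0 q + cell_count u 1 q + cell_count u 2 q = card {j \<in> {1..n}. col j = q}"
proof -
  let ?S = "\<lambda>p. {i \<in> {1..n}. row i = p \<and> col (u i) = q}"
  have "card (u ` (?S 0 \<union> ?S 1 \<union> ?S 2)) = card (?S 0 \<union> ?S 1 \<union> ?S 2)"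
    by (intro card_image inj_on_subset[OF permutes_inj[OF assms]]) auto
  also have "u ` (?S 0 \<union> ?S 1 \<union> ?S 2) = {j \<in> {1..n}. col j = q}"
  proof
    show "{j \<in> {1..n}. col j = q} \<subseteq> u ` (?S 0 \<union> ?S 1 \<union> ?S 2)"
    proof
      fix j assume j: "j \<in> {j \<in> {1..n}. col j = q}"
      then have "Hilbert_Choice.inv u j \<in> {1..n}" "u (Hilbert_Choice.inv u j) = j"
        using permutes_mem[OF permutes_inv[OF assms]] permutes_inverses[OF assms] by auto
      then show "j \<in> u ` (?S 0 \<union> ?S 1 \<union> ?S 2)"
        using j block_class_cases[of n b r "Hilbert_Choice.inv u j"]
        by (intro image_eqI[of _ _ "Hilbert_Choice.inv u j"]) auto
    qed
  qed (use permutes_mem[OF assms] in auto)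
  also have "card (?S 0 \<union> ?S 1 \<union> ?S 2) = card (?S 0) + card (?S 1) + card (?S 2)"
    by (subst card_Un_disjoint, auto)+
  finally show ?thesis by (simp add: cell_count_def)
qed

lemma down_closed_eq:
  fixes A B R :: "nat set"
  assumes "finite R" "A \<subseteq> R" "B \<subseteq> R" "card A = card B"
    and A: "\<And>x y. x \<in> R \<Longrightarrow> y \<in> A \<Longrightarrow> x < y \<Longrightarrow> x \<in> A"
    and B: "\<And>x y. x \<in> R \<Longrightarrow> y \<in> B \<Longrightarrow> x < y \<Longrightarrow> x \<in> B"
  shows "A = B"
proof -
  have "A \<subseteq> B \<or> B \<subseteq> A"
  proof (rule ccontr)
    assume "\<not> ?thesis"
    then obtain x y where xy: "x \<in> A" "x \<notin> B" "y \<in> B" "y \<notin> A" by blast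
    then have "x \<in> R" "y \<in> R" "x \<noteq> y" using assms(2,3) by auto
    then show False using A[of y x] B[of x y] xy by (cases "x < y") auto
  qed
  moreover have "finite A" "finite B" using assms finite_subset by blast+
  ultimately show ?thesis using assms(4) card_subset_eq by metis
qed

lemma up_closed_eq:
  fixes A B R :: "nat set"
  assumes "finite R" "A \<subseteq> R" "B \<subseteq> R" "card A = card B"
    and A: "\<And>x y. x \<in> R \<Longrightarrow> y \<in> A \<Longrightarrow> y < x \<Longrightarrow> x \<in> A"
    and B: "\<And>x y. x \<in> R \<Longrightarrow> y \<in> B \<Longrightarrow> y < x \<Longrightarrow> x \<in> B"
  shows "A = B"
proof -
  have "A \<subseteq> B \<or> B \<subseteq> A"
  proof (rule ccontr)
    assume "\<not> ?thesis"
    then obtain x y where xy: "x \<in> A" "x \<notin> B" "y \<in> B" "y \<notin> A" by blast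
    then have "x \<in> R" "y \<in> R" "x \<noteq> y" using assms(2,3) by auto
    then show False using A[of y x] B[of x y] xy by (cases "x < y") auto
  qed
  moreover have "finite A" "finite B" using assms finite_subset by blast+
  ultimately show ?thesis using assms(4) card_subset_eq by metis
qed

text \<open>The composite of v with the inverse of u preserves column classes. As both inverses are
  increasing on each class, it is increasing, hence the identity.\<close>

lemma block_perm_eq:
  assumes u: "u permutes {1..n}" and v: "v permutes {1..n}"
    and inc: "block_increasing n c s (Hilbert_Choice.inv u)" "block_increasing n c s (Hilbert_Choice.inv v)"
    and col: "\<And>i. i \<in> {1..n} \<Longrightarrow> col (u i) = col (v i)"
  shows "u = v"
proof -
  let ?iu = "Hilbert_Choice.inv u"
  have iu: "?iu permutes {1..n}" by (rule permutes_inv[OF u])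
  have "v \<circ> ?iu = id"
  proof (rule permutes_increasing_id)
    show "v \<circ> ?iu permutes {1..n}" by (rule permutes_compose[OF iu v])
    fix p q assume pq: "p \<in> {1..n}" "q \<in> {1..n}" "p < q"
    have mem: "?iu p \<in> {1..n}" "?iu q \<in> {1..n}" using pq permutes_mem[OF iu] by auto
    have cls: "col (v (?iu p)) = col p" "col (v (?iu q)) = col q"
      using col[OF mem(1)] col[OF mem(2)] by (simp_all add: permutes_inverses[OF u])
    have vm: "v (?iu p) \<in> {1..n}" "v (?iu q) \<in> {1..n}" using mem permutes_mem[OF v] by auto
    have "v (?iu p) < v (?iu q)"
    proof (rule ccontr)
      assume not: "\<not> v (?iu p) < v (?iu q)"
      then have "col (v (?iu q)) \<le> col (v (?iu p))" by (intro block_class_mono) simp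
      then have same: "col p = col q" using block_class_mono[of p q n c s] pq(3) cls by simp
      have less: "?iu p < ?iu q" by (rule block_increasingD[OF inc(1) pq same])
      have "v (?iu p) \<noteq> v (?iu q)" using less inj_eq[OF permutes_inj[OF v]] by simp
      then have "v (?iu q) < v (?iu p)" using not by simp
      from block_increasingD[OF inc(2) vm(2,1) this] show False
        using less cls same by (simp add: permutes_inverses[OF v])
    qed
    then show "(v \<circ> ?iu) p < (v \<circ> ?iu) q" by simp
  qed
  then have "v \<circ> ?iu \<circ> u = u" by simp
  then show ?thesis using permutes_inv_o(2)[OF u] by (simp add: o_assoc[symmetric] del: comp_apply)
qed

text \<open>The empty corners and the column sums turn the two given counts into all counts in the
  outer columns. Within a block of rows monotonicity puts the points of class 0 first and those of
  class 2 last, so the counts fix the class of every point.\<close>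

lemma block_perm_unique:
  assumes u: "u permutes {1..n}" "in_cells corner_ok u" "block_increasing n b r u"
      "block_increasing n c s (Hilbert_Choice.inv u)"
    and v: "v permutes {1..n}" "in_cells corner_ok v" "block_increasing n b r v"
      "block_increasing n c s (Hilbert_Choice.inv v)"
    and counts: "cell_count u 0 2 = cell_count v 0 2" "cell_count u 2 0 = cell_count v 2 0"
  shows "u = v"
proof (rule block_perm_eq[OF u(1) v(1) u(4) v(4)])
  have empty: "cell_count w 0 0 = 0" "cell_count w 2 2 = 0" if "in_cells corner_ok w" for w
  proof -
    have "{i \<in> {1..n}. row i = 0 \<and> col (w i) = 0} = {}" "{i \<in> {1..n}. row i = 2 \<and> col (w i) = 2} = {}"
      using in_cellsD[OF that] by (auto simp: corner_ok_def)
    then show "cell_count w 0 0 = 0" "cell_count w 2 2 = 0" by (simp_all only: cell_count_def card.empty)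
  qed
  have count: "cell_count u p q = cell_count v p q" if "p = 0 \<or> p = 1 \<or> p = 2" "q = 0 \<or> q = 2" for p q
    using that counts empty[OF u(2)] empty[OF v(2)]
      cell_count_col[OF u(1), of 0] cell_count_col[OF v(1), of 0]
      cell_count_col[OF u(1), of 2] cell_count_col[OF v(1), of 2]
    by auto
  have mono: "col (w x) \<le> col (w y)"
    if "block_increasing n b r w" "x \<in> {1..n}" "y \<in> {1..n}" "row x = row y" "x < y" for w x y
    using block_increasingD[OF that(1-3,5,4)] by (intro block_class_mono) simp
  fix i assume i: "i \<in> {1..n}"
  let ?R = "{k \<in> {1..n}. row k = row i}"
  have card: "card {k \<in> ?R. col (u k) = q} = card {k \<in> ?R. col (v k) = q}" if "q = 0 \<or> q = 2" for q
  proof -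
    have "{k \<in> ?R. col (w k) = q} = {k \<in> {1..n}. row k = row i \<and> col (w k) = q}" for w by auto
    then show ?thesis
      using count[OF block_class_cases that, of n b r i] by (simp only: cell_count_def)
  qed
  have down: "x \<in> {k \<in> ?R. col (w k) = 0}"
    if "block_increasing n b r w" "x \<in> ?R" "y \<in> {k \<in> ?R. col (w k) = 0}" "x < y" for w x y
    using mono[OF that(1), of x y] that by auto
  have up: "x \<in> {k \<in> ?R. col (w k) = 2}"
    if "block_increasing n b r w" "x \<in> ?R" "y \<in> {k \<in> ?R. col (w k) = 2}" "y < x" for w x y
    using mono[OF that(1), of y x] that block_class_cases[of n c s "w x"] by auto
  have low: "{k \<in> ?R. col (u k) = 0} = {k \<in> ?R. col (v k) = 0}"
    by (rule down_closed_eq[where R = ?R, OF _ _ _ card down[OF u(3)] down[OF v(3)]]) auto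
  have high: "{k \<in> ?R. col (u k) = 2} = {k \<in> ?R. col (v k) = 2}"
    by (rule up_closed_eq[where R = ?R, OF _ _ _ card up[OF u(3)] up[OF v(3)]]) auto
  have "col (u i) = 0 \<longleftrightarrow> col (v i) = 0" "col (u i) = 2 \<longleftrightarrow> col (v i) = 2"
    using low high i by blast+
  then show "col (u i) = col (v i)"
    using block_class_cases[of n c s "u i"] block_class_cases[of n c s "v i"] by auto
qed

end

section \<open>Reduced words in which one letter occurs exactly once\<close>

lemma word_perm_fixes:
  assumes "x \<in> lists {a..<b}" "k < a \<or> b < k"
  shows "word_perm x k = k"
  using assms(1)
proof (induction x)
  case (Cons i x)
  then show ?case using assms(2) by (auto simp: Transposition.transpose_def)
qed simp

text \<open>Sorting the first i positions produces t with 1, ..., i - 1 in place, the value i at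
  position i + 1 and a larger value at position i. One application of s_i then fixes 1, ..., i, so
  what remains is a word in letters above i.\<close>

lemma exists_split_word:
  assumes v: "v permutes {1..n}" and i: "1 \<le> i" "i < n"
    and small: "\<And>q. 1 \<le> q \<Longrightarrow> q < i \<Longrightarrow> Hilbert_Choice.inv v q \<le> i" and next_val: "v (Suc i) = i"
  shows "\<exists>x y. x \<in> lists {Suc i..<n} \<and> y \<in> lists {1..<i} \<and> reduced_word n v (x @ [i] @ y)"
proof -
  let ?s = "simple_transposition i"
  have iv: "Hilbert_Choice.inv v permutes {1..n}" by (rule permutes_inv[OF v])
  have "\<exists>t y. t permutes {1..n} \<and> y \<in> lists {1..<i} \<and> v = t \<circ> word_perm y \<and>
      card (inversions v) = card (inversions t) + length y \<and> (\<forall>k\<in>{1..<i}. t k < t (Suc k))"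
    by (rule sort_interval[OF v]) (use i in auto)
  then obtain t y where t: "t permutes {1..n}" "y \<in> lists {1..<i}" "v = t \<circ> word_perm y"
      "card (inversions v) = card (inversions t) + length y" "\<forall>k\<in>{1..<i}. t k < t (Suc k)"
    by blast
  have y: "word_perm y permutes {1..i}" by (rule word_perm_permutes[OF t(2)])
  have inj: "inj t" by (rule permutes_inj[OF t(1)])
  have tSuc: "t (Suc i) = i" using next_val t(3) permutes_not_in[OF y, of "Suc i"] by simp
  have pos: "\<exists>k\<in>{1..i}. t k = q" if q: "1 \<le> q" "q < i" for q
  proof -
    have "Hilbert_Choice.inv v q \<in> {1..i}"
      using small[OF q] permutes_mem[OF iv, of q] q i by auto
    then have "word_perm y (Hilbert_Choice.inv v q) \<in> {1..i}" by (rule permutes_mem[OF y])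
    moreover have "t (word_perm y (Hilbert_Choice.inv v q)) = q"
      using permutes_inverses(1)[OF v, of q] unfolding t(3) comp_apply .
    ultimately show ?thesis by blast
  qed
  have fix_below: "t j = j" if "1 \<le> j" "j < i" for j
    using that
  proof (induction j rule: less_induct)
    case (less j)
    obtain k where k: "k \<in> {1..i}" "t k = j" using pos less.prems by blast
    have "\<not> k < j" using less.IH[of k] k less.prems by auto
    moreover have "\<not> j < k"
    proof
      assume "j < k"
      then have "t j < j" using ascents_imp_less[OF t(5), of j k] less.prems k by auto
      moreover have "t j \<in> {1..n}" using permutes_mem[OF t(1)] less.prems i by auto
      ultimately have "t (t j) = t j" using less.IH[of "t j"] less.prems by auto
      from injD[OF inj this] show False using \<open>t j < j\<close> by simp
    qed
    ultimately show ?case using k(2) by simp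
  qed
  have "t i \<noteq> j" if "j \<le> i" for j
  proof (cases "j = i \<or> j = 0")
    case True
    moreover have "t i \<noteq> i" using tSuc injD[OF inj, of i "Suc i"] by auto
    moreover have "t i \<in> {1..n}" using permutes_mem[OF t(1), of i] i by simp
    ultimately show ?thesis by auto
  next
    case False
    then have j: "t j = j" "j \<noteq> i" using that fix_below by auto
    show ?thesis
    proof
      assume "t i = j"
      then have "t i = t j" using j(1) by simp
      from injD[OF inj this] show False using j(2) by simp
    qed
  qed
  then have "\<not> t i \<le> i" by blast
  then have "i < t i" by simp
  then have desc: "t (Suc i) < t i" using tSuc by simp
  have i': "i \<in> {1..<n}" using i by auto
  have t': "t \<circ> ?s permutes {1..n}" by (rule permutes_compose[OF simple_transposition_permutes[OF i'] t(1)])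
  have inv_t: "card (inversions t) = Suc (card (inversions (t \<circ> ?s)))"
    by (rule card_inversions_descent[OF t(1) desc i'])
  have fix': "(t \<circ> ?s) j = j" if "j \<le> i" for j
  proof (cases "j = i \<or> j = 0")
    case True
    then show ?thesis using tSuc i permutes_not_in[OF t', of 0] by auto
  next
    case False
    then show ?thesis using that fix_below by (auto simp: Transposition.transpose_def)
  qed
  have "\<exists>p x. p permutes {1..n} \<and> x \<in> lists {Suc i..<n} \<and> t \<circ> ?s = p \<circ> word_perm x \<and>
      card (inversions (t \<circ> ?s)) = card (inversions p) + length x \<and> (\<forall>k\<in>{Suc i..<n}. p k < p (Suc k))"
    by (rule sort_interval[OF t']) (use i in auto)
  then obtain p x where p: "p permutes {1..n}" "x \<in> lists {Suc i..<n}" "t \<circ> ?s = p \<circ> word_perm x"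
      "card (inversions (t \<circ> ?s)) = card (inversions p) + length x" "\<forall>k\<in>{Suc i..<n}. p k < p (Suc k)"
    by blast
  have p_fix: "p j = j" if "j \<le> i" for j
    using fix'[OF that] p(3) word_perm_fixes[OF p(2), of j] that by (metis comp_apply le_imp_less_Suc)
  have p_above: "i < p j" if "i < j" for j
  proof (rule ccontr)
    assume "\<not> i < p j"
    then have "p (p j) = p j" using p_fix by simp
    from injD[OF permutes_inj[OF p(1)] this] show False using \<open>\<not> i < p j\<close> that by simp
  qed
  have "p = id"
  proof (rule permutes_increasing_id[OF p(1)])
    fix j k assume jk: "j \<in> {1..n}" "k \<in> {1..n}" "j < k"
    show "p j < p k"
    proof (cases "j \<le> i")
      case True
      then show ?thesis using p_fix[of j] p_fix[of k] p_above[of k] jk by (cases "k \<le> i") auto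
    next
      case False
      then show ?thesis using ascents_imp_less[OF p(5), of j k] jk by auto
    qed
  qed
  then have tx: "t \<circ> ?s = word_perm x" using p(3) by simp
  have "t = (t \<circ> ?s) \<circ> ?s" by (simp add: o_assoc[symmetric] del: comp_apply)
  then have "v = word_perm (x @ [i] @ y)" unfolding t(3) by (simp only: tx word_perm_append word_perm_Cons word_perm_Nil comp_id o_assoc)
  moreover have "inversions p = {}" unfolding \<open>p = id\<close> by (auto simp: inversions_def)
  then have "card (inversions v) = length (x @ [i] @ y)" using t(4) inv_t p(4) by simp
  moreover have "x @ [i] @ y \<in> lists {1..<n}" using p(2) t(2) i by auto
  ultimately have "reduced_word n v (x @ [i] @ y)" by (simp add: reduced_word_iff)
  then show ?thesis using p(2) t(2) by blast
qed

lemma word_action_zero_interval: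
  assumes "\<And>u. u permutes {a..b} \<Longrightarrow> h u = 0" "x \<in> lists {a..<b}" "u permutes {a..b}"
  shows "word_action x h u = 0"
  using assms(2,3)
proof (induction x arbitrary: u)
  case (Cons i x)
  then have "u \<circ> simple_transposition i permutes {a..b}"
    by (intro permutes_transpose) auto
  then show ?case using Cons by simp
qed (use assms(1) in auto)

text \<open>The expansion pairs p q with p s_i q, where p comes from letters above i and q from
  letters below i; the two occur with opposite signs.\<close>

lemma split_word_action_zero:
  assumes x: "x \<in> lists {Suc i..<n}" and y: "y \<in> lists {1..<i}"
    and inv: "\<And>p q. p permutes {Suc i..n} \<Longrightarrow> q permutes {1..i} \<Longrightarrow>
      h (p \<circ> simple_transposition i \<circ> q) = h (p \<circ> q)"
  shows "word_action (x @ [i] @ y) h id = 0"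
  unfolding word_action_append
proof (rule word_action_zero_interval[OF _ x permutes_id])
  fix p assume p: "p permutes {Suc i..n}"
  have "word_action y h (p \<circ> simple_transposition i) = word_action y (\<lambda>u. h ((p \<circ> simple_transposition i) \<circ> u)) id"
    unfolding word_action_left_translate by (simp only: comp_id)
  also have "\<dots> = word_action y (\<lambda>u. h (p \<circ> u)) id"
    by (rule word_action_cong[where n = i]) (use inv[OF p] y permutes_id in auto)
  also have "\<dots> = word_action y h p"
    unfolding word_action_left_translate by (simp only: comp_id)
  finally show "word_action [i] (word_action y h) p = 0" by simp
qed

text \<open>Being a functional is a condition on permutations of \<open>{1..n}\<close> only, and the
  identities relating block functions of u and of its inverse are available just there.\<close>

lemma tl_functional_cong:
  assumes "tl_functional n h" "\<And>u. u permutes {1..n} \<Longrightarrow> h u = g u"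
  shows "tl_functional n g"
  unfolding tl_functional_def tl_relation_def
proof (intro allI impI)
  fix u i j k
  assume u: "u permutes {1..n}" and "{i, j, k} \<subseteq> {1..n}" and ne: "i \<noteq> j" "j \<noteq> k" "i \<noteq> k"
  then have mem: "i \<in> {1..n}" "j \<in> {1..n}" "k \<in> {1..n}" by auto
  have eq: "g v = h v" "g (v \<circ> Transposition.transpose i j) = h (v \<circ> Transposition.transpose i j)"
      "g (v \<circ> Transposition.transpose j k) = h (v \<circ> Transposition.transpose j k)"
      "g (v \<circ> Transposition.transpose i k) = h (v \<circ> Transposition.transpose i k)"
    if "v permutes {1..n}" for v
    using that mem by (simp_all only: assms(2) permutes_transpose)
  show "g u + g (u \<circ> Transposition.transpose i j \<circ> Transposition.transpose j k)
      + g (u \<circ> Transposition.transpose j k \<circ> Transposition.transpose i j) =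
    g (u \<circ> Transposition.transpose i j) + g (u \<circ> Transposition.transpose j k) + g (u \<circ> Transposition.transpose i k)"
    using tl_functionalD[OF assms(1) u mem ne] eq(2-)[OF u] eq(1)[OF u]
      eq(3)[OF permutes_transpose[OF u mem(1,2)]] eq(2)[OF permutes_transpose[OF u mem(2,3)]]
    by (simp del: comp_apply)
qed

section \<open>Indicator functions of block shapes as functionals\<close>

context blocks
begin

definition corner_fun :: "(nat \<Rightarrow> nat) \<Rightarrow> complex"
  where "corner_fun u = (if in_cells corner_ok u then 1 else 0)"

definition wide_fun :: "(nat \<Rightarrow> nat) \<Rightarrow> complex"
  where "wide_fun u = (if in_cells corner_ok u then 1 else 0) + (if in_cells narrow_ok u then 1 else 0)"

lemma swapped: "blocks n c b s r"
  using rows_le cols_le by unfold_locales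

lemma corner_ok_swap: "(\<lambda>p q. corner_ok q p) = corner_ok"
  by (auto simp: corner_ok_def fun_eq_iff)

lemma corner_cells_inv:
  "u permutes {1..n} \<Longrightarrow> blocks.in_cells n c b s r corner_ok (Hilbert_Choice.inv u) \<longleftrightarrow> in_cells corner_ok u"
  using in_cells_inv[of u corner_ok] by (simp add: corner_ok_swap)

lemma narrow_ok_swap: "blocks.narrow_ok c b = (\<lambda>p q. narrow_ok q p)"
  unfolding blocks.narrow_ok_def[OF swapped, abs_def] narrow_ok_def corner_ok_def
  by (intro ext) auto

lemma narrow_cells_inv:
  "u permutes {1..n} \<Longrightarrow> blocks.in_cells n c b s r (blocks.narrow_ok c b) (Hilbert_Choice.inv u) \<longleftrightarrow>
    in_cells narrow_ok u"
  using in_cells_inv[of u narrow_ok] by (simp add: narrow_ok_swap)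

lemma wide_fun_inv:
  "u permutes {1..n} \<Longrightarrow> blocks.wide_fun n c b s r (Hilbert_Choice.inv u) = wide_fun u"
  by (simp add: blocks.wide_fun_def[OF swapped] wide_fun_def corner_cells_inv narrow_cells_inv)

lemma corner_fun_inv:
  "u permutes {1..n} \<Longrightarrow> blocks.corner_fun n c b s r (Hilbert_Choice.inv u) = corner_fun u"
  by (simp add: blocks.corner_fun_def[OF swapped] corner_fun_def corner_cells_inv)

lemma tl_functional_corner_rows:
  assumes "\<And>i. i \<in> {1..n} \<Longrightarrow> row i = p \<or> row i = q"
  shows "tl_functional n corner_fun"
  by (rule tl_functional_two_classes[where cls = row and a = p and b = q])
    (use assms in \<open>simp_all add: corner_fun_def in_cells_right del: comp_apply\<close>)

text \<open>Rows or columns then occupy at most two classes. The conditions on b and c, and on r and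
  s, come in pairs because both blocks (0,2) and (2,0) have to become empty for the counts in
  \<open>degenerate_counts\<close>.\<close>

definition degenerate :: bool
  where "degenerate \<longleftrightarrow> b + r = n \<or> c + s = n \<or> b = 0 \<and> c = 0 \<or> r = 0 \<and> s = 0"

lemma tl_functional_corner:
  assumes degenerate
  shows "tl_functional n corner_fun"
proof -
  consider "b + r = n" | "c + s = n" | "b = 0" | "r = 0" using assms by (auto simp: degenerate_def)
  then show ?thesis
  proof cases
    case 1
    then show ?thesis
      by (intro tl_functional_corner_rows[of 0 2]) (auto simp: block_class_def)
  next
    case 2
    have "tl_functional n (blocks.corner_fun n c b s r)"
      by (rule blocks.tl_functional_corner_rows[OF swapped, of 0 2]) (use 2 in \<open>auto simp: block_class_def\<close>)
    then show ?thesis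
      by (rule tl_functional_cong[OF tl_functional_inv]) (rule corner_fun_inv)
  next
    case 3
    then show ?thesis
      by (intro tl_functional_corner_rows[of 1 2]) (auto simp: block_class_def)
  next
    case 4
    then show ?thesis
      by (intro tl_functional_corner_rows[of 0 1]) (auto simp: block_class_def)
  qed
qed

lemma wide_fun_right:
  "i \<in> {1..n} \<Longrightarrow> j \<in> {1..n} \<Longrightarrow> row i = row j \<Longrightarrow> wide_fun (u \<circ> Transposition.transpose i j) = wide_fun u"
  by (simp add: wide_fun_def in_cells_right del: comp_apply)

end

context blocks
begin

lemma three_distinct_classes:
  fixes x y z :: nat
  assumes "x \<in> {0, 1, 2}" "y \<in> {0, 1, 2}" "z \<in> {0, 1, 2}" "x \<noteq> y \<and> y \<noteq> z \<and> x \<noteq> z"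
  shows "x = 0 \<and> y = 1 \<and> z = 2 \<or> x = 0 \<and> y = 2 \<and> z = 1 \<or> x = 1 \<and> y = 0 \<and> z = 2 \<or>
    x = 1 \<and> y = 2 \<and> z = 0 \<or> x = 2 \<and> y = 0 \<and> z = 1 \<or> x = 2 \<and> y = 1 \<and> z = 0"
  using assms by (elim insertE emptyE) simp_all

lemma corner_narrow_cancel:
  fixes x y z p q t :: nat and rest :: bool
  assumes "x \<in> {0, 1, 2}" "y \<in> {0, 1, 2}" "z \<in> {0, 1, 2}" "x \<noteq> y \<and> y \<noteq> z \<and> x \<noteq> z"
    and "p \<in> {0, 1, 2}" "q \<in> {0, 1, 2}" "t \<in> {0, 1, 2}" "p \<noteq> q \<and> q \<noteq> t \<and> p \<noteq> t"
  defines "E \<equiv> \<lambda>p q t. (if rest \<and> corner_ok x p \<and> corner_ok y q \<and> corner_ok z t then 1 else 0)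
    + (if rest \<and> narrow_ok x p \<and> narrow_ok y q \<and> narrow_ok z t then 1 else (0::complex))"
  shows "E p q t + E q t p + E t p q = E q p t + E p t q + E t q p"
proof -
  have corner: "corner_ok 0 0 = False" "corner_ok 0 1 = True" "corner_ok 0 2 = True" "corner_ok 1 0 = True"
      "corner_ok 1 1 = True" "corner_ok 1 2 = True" "corner_ok 2 0 = True" "corner_ok 2 1 = True"
      "corner_ok 2 2 = False"
    by (simp_all add: corner_ok_def)
  have narrow: "narrow_ok 0 0 = False" "narrow_ok 0 1 = (b \<noteq> 1)" "narrow_ok 0 2 = True"
      "narrow_ok 1 0 = (c \<noteq> 1)" "narrow_ok 1 1 = True" "narrow_ok 1 2 = (b = 1)"
      "narrow_ok 2 0 = True" "narrow_ok 2 1 = (c = 1)" "narrow_ok 2 2 = False"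
    by (simp_all add: narrow_ok_def corner_ok_def)
  have symmetric: ?thesis if "\<not> rest" using that by (simp add: E_def)
  show ?thesis
  proof (cases rest)
    case True
    then show ?thesis
      using three_distinct_classes[OF assms(1-4)] three_distinct_classes[OF assms(5-8)] unfolding E_def
      by (elim disjE conjE; hypsubst; simp only: corner narrow; cases "b = 1"; cases "c = 1"; simp)
  qed (rule symmetric)
qed

text \<open>Only three rows and three columns of pairwise different classes are relevant. There, the corner
  shape contributes two 3-cycles and the transposition exchanging the outer columns, and the narrow
  shape contributes the latter once more.\<close>

lemma tl_functional_wide:
  assumes bs: "b = 1 \<or> s = 1" and cr: "c = 1 \<or> r = 1"
  shows "tl_functional n wide_fun"
  unfolding tl_functional_def
proof (intro allI impI)
  fix u i j k
  assume u: "u permutes {1..n}" and "{i, j, k} \<subseteq> {1..n}" and ne: "i \<noteq> j" "j \<noteq> k" "i \<noteq> k"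
  then have mem: "i \<in> {1..n}" "j \<in> {1..n}" "k \<in> {1..n}" by auto
  let ?iu = "Hilbert_Choice.inv u"
  have mem': "u i \<in> {1..n}" "u j \<in> {1..n}" "u k \<in> {1..n}" using mem[THEN permutes_mem[OF u]] .
  have inj: "inj u" by (rule permutes_inj[OF u])
  have ne': "u i \<noteq> u j" "u j \<noteq> u k" "u i \<noteq> u k" using ne inj by (auto dest: injD)
  show "tl_relation wide_fun u i j k"
  proof (cases "row i = row j \<or> row j = row k \<or> row i = row k")
    case True
    then show ?thesis
      using wide_fun_right mem by (intro tl_relation_if_invariant[OF u mem ne]) blast
  next
    case rows: False
    show ?thesis
    proof (cases "col (u i) = col (u j) \<or> col (u j) = col (u k) \<or> col (u i) = col (u k)")
      case True
      interpret sw: blocks n c b s r by (rule swapped)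
      have "tl_relation sw.wide_fun ?iu (u i) (u j) (u k)"
        using True sw.wide_fun_right mem'
        by (intro tl_relation_if_invariant[OF permutes_inv[OF u] mem' ne']) blast
      then have *: "tl_relation (\<lambda>u. sw.wide_fun (Hilbert_Choice.inv u)) u i j k"
        unfolding tl_relation_inv[OF u mem ne] .
      note p = permutes_transpose[OF u mem(1,2)] permutes_transpose[OF u mem(2,3)]
        permutes_transpose[OF u mem(1,3)]
      show ?thesis
        using * unfolding tl_relation_def wide_fun_inv[OF u] p[THEN wide_fun_inv]
          wide_fun_inv[OF permutes_transpose[OF p(1) mem(2,3)]]
          wide_fun_inv[OF permutes_transpose[OF p(2) mem(1,2)]] .
    next
      case cols: False
      let ?rest = "\<lambda>ok. \<forall>x\<in>{1..n} - {i, j, k}. ok (row x) (col (u x))"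
      have cells: "in_cells ok v \<longleftrightarrow> ?rest ok \<and> ok (row i) (col (v i)) \<and> ok (row j) (col (v j)) \<and> ok (row k) (col (v k))"
        if "\<And>x. x \<notin> {i, j, k} \<Longrightarrow> v x = u x" for v ok
      proof -
        have "{1..n} = ({1..n} - {i, j, k}) \<union> {i, j, k}" using mem by auto
        then have "in_cells ok v \<longleftrightarrow> (\<forall>x\<in>({1..n} - {i, j, k}) \<union> {i, j, k}. ok (row x) (col (v x)))"
          unfolding in_cells_def by simp
        also have "\<dots> \<longleftrightarrow> (\<forall>x\<in>{1..n} - {i, j, k}. ok (row x) (col (v x))) \<and>
            (\<forall>x\<in>{i, j, k}. ok (row x) (col (v x)))" by (rule ball_Un)
        also have "(\<forall>x\<in>{1..n} - {i, j, k}. ok (row x) (col (v x))) \<longleftrightarrow> ?rest ok"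
          by (rule ball_cong) (simp_all add: that)
        finally show ?thesis by simp
      qed
      have r012: "row i \<in> {0,1,2}" "row j \<in> {0,1,2}" "row k \<in> {0,1,2}"
        and c012: "col (u i) \<in> {0,1,2}" "col (u j) \<in> {0,1,2}" "col (u k) \<in> {0,1,2}"
        using block_class_cases[of n b r] block_class_cases[of n c s] by simp_all
      have row_ex: "\<exists>y\<in>{i, j, k}. row y = p" if "p \<in> {0,1,2}" for p
        using r012 rows that by auto
      have col_ex: "\<exists>y\<in>{i, j, k}. col (u y) = p" if "p \<in> {0,1,2}" for p
        using c012 cols that by auto
      \<comment> \<open>If b = 1, then the only row of class 0 is one of i, j, k, so no other point
        can use the cell (0,1); s, c and r play this role for the other three cells. Hence the
        shapes agree away from i, j, k.\<close>
      have rest: "?rest narrow_ok \<longleftrightarrow> ?rest corner_ok"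
      proof
        assume c: "?rest corner_ok"
        show "?rest narrow_ok"
        proof
          fix x assume x: "x \<in> {1..n} - {i, j, k}"
          then have ux: "u x \<in> {1..n}" using permutes_mem[OF u] by blast
          have un: "u y \<noteq> u x" if "y \<in> {i, j, k}" for y using that x inj by (auto dest: injD)
          have 1: "\<not> (row x = 0 \<and> col (u x) = 1)" if "b = 1"
          proof
            assume "row x = 0 \<and> col (u x) = 1"
            then have "x = 1" using that x by (auto simp: block_class_def split: if_splits)
            moreover obtain y where "y \<in> {i, j, k}" "row y = 0" using row_ex by blast
            then have "y \<in> {i, j, k}" "y = 1" using that mem by (auto simp: block_class_def split: if_splits)
            ultimately show False using x by blast
          qed
          have 2: "\<not> (row x = 1 \<and> col (u x) = 2)" if "s = 1"
          proof
            assume "row x = 1 \<and> col (u x) = 2"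
            then have "u x = n" using that ux by (auto simp: block_class_def split: if_splits)
            moreover obtain y where y: "y \<in> {i, j, k}" "col (u y) = 2" using col_ex by blast
            moreover have "u y \<in> {1..n}" using y(1) mem' by auto
            then have "u y = n" using that y by (auto simp: block_class_def split: if_splits)
            ultimately show False using un by metis
          qed
          have 3: "\<not> (row x = 1 \<and> col (u x) = 0)" if "c = 1"
          proof
            assume "row x = 1 \<and> col (u x) = 0"
            then have "u x = 1" using that ux by (auto simp: block_class_def split: if_splits)
            moreover obtain y where y: "y \<in> {i, j, k}" "col (u y) = 0" using col_ex by blast
            moreover have "u y \<in> {1..n}" using y(1) mem' by auto
            then have "u y = 1" using that y by (auto simp: block_class_def split: if_splits)
            ultimately show False using un by metis
          qed
          have 4: "\<not> (row x = 2 \<and> col (u x) = 1)" if "r = 1"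
          proof
            assume "row x = 2 \<and> col (u x) = 1"
            then have "x = n" using that x by (auto simp: block_class_def split: if_splits)
            moreover obtain y where "y \<in> {i, j, k}" "row y = 2" using row_ex by blast
            then have "y \<in> {i, j, k}" "y = n" using that mem by (auto simp: block_class_def split: if_splits)
            ultimately show False using x by blast
          qed
          have "corner_ok (row x) (col (u x))" using c x by blast
          moreover have "if b = 1 then \<not> (row x = 0 \<and> col (u x) = 1) else \<not> (row x = 1 \<and> col (u x) = 2)"
            using 1 2 bs by (cases "b = 1") auto
          moreover have "if c = 1 then \<not> (row x = 1 \<and> col (u x) = 0) else \<not> (row x = 2 \<and> col (u x) = 1)"
            using 3 4 cr by (cases "c = 1") auto
          ultimately show "narrow_ok (row x) (col (u x))" by (simp only: narrow_ok_def simp_thms)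
        qed
      qed (auto simp: narrow_ok_def)
      let ?E = "\<lambda>p q t. (if ?rest corner_ok \<and> corner_ok (row i) p \<and> corner_ok (row j) q \<and> corner_ok (row k) t then 1 else 0)
        + (if ?rest corner_ok \<and> narrow_ok (row i) p \<and> narrow_ok (row j) q \<and> narrow_ok (row k) t then 1 else (0::complex))"
      have E: "wide_fun v = ?E (col (v i)) (col (v j)) (col (v k))" if "\<And>x. x \<notin> {i, j, k} \<Longrightarrow> v x = u x" for v
      proof -
        have "in_cells ok v \<longleftrightarrow> ?rest ok \<and> ok (row i) (col (v i)) \<and> ok (row j) (col (v j)) \<and> ok (row k) (col (v k))"
          for ok by (rule cells) (rule that)
        then show ?thesis by (simp only: wide_fun_def rest)
      qed
      have outside: "(u \<circ> Transposition.transpose x y) z = u z"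
          "(u \<circ> Transposition.transpose x y \<circ> Transposition.transpose x' y') z = u z"
        if "z \<notin> {i, j, k}" "x \<in> {i, j, k}" "y \<in> {i, j, k}" "x' \<in> {i, j, k}" "y' \<in> {i, j, k}" for x y x' y' z
        using that by (auto simp: Transposition.transpose_def)
      let ?p = "col (u i)" and ?q = "col (u j)" and ?t = "col (u k)"
      have vals: "wide_fun u = ?E ?p ?q ?t"
          "wide_fun (u \<circ> Transposition.transpose i j) = ?E ?q ?p ?t"
          "wide_fun (u \<circ> Transposition.transpose j k) = ?E ?p ?t ?q"
          "wide_fun (u \<circ> Transposition.transpose i k) = ?E ?t ?q ?p"
          "wide_fun (u \<circ> Transposition.transpose i j \<circ> Transposition.transpose j k) = ?E ?q ?t ?p"
          "wide_fun (u \<circ> Transposition.transpose j k \<circ> Transposition.transpose i j) = ?E ?t ?p ?q"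
        by (subst E, use ne outside in \<open>simp; fail\<close>, use ne in \<open>simp add: Transposition.transpose_def\<close>)+
      have "?E ?p ?q ?t + ?E ?q ?t ?p + ?E ?t ?p ?q = ?E ?q ?p ?t + ?E ?p ?t ?q + ?E ?t ?q ?p"
      proof -
        show ?thesis by (rule corner_narrow_cancel[OF r012 _ c012]) (use rows cols in auto)
      qed
      then show ?thesis unfolding tl_relation_def vals .
    qed
  qed
qed

end

section \<open>Basis words that do not annihilate a block function\<close>

context blocks
begin

text \<open>A descent inside a block is killed by the invariance on that side. If v is outside the
  corner shape, so is everything below v, because the shape is an upper set.\<close>

lemma block_increasing_if_action_nonzero:
  assumes h: "tl_functional n h" and v: "v \<in> avoiders_321 n"
    and right: "\<And>u i j. i \<in> {1..n} \<Longrightarrow> j \<in> {1..n} \<Longrightarrow> row i = row j \<Longrightarrow> h (u \<circ> Transposition.transpose i j) = h u"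
    and left: "\<And>u p q. col p = col q \<Longrightarrow> h (Transposition.transpose p q \<circ> u) = h u"
    and cells: "\<And>u. \<not> in_cells corner_ok u \<Longrightarrow> h u = 0"
    and nz: "word_action (basis_word n v) h id \<noteq> 0"
  shows "block_increasing n b r v" "block_increasing n c s (Hilbert_Choice.inv v)" "in_cells corner_ok v"
proof -
  have vp: "v permutes {1..n}" using v by (simp add: avoiders_321_iff)
  show "block_increasing n b r v"
  proof (rule block_increasing_if_ascents)
    fix i assume i: "i \<in> {1..<n}" "row i = row (Suc i)"
    have "\<not> v (Suc i) < v i"
      using basis_word_action_right_invariant[OF v h, of i] right[of i "Suc i"] i nz by auto
    then show "v i < v (Suc i)" using ascent_or_descent[OF vp] by blast
  qed
  show "block_increasing n c s (Hilbert_Choice.inv v)"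
  proof (rule block_increasing_if_ascents)
    fix i assume i: "i \<in> {1..<n}" "col i = col (Suc i)"
    have "\<not> Hilbert_Choice.inv v (Suc i) < Hilbert_Choice.inv v i"
      using basis_word_action_left_invariant[OF v h, of i] left[of i "Suc i"] i nz by auto
    then show "Hilbert_Choice.inv v i < Hilbert_Choice.inv v (Suc i)"
      using ascent_or_descent[OF permutes_inv[OF vp]] by blast
  qed
  show "in_cells corner_ok v"
  proof (rule ccontr)
    assume not: "\<not> in_cells corner_ok v"
    have "word_action (basis_word n v) h id = 0"
    proof (rule word_action_vanishes[OF reduced_basis_word[OF vp]])
      fix u assume "u permutes {1..n}" "bruhat_le u v"
      then show "h u = 0" using in_cells_corner_bruhat[OF _ vp] not cells by blast
    qed
    then show False using nz by simp
  qed
qed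

lemma cell_count_row:
  "cell_count u p 0 + cell_count u p 1 + cell_count u p 2 = card {i \<in> {1..n}. row i = p}"
proof -
  let ?S = "\<lambda>q. {i \<in> {1..n}. row i = p \<and> col (u i) = q}"
  have split: "{i \<in> {1..n}. row i = p} = ?S 0 \<union> ?S 1 \<union> ?S 2"
  proof
    show "{i \<in> {1..n}. row i = p} \<subseteq> ?S 0 \<union> ?S 1 \<union> ?S 2"
    proof
      fix i assume "i \<in> {i \<in> {1..n}. row i = p}"
      then show "i \<in> ?S 0 \<union> ?S 1 \<union> ?S 2" using block_class_cases[of n c s "u i"] by simp
    qed
  qed auto
  have "card (?S 0 \<union> ?S 1 \<union> ?S 2) = card (?S 0) + card (?S 1) + card (?S 2)"
    by (subst card_Un_disjoint, auto)+
  then show ?thesis unfolding cell_count_def split by (rule sym)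
qed

lemma cell_count_corner:
  assumes "in_cells corner_ok u"
  shows "cell_count u 0 0 = 0" "cell_count u 2 2 = 0"
proof -
  have "{i \<in> {1..n}. row i = 0 \<and> col (u i) = 0} = {}" "{i \<in> {1..n}. row i = 2 \<and> col (u i) = 2} = {}"
    using in_cellsD[OF assms] by (auto simp: corner_ok_def)
  then show "cell_count u 0 0 = 0" "cell_count u 2 2 = 0" by (simp_all only: cell_count_def card.empty)
qed

lemma cell_count_eq_0_iff: "cell_count u p q = 0 \<longleftrightarrow> (\<forall>i\<in>{1..n}. \<not> (row i = p \<and> col (u i) = q))"
  unfolding cell_count_def by (subst card_eq_0_iff) auto

lemma cell_count_eq_0I:
  assumes "\<And>i. i \<in> {1..n} \<Longrightarrow> row i = p \<Longrightarrow> col (u i) = q \<Longrightarrow> False"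
  shows "cell_count u p q = 0"
  unfolding cell_count_eq_0_iff
proof
  fix i assume i: "i \<in> {1..n}"
  show "\<not> (row i = p \<and> col (u i) = q)"
  proof
    assume "row i = p \<and> col (u i) = q"
    then show False using assms[OF i] by simp
  qed
qed

lemma cell_count_neq_0E:
  assumes "cell_count u p q \<noteq> 0"
  obtains i where "i \<in> {1..n}" "row i = p" "col (u i) = q"
  using assms unfolding cell_count_eq_0_iff by auto

text \<open>Without middle rows the column sums determine both counts, without middle columns the
  row sums do, and in the other two cases both blocks are empty.\<close>

lemma degenerate_counts:
  assumes deg: degenerate
    and u: "u permutes {1..n}" "in_cells corner_ok u" and v: "v permutes {1..n}" "in_cells corner_ok v"
  shows "cell_count u 0 2 = cell_count v 0 2 \<and> cell_count u 2 0 = cell_count v 2 0"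
proof -
  note corner = cell_count_corner[OF u(2)] cell_count_corner[OF v(2)]
  consider "b + r = n" | "c + s = n" | "b = 0" "c = 0" | "r = 0" "s = 0"
    using deg by (auto simp: degenerate_def)
  then show ?thesis
  proof cases
    case 1
    have "cell_count w 1 q = 0" for w q
      by (rule cell_count_eq_0I) (use 1 in \<open>auto simp: block_class_def split: if_splits\<close>)
    then show ?thesis
      using corner cell_count_col[OF u(1), of 0] cell_count_col[OF v(1), of 0]
        cell_count_col[OF u(1), of 2] cell_count_col[OF v(1), of 2] by simp
  next
    case 2
    have "cell_count w p 1 = 0" for w p
      by (rule cell_count_eq_0I) (use 2 in \<open>auto simp: block_class_def split: if_splits\<close>)
    then show ?thesis
      using corner cell_count_row[of u 0] cell_count_row[of v 0] cell_count_row[of u 2] cell_count_row[of v 2]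
      by simp
  next
    case 3
    have "cell_count w 0 2 = 0 \<and> cell_count w 2 0 = 0" if w: "w permutes {1..n}" for w
    proof (intro conjI; rule cell_count_eq_0I)
      fix i assume i: "i \<in> {1..n}"
      then have wi: "w i \<in> {1..n}" by (simp only: permutes_in_image[OF w])
      show "row i = 0 \<Longrightarrow> col (w i) = 2 \<Longrightarrow> False" "row i = 2 \<Longrightarrow> col (w i) = 0 \<Longrightarrow> False"
        using i wi 3 by (simp_all add: block_class_def split: if_splits)
    qed
    then show ?thesis using u(1) v(1) by simp
  next
    case 4
    have "cell_count w 0 2 = 0 \<and> cell_count w 2 0 = 0" if w: "w permutes {1..n}" for w
    proof (intro conjI; rule cell_count_eq_0I)
      fix i assume i: "i \<in> {1..n}"
      then have wi: "w i \<in> {1..n}" by (simp only: permutes_in_image[OF w])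
      show "row i = 0 \<Longrightarrow> col (w i) = 2 \<Longrightarrow> False" "row i = 2 \<Longrightarrow> col (w i) = 0 \<Longrightarrow> False"
        using i wi 4 by (simp_all add: block_class_def split: if_splits)
    qed
    then show ?thesis using u(1) v(1) by simp
  qed
qed

lemma degenerate_action_zero:
  assumes deg: degenerate and v: "v \<in> avoiders_321 n"
    and w: "w permutes {1..n}" "in_cells corner_ok w" "block_increasing n b r w"
      "block_increasing n c s (Hilbert_Choice.inv w)"
    and ne: "v \<noteq> w"
  shows "word_action (basis_word n v) corner_fun id = 0"
proof (rule ccontr)
  assume nz: "word_action (basis_word n v) corner_fun id \<noteq> 0"
  have vp: "v permutes {1..n}" using v by (simp add: avoiders_321_iff)
  have props: "block_increasing n b r v" "block_increasing n c s (Hilbert_Choice.inv v)" "in_cells corner_ok v"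
    by (rule block_increasing_if_action_nonzero[OF tl_functional_corner[OF deg] v _ _ _ nz];
        simp add: corner_fun_def in_cells_right in_cells_left del: comp_apply)+
  have "v = w"
    using degenerate_counts[OF deg vp props(3) w(1,2)]
    by (intro block_perm_unique[OF vp props(3,1,2) w]) auto
  then show False using ne by simp
qed

text \<open>Let $R_0$, $R_1$, $R_2$ be the rows and $C_0$, $C_1$, $C_2$ the columns of the three classes. If \<open>v\<close>
  has a point in $R_0 \times C_2$ but none in $R_2 \times C_0$, then it has a reduced word in which the
  letter \<open>b + c\<close> occurs exactly once, and omitting this letter does not affect whether the product of
  a subword lies in the corner shape; the contributions to the action therefore cancel.\<close>

lemma chain_action_zero:
  assumes v: "v permutes {1..n}" "in_cells corner_ok v" "block_increasing n b r v"
      "block_increasing n c s (Hilbert_Choice.inv v)"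
    and counts: "cell_count v 0 2 = 1" "cell_count v 2 0 = 0"
    and pos: "1 \<le> b" "1 \<le> c" "1 \<le> r" "1 \<le> s" and le: "b + c + r + s \<le> n"
  shows "\<exists>x. reduced_word n v x \<and> word_action x wide_fun id = 0"
proof -
  let ?i = "b + c"
  let ?iv = "Hilbert_Choice.inv v"
  have iv: "?iv permutes {1..n}" by (rule permutes_inv[OF v(1)])
  have row0: "row k = 0 \<longleftrightarrow> k \<le> b" and row1: "row k = 1 \<longleftrightarrow> b < k \<and> k \<le> n - r"
    and row2: "row k = 2 \<longleftrightarrow> n - r < k" for k
    using rows_le by (auto simp: block_class_def)
  have col0: "col k = 0 \<longleftrightarrow> k \<le> c" and col1: "col k = 1 \<longleftrightarrow> c < k \<and> k \<le> n - s"
    and col2: "col k = 2 \<longleftrightarrow> n - s < k" for k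
    using cols_le by (auto simp: block_class_def)
  have mono: "col (v x) \<le> col (v y)" if "x \<in> {1..n}" "y \<in> {1..n}" "row x = row y" "x < y" for x y
    using block_increasingD[OF v(3) that(1,2,4,3)] by (intro block_class_mono) simp
  have "{k \<in> {1..n}. col k = 0} = {1..c}" "{k \<in> {1..n}. col k = 2} = {n - s<..n}"
    using cols_le by (auto simp: col0 col2)
  then have card_col: "card {k \<in> {1..n}. col k = 0} = c" "card {k \<in> {1..n}. col k = 2} = s"
    using cols_le by simp_all
  \<comment> \<open>Column sums: all of C_0 and all but one column of C_2 are used by middle
    rows.\<close>
  have c10: "cell_count v 1 0 = c" and c12: "cell_count v 1 2 = s - 1"
    using cell_count_col[OF v(1), of 0] cell_count_col[OF v(1), of 2] card_col counts
      cell_count_corner[OF v(2)] by simp_all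
  \<comment> \<open>Since v increases on the middle rows, those with values in C_0 are the first c
    of them.\<close>
  let ?A = "{k \<in> {1..n}. row k = 1 \<and> col (v k) = 0}"
  have A: "?A = {b<..b + c}"
  proof (rule down_closed_eq[of "{b<..n - r}"])
    show "card ?A = card {b<..b + c}" using c10 by (simp add: cell_count_def)
    show "x \<in> ?A" if "x \<in> {b<..n - r}" "y \<in> ?A" "x < y" for x y
      using mono[of x y] that row1[of x] rows_le by auto
  qed (use le in \<open>auto simp: row1\<close>)
  have low: "b < k \<and> k \<le> b + c" if "k \<in> {1..n}" "col (v k) = 0" for k
  proof -
    have "row k \<noteq> 0" using in_cellsD[OF v(2) that(1)] that(2) by (auto simp: corner_ok_def)
    moreover have "row k \<noteq> 2"
    proof
      assume "row k = 2"
      then have "k \<in> {k \<in> {1..n}. row k = 2 \<and> col (v k) = 0}" using that by simp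
      then show False using counts(2) unfolding cell_count_def by (subst (asm) card_eq_0_iff) auto
    qed
    ultimately have "k \<in> ?A" using that block_class_cases[of n b r k] by auto
    then show ?thesis unfolding A by simp
  qed
  \<comment> \<open>The only point of R_0 with value in C_2 is in the last row of R_0.\<close>
  let ?B = "{k \<in> {1..n}. row k = 0 \<and> col (v k) = 2}"
  have B: "?B = {b}"
  proof (rule up_closed_eq[of "{1..b}"])
    show "card ?B = card {b}" using counts(1) by (simp add: cell_count_def)
    show "x \<in> ?B" if "x \<in> {1..b}" "y \<in> ?B" "y < x" for x y
      using mono[of y x] that row0[of x] rows_le block_class_cases[of n c s "v x"] by auto
  qed (use pos in \<open>auto simp: row0\<close>)
  let ?C = "{k \<in> {1..n}. row k = 1 \<and> col (v k) = 2}"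
  define m where "m = n - r - (s - 1)"
  have m: "b + c < m" "card {m<..n - r} = s - 1" using le pos by (simp_all add: m_def)
  have C: "?C = {m<..n - r}"
  proof (rule up_closed_eq[of "{b<..n - r}"])
    show "card ?C = card {m<..n - r}" using c12 m(2) by (simp add: cell_count_def)
    show "x \<in> ?C" if x: "x \<in> {b<..n - r}" and y: "y \<in> ?C" and "y < x" for x y
    proof -
      have "x \<in> {1..n}" "row x = 1" using x by (auto simp: row1)
      then show ?thesis using mono[of y x] y \<open>y < x\<close> block_class_cases[of n c s "v x"] by auto
    qed
    show "x \<in> {m<..n - r}" if "x \<in> {b<..n - r}" "y \<in> {m<..n - r}" "y < x" for x y
      using that by simp
  qed (use m(1) in \<open>auto simp: row1\<close>)
  have mid_small: "col (v k) = 1" if "1 \<le> k" "k < b" for k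
  proof -
    have k: "k \<in> {1..n}" "row k = 0" using that rows_le by (auto simp: row0)
    have "col (v k) \<noteq> 0" using in_cellsD[OF v(2) k(1)] k(2) by (auto simp: corner_ok_def)
    moreover have "k \<notin> ?B" unfolding B using that by simp
    ultimately show ?thesis using k block_class_cases[of n c s "v k"] by auto
  qed
  \<comment> \<open>The middle columns used by rows up to b + c. They are the values of the rows 1,
    ..., b - 1, hence b - 1 in number, and by monotonicity of the inverse they are the first
    ones.\<close>
  let ?D = "{q \<in> {c<..n - s}. ?iv q \<le> ?i}"
  have "v ` {1..<b} = ?D"
  proof
    show "v ` {1..<b} \<subseteq> ?D"
      using mid_small by (auto simp: col1 permutes_inverses[OF v(1)])
    show "?D \<subseteq> v ` {1..<b}"
    proof
      fix q assume q: "q \<in> ?D"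
      then have qn: "q \<in> {1..n}" by auto
      let ?k = "?iv q"
      have k: "?k \<in> {1..n}" "v ?k = q" using permutes_mem[OF iv qn] permutes_inverses[OF v(1)] by auto
      have "col q = 1" using q by (simp add: col1)
      have "?k \<notin> ?A" "?k \<notin> ?B" using k(2) \<open>col q = 1\<close> by auto
      then have "\<not> (b < ?k \<and> ?k \<le> b + c)" "?k \<noteq> b" unfolding A B by simp_all
      then have "?k \<in> {1..<b}" using q k(1) by simp
      then show "q \<in> v ` {1..<b}" using k(2) by (intro image_eqI[of _ _ ?k]) simp_all
    qed
  qed
  then have card_D: "card ?D = b - 1"
    using card_image[OF inj_on_subset[OF permutes_inj[OF v(1)] subset_UNIV], of "{1..<b}"] by simp
  have inc_mid: "?iv p < ?iv q" if "p \<in> {c<..n - s}" "q \<in> {c<..n - s}" "p < q" for p q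
  proof -
    have "col p = 1" "col q = 1" "p \<in> {1..n}" "q \<in> {1..n}" using that by (auto simp: col1)
    then show ?thesis using that(3) by (intro block_increasingD[OF v(4)]) simp_all
  qed
  have D: "?D = {c<..<c + b}"
  proof (rule down_closed_eq[of "{c<..n - s}"])
    show "card ?D = card {c<..<c + b}" using card_D by simp
    show "x \<in> ?D" if "x \<in> {c<..n - s}" "y \<in> ?D" "x < y" for x y
      using inc_mid[of x y] that by auto
  qed (use le in auto)
  have small: "?iv q \<le> ?i" if "1 \<le> q" "q < ?i" for q
  proof (cases "q \<le> c")
    case True
    then have "?iv q \<in> {1..n}" "col (v (?iv q)) = 0"
      using that le permutes_mem[OF iv, of q] by (auto simp: col0 permutes_inverses[OF v(1)])
    then show ?thesis using low by blast
  next
    case False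
    then have "q \<in> ?D" unfolding D using that by auto
    then show ?thesis by simp
  qed
  \<comment> \<open>Row b + c + 1 comes after the middle rows with values in C_0 and before those
    with values in C_2, so it takes the first middle column outside \<open>?D\<close>.\<close>
  have next_val: "v (Suc ?i) = ?i"
  proof -
    have Si: "Suc ?i \<in> {1..n}" "row (Suc ?i) = 1" using le pos by (auto simp: row1)
    have "Suc ?i \<notin> ?A" unfolding A by simp
    moreover have "Suc ?i \<notin> ?C" unfolding C using m(1) by simp
    ultimately have "col (v (Suc ?i)) = 1" using Si block_class_cases[of n c s "v (Suc ?i)"] by auto
    then have q: "v (Suc ?i) \<in> {c<..n - s}" by (simp add: col1)
    have inv: "?iv (v (Suc ?i)) = Suc ?i" by (simp add: permutes_inverses[OF v(1)])
    then have "v (Suc ?i) \<notin> ?D" by simp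
    then have ge: "?i \<le> v (Suc ?i)" using q unfolding D by auto
    have "?i \<notin> ?D" unfolding D by simp
    moreover have i: "?i \<in> {c<..n - s}" using le pos by auto
    ultimately have "?i < ?iv ?i" by auto
    then have "\<not> ?i < v (Suc ?i)" using inc_mid[OF i q] inv by auto
    then show ?thesis using ge by simp
  qed
  obtain x y where xy: "x \<in> lists {Suc ?i..<n}" "y \<in> lists {1..<?i}" "reduced_word n v (x @ [?i] @ y)"
    using exists_split_word[OF v(1) _ _ small next_val] le pos by auto
  have "word_action (x @ [?i] @ y) wide_fun id = 0"
  proof (rule split_word_action_zero[OF xy(1,2)])
    fix p q assume p: "p permutes {Suc ?i..n}" and q: "q permutes {1..?i}"
    let ?s = "simple_transposition ?i"
    have p_fix: "p k = k" if "k \<le> ?i" for k using p that by (auto intro: permutes_not_in)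
    have p_above: "?i < p k" if "?i < k" for k
      using permutes_mem[OF p, of k] permutes_not_in[OF p, of k] that by (cases "k \<in> {Suc ?i..n}") auto
    have q_fix: "q k = k" if "?i < k" for k using q that by (auto intro: permutes_not_in)
    have q_le: "q k \<le> ?i" if "k \<le> ?i" for k
      using permutes_mem[OF q, of k] permutes_not_in[OF q, of k] that by (cases "k \<in> {1..?i}") auto
    \<comment> \<open>For k \<le> b the products can differ only if q k = b + c. Then one value is b
      + c and the other is even larger, so both exceed c.\<close>
    have upper: "(p \<circ> ?s \<circ> q) k \<le> c \<longleftrightarrow> (p \<circ> q) k \<le> c" if "k \<le> b" for k
    proof (cases "q k = ?i")
      case True
      then show ?thesis using p_above[of "Suc ?i"] p_fix[of ?i] pos by simp
    next
      case False
      then have "q k < ?i" using q_le[of k] that by simp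
      then show ?thesis by (simp add: Transposition.transpose_def)
    qed
    have lower: "(p \<circ> ?s \<circ> q) k = (p \<circ> q) k" if "n - r < k" for k
    proof -
      have "Suc ?i < k" using that le pos by linarith
      then show ?thesis using q_fix[of k] by (simp add: Transposition.transpose_def)
    qed
    have corner: "in_cells corner_ok (p \<circ> ?s \<circ> q) \<longleftrightarrow> in_cells corner_ok (p \<circ> q)"
      unfolding in_cells_corner_iff
    proof (rule ball_cong)
      fix k assume "k \<in> {1..n}"
      show "(\<not> (k \<le> b \<and> (p \<circ> ?s \<circ> q) k \<le> c) \<and> \<not> (n - r < k \<and> n - s < (p \<circ> ?s \<circ> q) k)) =
          (\<not> (k \<le> b \<and> (p \<circ> q) k \<le> c) \<and> \<not> (n - r < k \<and> n - s < (p \<circ> q) k))"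
        using upper[of k] lower[of k] by (simp del: comp_apply cong: conj_cong)
    qed simp
    have pn: "n \<in> {1..n}" "row n = 2" "?i < n" using le pos by (auto simp: row2)
    define k where "k = Hilbert_Choice.inv q 1"
    have k: "k \<in> {1..?i}" "q k = 1"
      unfolding k_def using permutes_mem[OF permutes_inv[OF q], of 1] pos
      by (simp_all add: permutes_inverses[OF q])
    \<comment> \<open>The value 1 in a row up to b + c must lie in block (1,0), which the narrow
      shape admits only if c differs from 1. Row n is then confined to C_0, but p sends n above b +
      c.\<close>
    have narrow: "\<not> in_cells narrow_ok u"
      if u: "u permutes {1..n}" "u k = 1" "u n = p n" for u
    proof
      assume narrow: "in_cells narrow_ok u"
      have "k \<in> {1..n}" using k(1) le by auto
      then have nk: "narrow_ok (row k) (col (u k))" by (rule in_cellsD[OF narrow])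
      have "col (u k) = 0" using u(2) pos by (simp add: col0)
      moreover have "row k \<noteq> 2" using k(1) le pos by (auto simp: row2)
      ultimately have "row k = 1" "c \<noteq> 1"
        using nk block_class_cases[of n b r k] by (auto simp: corner_ok_def narrow_ok_def)
      note this(2)
      moreover have "col (u n) \<noteq> 0" using u(3) p_above[OF pn(3)] pos by (simp add: col0)
      moreover have "narrow_ok 2 (col (u n))" using in_cellsD[OF narrow pn(1)] pn(2) by simp
      ultimately show False using block_class_cases[of n c s "u n"] by (auto simp: corner_ok_def narrow_ok_def)
    qed
    have "p \<circ> q permutes {1..n}" "p \<circ> ?s \<circ> q permutes {1..n}"
      using permutes_subset[OF p, of "{1..n}"] permutes_subset[OF q, of "{1..n}"] le pos
      by (auto intro!: permutes_compose simple_transposition_permutes simp del: comp_apply)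
    then have "\<not> in_cells narrow_ok (p \<circ> q)" "\<not> in_cells narrow_ok (p \<circ> ?s \<circ> q)"
      using narrow k(2) p_fix[of 1] q_fix[of n] pn(3) le pos by (auto simp: Transposition.transpose_def)
    then show "wide_fun (p \<circ> ?s \<circ> q) = wide_fun (p \<circ> q)"
      unfolding wide_fun_def corner by simp
  qed
  then show ?thesis using xy(3) by blast
qed

end

lemma block_class_singleton:
  "block_class n 1 z i = 0 \<Longrightarrow> 1 \<le> i \<Longrightarrow> i = 1" "block_class n a 1 i = 2 \<Longrightarrow> i \<le> n \<Longrightarrow> i = n"
  by (auto simp: block_class_def split: if_splits)

context blocks
begin

text \<open>The blocks (0,2) and (2,0) hold at most one point of v each, since each has a singleton
  row or column class. No points at all identify v with w, one in each yields a 321 through a middle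
  point, one in (0,2) only is handled by \<open>chain_action_zero\<close>, and one in (2,0) only by
  its mirror image under inversion.\<close>

lemma wide_action_zero:
  assumes bs: "b = 1 \<or> s = 1" and cr: "c = 1 \<or> r = 1" and pos: "1 \<le> b" "1 \<le> c" "1 \<le> r" "1 \<le> s"
    and v: "v \<in> avoiders_321 n"
    and w: "w permutes {1..n}" "in_cells corner_ok w" "block_increasing n b r w"
      "block_increasing n c s (Hilbert_Choice.inv w)"
    and counts: "cell_count w 0 2 = 0" "cell_count w 2 0 = 0"
    and ne: "v \<noteq> w"
  shows "word_action (basis_word n v) wide_fun id = 0"
proof (rule ccontr)
  assume nz: "word_action (basis_word n v) wide_fun id \<noteq> 0"
  have vp: "v permutes {1..n}" "\<not> has_321 v" using v by (auto simp: avoiders_321_iff)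
  note wide = tl_functional_wide[OF bs cr]
  have right: "wide_fun (u \<circ> Transposition.transpose i j) = wide_fun u"
    if "i \<in> {1..n}" "j \<in> {1..n}" "row i = row j" for u i j
    by (simp add: wide_fun_def in_cells_right[OF that] del: comp_apply)
  have left: "wide_fun (Transposition.transpose p q \<circ> u) = wide_fun u" if "col p = col q" for u p q
    by (simp add: wide_fun_def in_cells_left[OF that] del: comp_apply)
  have cells: "wide_fun u = 0" if not: "\<not> in_cells corner_ok u" for u
  proof -
    have "\<not> in_cells narrow_ok u" using not unfolding in_cells_def narrow_ok_def by blast
    then show ?thesis using not by (simp add: wide_fun_def)
  qed
  have props: "block_increasing n b r v" "block_increasing n c s (Hilbert_Choice.inv v)" "in_cells corner_ok v"
    using block_increasing_if_action_nonzero[OF wide v right left cells nz] by blast+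
  have row_cards: "card {i \<in> {1..n}. row i = 1} = n - b - r"
    and col_cards: "card {i \<in> {1..n}. col i = 0} = c" "card {i \<in> {1..n}. col i = 2} = s"
  proof -
    have "{i \<in> {1..n}. row i = 1} = {b<..n - r}" "{i \<in> {1..n}. col i = 0} = {1..c}"
        "{i \<in> {1..n}. col i = 2} = {n - s<..n}"
      using rows_le cols_le by (auto simp: block_class_def split: if_splits)
    then show "card {i \<in> {1..n}. row i = 1} = n - b - r"
      "card {i \<in> {1..n}. col i = 0} = c" "card {i \<in> {1..n}. col i = 2} = s"
      using rows_le cols_le by simp_all
  qed
  \<comment> \<open>All c + s outer columns of w are used by middle rows, because the four corner
    blocks are empty for w.\<close>
  have le: "b + c + r + s \<le> n"
    using cell_count_col[OF w(1), of 0] cell_count_col[OF w(1), of 2] cell_count_row[of w 1]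
      cell_count_corner[OF w(2)] counts row_cards col_cards rows_le by linarith
  have le1: "cell_count v p q \<le> 1" if small: "(p = 0 \<and> b = 1) \<or> (p = 2 \<and> r = 1) \<or> (q = 0 \<and> c = 1) \<or> (q = 2 \<and> s = 1)" for p q
  proof -
    let ?S = "{i \<in> {1..n}. row i = p \<and> col (v i) = q}"
    have eq: "x = y" if xy: "x \<in> ?S" "y \<in> ?S" for x y
    proof -
      have v: "v x \<in> {1..n}" "v y \<in> {1..n}" using xy permutes_mem[OF vp(1)] by auto
      have "\<exists>k. x = k \<and> y = k \<or> v x = k \<and> v y = k" using small
      proof (elim disjE conjE)
        assume "p = 0" "b = 1"
        then have "x = 1" "y = 1" using xy by (auto intro: block_class_singleton)
        then show ?thesis by blast
      next
        assume "p = 2" "r = 1"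
        then have "x = n" "y = n" using xy by (auto intro: block_class_singleton)
        then show ?thesis by blast
      next
        assume "q = 0" "c = 1"
        then have "v x = 1" "v y = 1" using xy v by (auto intro: block_class_singleton)
        then show ?thesis by blast
      next
        assume "q = 2" "s = 1"
        then have "v x = n" "v y = n" using xy v by (auto intro: block_class_singleton)
        then show ?thesis by blast
      qed
      then have "x = y \<or> v x = v y" by auto
      then show ?thesis using inj_eq[OF permutes_inj[OF vp(1)]] by blast
    qed
    show ?thesis
    proof (cases "?S = {}")
      case True
      then show ?thesis unfolding cell_count_def True by simp
    next
      case False
      then obtain x where "x \<in> ?S" by blast
      then have "?S \<subseteq> {x}" using eq by blast
      then show ?thesis unfolding cell_count_def using card_mono[of "{x}" ?S] by simp
    qed
  qed
  have y: "cell_count v 0 2 \<le> 1" using bs by (intro le1) auto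
  have z: "cell_count v 2 0 \<le> 1" using cr by (intro le1) auto
  consider "cell_count v 0 2 = 0" "cell_count v 2 0 = 0" | "cell_count v 0 2 = 1" "cell_count v 2 0 = 1"
    | "cell_count v 0 2 = 1" "cell_count v 2 0 = 0" | "cell_count v 0 2 = 0" "cell_count v 2 0 = 1"
    using y z by linarith
  then show False
  proof cases
    case 1
    then have "v = w" using counts by (intro block_perm_unique[OF vp(1) props(3,1,2) w]) auto
    then show False using ne by simp
  next
    case 2
    \<comment> \<open>Of the n - b - r middle rows just (c - 1) + (s - 1) go to outer columns, so
      some go to middle ones.\<close>
    have "cell_count v 1 1 \<noteq> 0"
      using cell_count_col[OF vp(1), of 0] cell_count_col[OF vp(1), of 2] cell_count_row[of v 1]
        cell_count_corner[OF props(3)] 2 row_cards col_cards le by linarith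
    then obtain j where j: "row j = 1" "col (v j) = 1" by (rule cell_count_neq_0E)
    have "cell_count v 0 2 \<noteq> 0" "cell_count v 2 0 \<noteq> 0" using 2 by simp_all
    then obtain i k where i: "row i = 0" "col (v i) = 2" and k: "row k = 2" "col (v k) = 0"
      by (elim cell_count_neq_0E)
    have "\<not> j \<le> i" using block_class_mono[of j i n b r] i(1) j(1) by (intro notI) simp
    moreover have "\<not> k \<le> j" using block_class_mono[of k j n b r] k(1) j(1) by (intro notI) simp
    moreover have "\<not> v i \<le> v j" using block_class_mono[of "v i" "v j" n c s] i(2) j(2) by (intro notI) simp
    moreover have "\<not> v j \<le> v k" using block_class_mono[of "v j" "v k" n c s] k(2) j(2) by (intro notI) simp
    ultimately have "i < j" "j < k" "v j < v i" "v k < v j" by simp_all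
    then show False using vp(2) unfolding has_321_def by blast
  next
    case 3
    then obtain x where "reduced_word n v x" "word_action x wide_fun id = 0"
      using chain_action_zero[OF vp(1) props(3,1,2) _ _ pos le] by blast
    then show False using nz basis_word_action_eq[OF v _ wide] by simp
  next
    case 4
    interpret sw: blocks n c b s r by (rule swapped)
    let ?iv = "Hilbert_Choice.inv v"
    have ivp: "?iv permutes {1..n}" by (rule permutes_inv[OF vp(1)])
    have count: "sw.cell_count ?iv p q = cell_count v q p" for p q
    proof -
      have "v ` {i \<in> {1..n}. row i = q \<and> col (v i) = p} = {j \<in> {1..n}. col j = p \<and> row (?iv j) = q}"
      proof
        show "{j \<in> {1..n}. col j = p \<and> row (?iv j) = q} \<subseteq> v ` {i \<in> {1..n}. row i = q \<and> col (v i) = p}"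
        proof
          fix j assume "j \<in> {j \<in> {1..n}. col j = p \<and> row (?iv j) = q}"
          then show "j \<in> v ` {i \<in> {1..n}. row i = q \<and> col (v i) = p}"
            using permutes_mem[OF ivp] by (intro image_eqI[of _ _ "?iv j"]) (auto simp: permutes_inverses[OF vp(1)])
        qed
      qed (use permutes_mem[OF vp(1)] in \<open>auto simp: permutes_inverses[OF vp(1)]\<close>)
      then show ?thesis
        unfolding sw.cell_count_def cell_count_def
        using card_image[OF inj_on_subset[OF permutes_inj[OF vp(1)] subset_UNIV]] by metis
    qed
    have "sw.in_cells corner_ok ?iv" using corner_cells_inv[OF vp(1)] props(3) by simp
    moreover have "block_increasing n b r (Hilbert_Choice.inv ?iv)" using props(1) by (simp add: permutes_inv_inv[OF vp(1)])
    ultimately obtain x where x: "reduced_word n ?iv x" "word_action x sw.wide_fun id = 0"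
      using sw.chain_action_zero[OF ivp _ props(2)] 4 count pos le by (auto simp: add_ac)
    have red: "reduced_word n v (rev x)"
      using reduced_word_rev[OF x(1)] by (simp add: permutes_inv_inv[OF vp(1)])
    have xl: "x \<in> lists {1..<n}" using x(1) by (simp add: reduced_word_iff)
    have "word_action (rev x) wide_fun id = word_action (rev x) (\<lambda>u. sw.wide_fun (Hilbert_Choice.inv u)) id"
      by (rule word_action_cong[OF _ _ permutes_id]) (use xl wide_fun_inv in auto)
    also have "\<dots> = word_action x (\<lambda>u. sw.wide_fun (u \<circ> Hilbert_Choice.inv id)) id"
      by (rule word_action_rev_inv[OF xl permutes_id])
    also have "\<dots> = 0" using x(2) by (simp add: inv_id del: id_apply)
    finally show False using nz basis_word_action_eq[OF v red wide] by simp
  qed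
qed

end

section \<open>Sums of percent immanants\<close>

text \<open>The sign of w matches the normalisation of h at w; the sign of u converts the dual
  function back to the coefficient.\<close>

lemma signed_tl_immanant_eq:
  assumes "w \<in> avoiders_321 n" "tl_functional n h" "h w = 1"
    and "\<And>v. v \<in> avoiders_321 n \<Longrightarrow> v \<noteq> w \<Longrightarrow> word_action (basis_word n v) h id = 0"
  shows "of_int (sign w) * tl_immanant n w = perm_sum n (\<lambda>u. of_int (sign u) * h u)"
  unfolding tl_immanant_eq of_int_mult_perm_sum
proof (rule perm_sum_cong)
  fix u assume "u permutes {1..n}"
  then have "h u = of_int (sign w) * tl_dual n w u"
    by (rule tl_dual_characterisation[OF assms(1-3), rotated]) (rule assms(4))
  then show "of_int (sign w) * tl_coefficient n w u = of_int (sign u) * h u"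
    by (simp add: tl_dual_def mult.left_commute sign_sq)
qed

context blocks
begin

lemma perm_sum_in_percent_immanants:
  assumes "\<exists>l m. skew_shape n l m \<and> (\<forall>u. u permutes {1..n} \<longrightarrow> lies_in n l m u = in_cells ok u)"
  shows "perm_sum n (\<lambda>u. of_int (sign u) * (if in_cells ok u then 1 else 0)) \<in> percent_immanants n"
proof -
  obtain l m where lm: "skew_shape n l m" "\<And>u. u permutes {1..n} \<Longrightarrow> lies_in n l m u = in_cells ok u"
    using assms by blast
  have "perm_sum n (\<lambda>u. of_int (sign u) * (if in_cells ok u then 1 else 0)) = percent_immanant n l m"
    unfolding percent_immanant_eq by (rule perm_sum_cong) (simp add: lm(2))
  then show ?thesis using lm(1) unfolding percent_immanants_def by blast
qed

lemma signed_tl_immanant_degenerate: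
  assumes deg: degenerate and w: "w \<in> avoiders_321 n" "in_cells corner_ok w" "block_increasing n b r w"
    "block_increasing n c s (Hilbert_Choice.inv w)"
  shows "of_int (sign w) * tl_immanant n w \<in> percent_immanants n"
proof -
  have wp: "w permutes {1..n}" using w(1) by (simp add: avoiders_321_iff)
  have "of_int (sign w) * tl_immanant n w = perm_sum n (\<lambda>u. of_int (sign u) * corner_fun u)"
  proof (rule signed_tl_immanant_eq[OF w(1) tl_functional_corner[OF deg]])
    show "corner_fun w = 1" using w(2) by (simp add: corner_fun_def)
  qed (rule degenerate_action_zero[OF deg _ wp w(2-4)])
  then show ?thesis unfolding corner_fun_def using perm_sum_in_percent_immanants[OF corner_shape] by simp
qed

lemma signed_tl_immanant_wide:
  assumes bs: "b = 1 \<or> s = 1" and cr: "c = 1 \<or> r = 1" and pos: "1 \<le> b" "1 \<le> c" "1 \<le> r" "1 \<le> s"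
    and w: "w \<in> avoiders_321 n" "in_cells corner_ok w" "\<not> in_cells narrow_ok w"
      "block_increasing n b r w" "block_increasing n c s (Hilbert_Choice.inv w)"
    and counts: "cell_count w 0 2 = 0" "cell_count w 2 0 = 0"
  shows "\<exists>f g. f \<in> percent_immanants n \<and> g \<in> percent_immanants n \<and> of_int (sign w) * tl_immanant n w = f + g"
proof -
  have wp: "w permutes {1..n}" using w(1) by (simp add: avoiders_321_iff)
  have "of_int (sign w) * tl_immanant n w = perm_sum n (\<lambda>u. of_int (sign u) * wide_fun u)"
  proof (rule signed_tl_immanant_eq[OF w(1) tl_functional_wide[OF bs cr]])
    show "wide_fun w = 1" using w(2,3) by (simp add: wide_fun_def)
  qed (rule wide_action_zero[OF bs cr pos _ wp w(2,4,5) counts])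
  also have "\<dots> = perm_sum n (\<lambda>u. of_int (sign u) * (if in_cells corner_ok u then 1 else 0)) +
      perm_sum n (\<lambda>u. of_int (sign u) * (if in_cells narrow_ok u then 1 else 0))"
    unfolding perm_sum_add wide_fun_def distrib_left ..
  finally show ?thesis
    using perm_sum_in_percent_immanants[OF corner_shape] perm_sum_in_percent_immanants[OF narrow_shape] by blast
qed

end

section \<open>From avoided patterns to the block structure\<close>

lemma not_has_321_inv:
  assumes w: "w permutes {1..n}" and no: "\<not> has_321 w"
  shows "\<not> has_321 (Hilbert_Choice.inv w)"
proof
  let ?iw = "Hilbert_Choice.inv w"
  assume "has_321 ?iw"
  then obtain x y z where "x < y" "y < z" "?iw z < ?iw y" "?iw y < ?iw x" by (auto simp: has_321_def)
  moreover have "w (?iw x) = x" "w (?iw y) = y" "w (?iw z) = z" by (simp_all add: permutes_inverses[OF w])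
  ultimately have "has_321 w"
    unfolding has_321_def by (intro exI[of _ "?iw z"] exI[of _ "?iw y"] exI[of _ "?iw x"]) simp
  then show False using no by simp
qed

lemma avoids_1324_inv:
  assumes w: "w permutes {1..n}" and no: "avoids_pattern n w [1, 3, 2, 4]"
  shows "avoids_pattern n (Hilbert_Choice.inv w) [1, 3, 2, 4]"
proof
  let ?iw = "Hilbert_Choice.inv w"
  have iw: "?iw permutes {1..n}" by (rule permutes_inv[OF w])
  assume "contains_pattern n ?iw [1, 3, 2, 4]"
  then obtain a b c d where abcd: "1 \<le> a" "a < b" "b < c" "c < d" "d \<le> n"
      "?iw a < ?iw c" "?iw c < ?iw b" "?iw b < ?iw d"
    unfolding contains_1324_iff[OF iw] by blast
  have "?iw a \<in> {1..n}" "?iw d \<in> {1..n}" using abcd by (simp_all only: permutes_in_image[OF iw]) auto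
  moreover have "w (?iw x) = x" for x by (simp add: permutes_inverses[OF w])
  ultimately have "contains_pattern n w [1, 3, 2, 4]"
    unfolding contains_1324_iff[OF w] using abcd
    by (intro exI[of _ "?iw a"] exI[of _ "?iw c"] exI[of _ "?iw b"] exI[of _ "?iw d"]) simp
  then show False using no by simp
qed

text \<open>The blocks are the rows before the value 1, the rows after the value n, and the rest. A
  descent in the first block followed by 1, or one in the last preceded by n, is a 321; a descent in
  the middle framed by 1 and n is a 1324.\<close>

lemma avoider_block_increasing:
  assumes w: "w permutes {1..n}" and no_321: "\<not> has_321 w" and no_1324: "avoids_pattern n w [1, 3, 2, 4]"
    and n: "1 \<le> n" and p: "p = Hilbert_Choice.inv w 1" and q: "q = Hilbert_Choice.inv w n"
  shows "p - 1 + (n - q) \<le> n" "block_increasing n (p - 1) (n - q) w"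
proof -
  have iw: "Hilbert_Choice.inv w permutes {1..n}" by (rule permutes_inv[OF w])
  have pq: "p \<in> {1..n}" "q \<in> {1..n}" unfolding p q using n by (simp_all only: permutes_in_image[OF iw]) auto
  have wpq: "w p = 1" "w q = n" by (simp_all add: p q permutes_inverses[OF w])
  have inj: "w x = w y \<longleftrightarrow> x = y" for x y by (rule inj_eq[OF permutes_inj[OF w]])
  have range: "w x \<in> {1..n}" if "x \<in> {1..n}" for x using that by (simp only: permutes_in_image[OF w])
  have above: "1 < w x" if "x \<in> {1..n}" "x \<noteq> p" for x
    using range[OF that(1)] inj[of x p] wpq(1) that(2) by (cases "w x = 1") auto
  have below: "w x < n" if "x \<in> {1..n}" "x \<noteq> q" for x
    using range[OF that(1)] inj[of x q] wpq(2) that(2) by (cases "w x = n") auto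
  \<comment> \<open>The case p = q + 1, with an empty middle block, is possible; any larger gap
    contains a row whose value completes a 321 with n and 1.\<close>
  have "p \<le> Suc q"
  proof (rule ccontr)
    assume "\<not> p \<le> Suc q"
    then have "q < Suc q" "Suc q < p" "Suc q \<in> {1..n}" using pq by auto
    then have "has_321 w" unfolding has_321_def using above[of "Suc q"] below[of "Suc q"] wpq
      by (intro exI[of _ q] exI[of _ "Suc q"] exI[of _ p]) simp
    then show False using no_321 by simp
  qed
  then show "p - 1 + (n - q) \<le> n" using pq by simp
  have "i \<le> p - 1 \<longleftrightarrow> i < p" "n - (n - q) = q" for i using pq by auto
  then have cls: "block_class n (p - 1) (n - q) i = (if i < p then 0 else if q < i then 2 else 1)" for i
    by (simp add: block_class_def)
  show "block_increasing n (p - 1) (n - q) w"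
    unfolding block_increasing_def
  proof (intro allI impI)
    fix i j
    assume ij: "1 \<le> i" "i < j" "j \<le> n" "block_class n (p - 1) (n - q) i = block_class n (p - 1) (n - q) j"
    show "w i < w j"
    proof (rule ccontr)
      assume "\<not> w i < w j"
      then have desc: "w j < w i" using inj[of i j] ij(2) by simp
      have mem: "i \<in> {1..n}" "j \<in> {1..n}" using ij by auto
      have "j < p \<or> q < i \<or> p \<le> i \<and> j \<le> q"
        using ij(2,4) by (auto simp: cls split: if_splits)
      then consider "j < p" | "q < i" | "p \<le> i" "j \<le> q" by blast
      then show False
      proof cases
        case 1
        then have "has_321 w" unfolding has_321_def using above[OF mem(2)] wpq ij(2) desc
          by (intro exI[of _ i] exI[of _ j] exI[of _ p]) simp
        then show False using no_321 by simp
      next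
        case 2
        then have "has_321 w" unfolding has_321_def using below[OF mem(1)] wpq ij(2) desc
          by (intro exI[of _ q] exI[of _ i] exI[of _ j]) simp
        then show False using no_321 by simp
      next
        case 3
        have "i \<noteq> p" using desc range[OF mem(2)] wpq(1) by auto
        moreover have "j \<noteq> q" using desc range[OF mem(1)] wpq(2) by auto
        ultimately have "contains_pattern n w [1, 3, 2, 4]"
          unfolding contains_1324_iff[OF w]
          using 3 pq wpq ij(2) desc above[OF mem(2)] below[OF mem(1)]
          by (intro exI[of _ p] exI[of _ i] exI[of _ j] exI[of _ q]) auto
        then show False using no_1324 by simp
      qed
    qed
  qed
qed

text \<open>Every failure of a required block property is completed to a forbidden pattern by some
  of the rows 1, p, q, n, whose values are x, 1, n, y.\<close>

lemma signed_tl_immanant_if_avoids: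
  assumes w: "w permutes {1..n}" and no_321: "avoids_pattern n w [3, 2, 1]"
    and no_1324: "avoids_pattern n w [1, 3, 2, 4]" and no_24153: "avoids_pattern n w [2, 4, 1, 5, 3]"
    and no_31524: "avoids_pattern n w [3, 1, 5, 2, 4]" and no_231564: "avoids_pattern n w [2, 3, 1, 5, 6, 4]"
    and no_312645: "avoids_pattern n w [3, 1, 2, 6, 4, 5]"
  shows "of_int (sign w) * tl_immanant n w \<in> percent_immanants n \<or>
    (\<exists>f g. f \<in> percent_immanants n \<and> g \<in> percent_immanants n \<and> of_int (sign w) * tl_immanant n w = f + g)"
proof (cases "n = 0")
  case True
  \<comment> \<open>Without rows there is no value 1 from which to read off the blocks; all sizes 0
    satisfy b + r = n and are thus degenerate.\<close>
  interpret blocks n 0 0 0 0 by unfold_locales simp_all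
  have "of_int (sign w) * tl_immanant n w \<in> percent_immanants n"
  proof (rule signed_tl_immanant_degenerate)
    show degenerate unfolding degenerate_def using True by simp
    show "in_cells corner_ok w" unfolding in_cells_def using True by simp
    show "w \<in> avoiders_321 n" using w no_321 by (simp add: avoiders_321_def)
  qed (use True in \<open>auto simp: block_increasing_def\<close>)
  then show ?thesis ..
next
  case False
  let ?iw = "Hilbert_Choice.inv w"
  have iw: "?iw permutes {1..n}" by (rule permutes_inv[OF w])
  have avoider: "w \<in> avoiders_321 n" and h321: "\<not> has_321 w"
    using w no_321 contains_321_iff_has_321[OF w] by (simp_all add: avoiders_321_def)
  define p q x y where pqxy: "p = ?iw 1" "q = ?iw n" "x = w 1" "y = w n"
  define b c r s where bcrs: "b = p - 1" "c = x - 1" "r = n - q" "s = n - y"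
  have wpq: "w p = 1" "w q = n" by (simp_all add: pqxy permutes_inverses[OF w])
  have range: "w i \<in> {1..n}" if "i \<in> {1..n}" for i using that by (simp only: permutes_in_image[OF w])
  have irange: "?iw i \<in> {1..n}" if "i \<in> {1..n}" for i using that by (simp only: permutes_in_image[OF iw])
  have one: "1 \<in> {1..n}" and last: "n \<in> {1..n}" using False by auto
  have mem: "p \<in> {1..n}" "q \<in> {1..n}" "x \<in> {1..n}" "y \<in> {1..n}"
    unfolding pqxy using range irange one last by blast+
  have inj: "w i = w j \<longleftrightarrow> i = j" for i j by (rule inj_eq[OF permutes_inj[OF w]])
  have above: "1 < w i" if "i \<in> {1..n}" "i \<noteq> p" for i
    using range[OF that(1)] inj[of i p] wpq(1) that(2) by (cases "w i = 1") auto
  have below: "w i < n" if "i \<in> {1..n}" "i \<noteq> q" for i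
    using range[OF that(1)] inj[of i q] wpq(2) that(2) by (cases "w i = n") auto
  have n1: "1 \<le> n" using False by simp
  have le_rows: "b + r \<le> n" and inc_rows: "block_increasing n b r w"
    unfolding bcrs using avoider_block_increasing[OF w h321 no_1324 n1 pqxy(1,2)] by simp_all
  have xy: "x = Hilbert_Choice.inv ?iw 1" "y = Hilbert_Choice.inv ?iw n"
    by (simp_all add: pqxy permutes_inv_inv[OF w])
  have le_cols: "c + s \<le> n" and inc_cols: "block_increasing n c s ?iw"
    unfolding bcrs
    using avoider_block_increasing[OF iw not_has_321_inv[OF w h321] avoids_1324_inv[OF w no_1324] n1 xy]
    by simp_all
  interpret blocks n b c r s by unfold_locales (fact le_rows le_cols)+
  have nr: "n - r = q" and ns: "n - s = y" using mem by (simp_all add: bcrs)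
  have b_le: "i \<le> b \<longleftrightarrow> i < p" and c_le: "i \<le> c \<longleftrightarrow> i < x" for i using mem by (auto simp: bcrs)
  have row0: "row i = 0 \<longleftrightarrow> i < p" and row2: "row i = 2 \<longleftrightarrow> p \<le> i \<and> q < i" for i
    by (auto simp: block_class_def b_le nr)
  have col0: "col i = 0 \<longleftrightarrow> i < x" and col2: "col i = 2 \<longleftrightarrow> x \<le> i \<and> y < i" for i
    by (auto simp: block_class_def c_le ns)
  have corner: "in_cells corner_ok w"
    unfolding in_cells_corner_iff nr ns b_le c_le
  proof (intro ballI conjI notI)
    fix i assume i: "i \<in> {1..n}"
    assume "i < p \<and> w i < x"
    then have "i < p" "w i < x" by simp_all
    moreover from this have "1 < i" using i by (cases "i = 1") (auto simp: pqxy)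
    ultimately have "has_321 w"
      unfolding has_321_def using above[OF i] wpq
      by (intro exI[of _ 1] exI[of _ i] exI[of _ p]) (simp add: pqxy(3))
    then show False using h321 by simp
  next
    fix i assume i: "i \<in> {1..n}"
    assume *: "q < i \<and> y < w i"
    then have "i < n" using i by (cases "i = n") (auto simp: pqxy)
    then have "has_321 w"
      unfolding has_321_def using * below[OF i] wpq
      by (intro exI[of _ q] exI[of _ i] exI[of _ n]) (simp add: pqxy(4))
    then show False using h321 by simp
  qed
  show ?thesis
  proof (cases degenerate)
    case True
    then show ?thesis using signed_tl_immanant_degenerate[OF _ avoider corner inc_rows inc_cols] by blast
  next
    case nondeg: False
    have nd: "b + r \<noteq> n" "c + s \<noteq> n" "\<not> (b = 0 \<and> c = 0)" "\<not> (r = 0 \<and> s = 0)"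
      using nondeg unfolding degenerate_def by blast+
    \<comment> \<open>Both p = 1 and x = 1 say that w fixes 1, so b and c vanish together, which is
      excluded; similarly for r and s with n.\<close>
    have "p = 1 \<longleftrightarrow> x = 1" using inj[of 1 p] wpq(1) by (auto simp: pqxy(3))
    then have pos1: "1 < p" "1 < x" using nd(3,4) mem by (auto simp: bcrs)
    have "q = n \<longleftrightarrow> y = n" using inj[of n q] wpq(2) by (auto simp: pqxy(4))
    then have pos2: "q < n" "y < n" using nd(3,4) mem by (auto simp: bcrs)
    have "p \<noteq> q" using wpq pos1 mem by auto
    then have pq: "p < q" using nd(1) mem le_rows pos1 by (simp add: bcrs)
    have "x \<noteq> y" using inj[of 1 n] mem pos2 by (auto simp: pqxy)
    then have xy: "x < y" using nd(2) mem le_cols pos1 by (simp add: bcrs)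
    have pos: "1 \<le> b" "1 \<le> c" "1 \<le> r" "1 \<le> s" using pos1 pos2 by (simp_all add: bcrs)
    \<comment> \<open>The rows 1, i, p, q, n would carry x, w i, 1, n, y with 1 < x < y < w i < n, a
      24153.\<close>
    have no_02: "\<not> (i < p \<and> y < w i)" if i: "i \<in> {1..n}" for i
    proof
      assume *: "i < p \<and> y < w i"
      then have "i \<noteq> 1" using xy by (auto simp: pqxy(3))
      then have "1 < i" using i by simp
      then have "contains_pattern n w [2, 4, 1, 5, 3]"
        unfolding contains_24153_iff[OF w] using * pq pos1 pos2 xy wpq below[OF i]
        by (intro exI[of _ 1] exI[of _ i] exI[of _ p] exI[of _ q] exI[of _ n])
          (simp add: pqxy(3,4)[symmetric])
      then show False using no_24153 by simp
    qed
    \<comment> \<open>The rows 1, p, q, i, n would carry x, 1, n, w i, y with 1 < w i < x < y < n, a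
      31524.\<close>
    have no_20: "\<not> (q < i \<and> w i < x)" if i: "i \<in> {1..n}" for i
    proof
      assume *: "q < i \<and> w i < x"
      then have "i \<noteq> n" using xy by (auto simp: pqxy(4))
      then have "i < n" using i by simp
      then have "contains_pattern n w [3, 1, 5, 2, 4]"
        unfolding contains_31524_iff[OF w] using * pq pos1 pos2 xy wpq above[OF i]
        by (intro exI[of _ 1] exI[of _ p] exI[of _ q] exI[of _ i] exI[of _ n])
          (simp add: pqxy(3,4)[symmetric])
      then show False using no_31524 by simp
    qed
    have counts: "cell_count w 0 2 = 0" "cell_count w 2 0 = 0"
      unfolding cell_count_eq_0_iff row0 row2 col0 col2 using no_02 no_20 by blast+
    have no_00: "\<not> (i < p \<and> w i < x)" and no_22: "\<not> (q < i \<and> y < w i)" if "i \<in> {1..n}" for i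
      using corner that unfolding in_cells_corner_iff nr ns b_le c_le by auto
    have w1: "w 1 = x" and wn: "w n = y" by (simp_all add: pqxy)
    define m where "m = n - 1"
    \<comment> \<open>Otherwise the rows 1, 2, p, j, q, n with w j = n - 1 carry x, w 2, 1, n - 1,
      n, y, a 231564.\<close>
    have bs: "b = 1 \<or> s = 1"
    proof (rule ccontr)
      assume "\<not> ?thesis"
      then have "2 < p" "y < n - 1" using pos1 pos2 by (auto simp: bcrs)
      then have ge: "2 < p" "y < m" "m < n" by (auto simp: m_def)
      have two: "2 \<in> {1..n}" using ge mem by auto
      have "row 1 = 0" "row 2 = 0" using ge by (simp_all add: row0)
      then have w2: "x < w 2" using block_increasingD[OF inc_rows one two] by (simp add: w1)
      have "w 2 \<noteq> y" using inj[of 2 n] ge(1) mem(1) wn by auto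
      then have w2': "w 2 < y" using no_02[OF two] ge(1) by simp
      define j where "j = ?iw m"
      have wj: "w j = m" by (simp add: j_def permutes_inverses[OF w])
      have j: "j \<in> {1..n}" unfolding j_def using ge mem by (intro irange) auto
      have "j \<noteq> p" using wj wpq(1) ge mem(4) by auto
      moreover have "j \<noteq> q" using wj wpq(2) ge by auto
      moreover have "\<not> j < p" using no_02[OF j] wj ge by simp
      moreover have "\<not> q < j" using no_22[OF j] wj ge by simp
      ultimately have j': "p < j" "j < q" by simp_all
      have "contains_pattern n w [2, 3, 1, 5, 6, 4]"
        unfolding contains_231564_iff[OF w]
        by (intro exI[of _ 1] exI[of _ 2] exI[of _ p] exI[of _ j] exI[of _ q] exI[of _ n])
          (simp add: w1 wn wpq wj w2 w2' j' pos1 pos2 ge)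
      then show False using no_231564 by simp
    qed
    \<comment> \<open>Otherwise the rows 1, p, j, q, n - 1, n with w j = 2 carry x, 1, 2, n, w (n -
      1), y, a 312645.\<close>
    have cr: "c = 1 \<or> r = 1"
    proof (rule ccontr)
      assume "\<not> ?thesis"
      then have "2 < x" "q < n - 1" using pos1 pos2 by (auto simp: bcrs)
      then have ge: "2 < x" "q < m" "m < n" by (auto simp: m_def)
      have prev: "m \<in> {1..n}" using ge mem by auto
      have "row m = 2" "row n = 2" using ge pq by (simp_all add: row2)
      then have wm: "w m < y" using block_increasingD[OF inc_rows prev last ge(3)] by (simp add: wn)
      have "w m \<noteq> x" using inj[of m 1] ge mem(2) w1 by auto
      then have wm': "x < w m" using no_20[OF prev] ge(2) by simp
      define j where "j = ?iw 2"
      have wj: "w j = 2" by (simp add: j_def permutes_inverses[OF w])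
      have j: "j \<in> {1..n}" unfolding j_def using ge mem by (intro irange) auto
      have "j \<noteq> p" using wj wpq(1) by auto
      moreover have "j \<noteq> q" using wj wpq(2) ge mem(3) by auto
      moreover have "\<not> j < p" using no_00[OF j] wj ge by simp
      moreover have "\<not> q < j" using no_20[OF j] wj ge by simp
      ultimately have j': "p < j" "j < q" by simp_all
      have "contains_pattern n w [3, 1, 2, 6, 4, 5]"
        unfolding contains_312645_iff[OF w]
        by (intro exI[of _ 1] exI[of _ p] exI[of _ j] exI[of _ q] exI[of _ m] exI[of _ n])
          (simp add: w1 wn wpq wj wm wm' j' pos1 pos2 ge)
      then show False using no_312645 by simp
    qed
    \<comment> \<open>The points (p, 1) and (n, y) of w lie in the blocks (1,0) and (2,1), one of
      which is removed from the narrow shape. Thus w is counted only once.\<close>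
    have "\<not> in_cells narrow_ok w"
    proof
      assume narrow: "in_cells narrow_ok w"
      have "row p = 1" "row n = 2" "col (w p) = 0" "col (w n) = 1"
        using pq xy pos1 pos2 block_class_cases[of n b r p] block_class_cases[of n c s "w n"]
        by (auto simp: row0 row2 col0 col2 wpq wn)
      then show False
        using in_cellsD[OF narrow mem(1)] in_cellsD[OF narrow last]
        by (auto simp: narrow_ok_def split: if_splits)
    qed
    then show ?thesis
      using signed_tl_immanant_wide[OF bs cr pos avoider corner _ inc_rows inc_cols counts] by blast
  qed
qed

section \<open>The equivalence of the three statements\<close>

lemma is_sum_of_at_most_two:
  assumes "(f :: matrix_poly) \<in> S \<or> (\<exists>g h. g \<in> S \<and> h \<in> S \<and> f = g + h)"
  shows "is_sum_of_at_most 2 f S"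
  using assms
proof (elim disjE exE conjE)
  show "is_sum_of_at_most 2 f S" if "f \<in> S"
    unfolding is_sum_of_at_most_def using that by (intro exI[of _ "[f]"]) simp
  show "is_sum_of_at_most 2 f S" if "g \<in> S" "h \<in> S" "f = g + h" for g h
    unfolding is_sum_of_at_most_def using that by (intro exI[of _ "[g, h]"]) simp
qed

text \<open>Linear combinations are indexed by a set, so a repeated summand has to enter with its
  multiplicity as coefficient.\<close>

lemma sum_list_eq_sum_count:
  fixes ps :: "'a::semiring_1 list"
  assumes "finite A" "set ps \<subseteq> A"
  shows "sum_list ps = (\<Sum>p\<in>A. of_nat (count_list ps p) * p)"
  using assms(2)
proof (induction ps)
  case (Cons a ps)
  have "of_nat (count_list (a # ps) p) * p = (if p = a then a else 0) + of_nat (count_list ps p) * p" for p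
    by (simp add: distrib_right add.commute)
  then have "(\<Sum>p\<in>A. of_nat (count_list (a # ps) p) * p) = a + (\<Sum>p\<in>A. of_nat (count_list ps p) * p)"
    using Cons.prems assms(1) by (simp add: sum.distrib del: count_list.simps)
  then show ?case using Cons by simp
qed simp

lemma linear_combination_if_signed_sum:
  assumes "is_sum_of_at_most k (of_int (sign w) * f) S"
  shows "is_linear_combination f S"
proof -
  obtain ps where ps: "set ps \<subseteq> S" "of_int (sign w) * f = sum_list ps"
    using assms unfolding is_sum_of_at_most_def by blast
  have count: "of_int e * (of_nat m * p) = const_poly (of_int e * of_nat m) * p" for e m and p :: matrix_poly
  proof -
    have "(of_nat m :: matrix_poly) = const_poly (of_nat m)" by (simp add: const_poly_def single_of_nat)
    moreover have "const_poly (of_int e) * const_poly (of_nat m) = const_poly (of_int e * of_nat m)"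
      unfolding const_poly_def mult_single by (simp only: add_0_left)
    ultimately show ?thesis unfolding of_int_matrix_poly by (simp only: mult.assoc[symmetric])
  qed
  have "f = of_int (sign w) * (of_int (sign w) * f)"
    by (cases w rule: sign_cases) simp_all
  also have "\<dots> = of_int (sign w) * (\<Sum>p\<in>set ps. of_nat (count_list ps p) * p)"
    unfolding ps(2) sum_list_eq_sum_count[OF finite_set subset_refl] ..
  also have "\<dots> = (\<Sum>p\<in>set ps. const_poly (of_int (sign w) * of_nat (count_list ps p)) * p)"
    unfolding sum_distrib_left count ..
  finally have "f = (\<Sum>p\<in>set ps. const_poly (of_int (sign w) * of_nat (count_list ps p)) * p)" .
  then show ?thesis
    unfolding is_linear_combination_def using ps(1)
    by (intro exI[of _ "set ps"] exI[of _ "\<lambda>p. of_int (sign w) * of_nat (count_list ps p)"]) simp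
qed

lemma avoids_if_linear_combination:
  assumes "w permutes {1..n}" "avoids_pattern n w [3, 2, 1]"
    and lin: "is_linear_combination (tl_immanant n w) (percent_immanants n)"
  shows "avoids_pattern n w [1, 3, 2, 4]" "avoids_pattern n w [2, 4, 1, 5, 3]"
    "avoids_pattern n w [3, 1, 5, 2, 4]" "avoids_pattern n w [2, 3, 1, 5, 6, 4]"
    "avoids_pattern n w [3, 1, 2, 6, 4, 5]"
proof -
  interpret shape_invariant n w
  proof
    show "w \<in> avoiders_321 n" using assms by (simp add: avoiders_321_def)
  qed (rule linear_combination_invariant[OF lin])
  show "avoids_pattern n w [1, 3, 2, 4]" by (rule avoids_1324)
  show "avoids_pattern n w [2, 4, 1, 5, 3]" by (rule avoids_24153)
  show "avoids_pattern n w [3, 1, 5, 2, 4]" by (rule avoids_31524)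
  show "avoids_pattern n w [2, 3, 1, 5, 6, 4]" by (rule avoids_231564)
  show "avoids_pattern n w [3, 1, 2, 6, 4, 5]" by (rule avoids_312645)
qed

theorem mainTheorem1:
  fixes n :: nat and w :: "nat \<Rightarrow> nat"
  assumes "w permutes {1..n}"
    and "avoids_pattern n w [3, 2, 1]"
  shows
    "(is_linear_combination (tl_immanant n w) (percent_immanants n) \<longleftrightarrow>
      is_sum_of_at_most 2 (of_int (sign w) * tl_immanant n w) (percent_immanants n)) \<and>
     (is_sum_of_at_most 2 (of_int (sign w) * tl_immanant n w) (percent_immanants n) \<longleftrightarrow>
      avoids_pattern n w [1, 3, 2, 4] \<and>
      avoids_pattern n w [2, 4, 1, 5, 3] \<and>
      avoids_pattern n w [3, 1, 5, 2, 4] \<and>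
      avoids_pattern n w [2, 3, 1, 5, 6, 4] \<and>
      avoids_pattern n w [3, 1, 2, 6, 4, 5] \<and>
      avoids_pattern n w [3, 2, 1])"
proof (intro conjI iffI)
  note lin_if = linear_combination_if_signed_sum[of 2 w _ "percent_immanants n"]
    and avoids_if = avoids_if_linear_combination[OF assms]
    and sum_if = is_sum_of_at_most_two[OF signed_tl_immanant_if_avoids[OF assms]]
  let ?lin = "is_linear_combination (tl_immanant n w) (percent_immanants n)"
    and ?sum = "is_sum_of_at_most 2 (of_int (sign w) * tl_immanant n w) (percent_immanants n)"
  show ?sum if ?lin by (intro sum_if avoids_if that)
  show ?lin if ?sum by (intro lin_if that)
  show ?sum if "avoids_pattern n w [1, 3, 2, 4] \<and> avoids_pattern n w [2, 4, 1, 5, 3] \<and>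
      avoids_pattern n w [3, 1, 5, 2, 4] \<and> avoids_pattern n w [2, 3, 1, 5, 6, 4] \<and>
      avoids_pattern n w [3, 1, 2, 6, 4, 5] \<and> avoids_pattern n w [3, 2, 1]"
    using that by (intro sum_if) simp_all
qed (use assms(2) avoids_if_linear_combination[OF assms] linear_combination_if_signed_sum in blast)+

end
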